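(* Let $\mathscr D\subset\mathbb T$ be a set whose boundary has Lebesgue measure zero and with $|\mathscr D|>0$, and let $\varphi\in\mathscr B(\mathbb T)$. For each $q\in\mathbb N$ let $p=p_q$ be chosen uniformly at random from $P_q(\mathscr D)=\{p\in\mathbb Z_q^\times : p/q \bmod 1\in\mathscr D\}$. Then the following convergences in distribution hold: (1) as $q\to\infty$ through integers with $q\equiv 0\bmod 4$ and $q$ not a perfect square: $\big(\frac{g_1(p,q)}{\sqrt q},\frac{g_\varphi(p,q)}{g_1(p,q)}\big)\xrightarrow{d}(X,G^+_\varphi)$; (2) as $q\to\infty$ through integers with $q\equiv 0\bmod 4$ and $q$ a perfect square: $\big(\frac{g_1(p,q)}{\sqrt q},\frac{g_\varphi(p,q)}{g_1(p,q)}\big)\xrightarrow{d}(Z,G^+_\varphi)$; (3) as $q\to\infty$ through odd integers that are not perfect squares: $\big(\frac{g_1(p,q)}{\epsilon_q\sqrt q},\frac{g_\varphi(p,q)}{g_1(p,q)}\big)\xrightarrow{d}(Y,G_\varphi)$; (4) as $q\to\infty$ through odd perfect squares: $\frac{g_\varphi(p,q)}{\epsilon_q\sqrt q}\xrightarrow{d}G_\varphi$; (5) as $q\to\infty$ through integers with $q\equiv 2\bmod 4$ and $q/2$ not a perfect square: $\big(\frac{g_1(2p,q/2)}{\epsilon_{q/2}\sqrt{q/2}},\frac{g_\varphi(p,q)}{2g_1(2p,q/2)}\big)\xrightarrow{d}(Y,G^-_\varphi)$; (6) as $q\to\infty$ through integers with $q\equiv 2\bmod 4$ and $q/2$ a perfect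 square: $\frac{g_\varphi(p,q)}{\epsilon_{q/2}\sqrt{2q}}\xrightarrow{d}G^-_\varphi$.
   Context: $\mathbb T=\mathbb R/\mathbb Z$ with Lebesgue measure $|\cdot|$. For $q\in\mathbb N$, $\mathbb Z_q^\times=\{p\in\{1,\dots,q\}:\gcd(p,q)=1\}$. $e(x)=e^{2\pi i x}$, $e_q(x)=e^{2\pi i x/q}$. For a function $\varphi:\mathbb T\to\mathbb C$ (i.e. 1-periodic on $\mathbb R$) and integers $q\ge1$, $p$, the incomplete Gauss sum is $g_\varphi(p,q)=\sum_{h=0}^{q-1}\varphi(h/q)\,e_q(ph^2)$; $g_1$ denotes the case $\varphi\equiv1$ (classical Gauss sum). $\widehat\varphi_k=\int_0^1\varphi(x)e(-kx)\,dx$ are the Fourier coefficients, and $\mathscr B(\mathbb T)=\{\varphi:\sum_{k\in\mathbb Z}k^2|\widehat\varphi_k|<\infty\}$ (such $\varphi$ equal their Fourier series). For an integer $a$, $\epsilon_a=1$ if $a\equiv1\bmod4$ and $\epsilon_a=i$ if $a\equiv 3\bmod 4$. Random variables: $X$ is uniform on $\{\pm1\pm i\}$; $Y$ is uniform on $\{\pm1\}$; $Z$ is uniform on $\{1+i,1-i\}$; with $x$ uniformly distributed on $\mathbb T$, $G^+_\varphi=\sum_{n\in\mathbb Z}\widehat\varphi_{2n}e(n^2x)$, $G_\varphi=\sum_{n\in\mathbb Z}\widehat\varphi_{n}e(n^2x)$, $G^-_\varphi=\sum_{n\in 2\mathbb Z+1}\widehat\varphi_{n}e(n^2x)$. In each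 limiting pair the two components are independent (e.g. $(X,G^+_\varphi)$ has the product law of $X$ and $G^+_\varphi$). *)

theory Defs
  imports "HOL-Probability.Probability"
begin

definition ee :: "real \<Rightarrow> complex" where
  "ee x = cis (2 * pi * x)"

text \<open>Incomplete Gauss sum g_phi(p,q) = sum_{h=0}^{q-1} phi(h/q) e_q(p h^2).
  A function on T is a 1-periodic function on the reals.\<close>
definition gauss :: "(real \<Rightarrow> complex) \<Rightarrow> int \<Rightarrow> nat \<Rightarrow> complex" where
  "gauss \<phi> p q = (\<Sum>h<q. \<phi> (real h / real q) * ee (real_of_int p * real h ^ 2 / real q))"

definition gauss1 :: "int \<Rightarrow> nat \<Rightarrow> complex" where
  "gauss1 p q = gauss (\<lambda>_. 1) p q"

definition fourier_coeff :: "(real \<Rightarrow> complex) \<Rightarrow> int \<Rightarrow> complex" where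
  "fourier_coeff \<phi> k = integral {0..1} (\<lambda>x. \<phi> x * ee (- (real_of_int k * x)))"

definition BT :: "(real \<Rightarrow> complex) set" where
  "BT = {\<phi>. (\<forall>x. \<phi> (x + 1) = \<phi> x) \<and> continuous_on UNIV \<phi> \<and>
            (\<lambda>k::int. of_int (k ^ 2) * norm (fourier_coeff \<phi> k)) summable_on (UNIV :: int set)}"

definition eps :: "nat \<Rightarrow> complex" where
  "eps a = (if a mod 4 = 1 then 1 else if a mod 4 = 3 then \<i> else 0)"

definition is_square :: "nat \<Rightarrow> bool" where
  "is_square q \<longleftrightarrow> (\<exists>k. q = k ^ 2)"

text \<open>P_q(D): D is a subset of T represented as a subset of [0,1); p/q mod 1 is frac(p/q).\<close>
definition Pset :: "real set \<Rightarrow> nat \<Rightarrow> int set" where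
  "Pset D q = {p. 1 \<le> p \<and> p \<le> int q \<and> coprime p (int q) \<and> frac (real_of_int p / real q) \<in> D}"

definition Gplus :: "(real \<Rightarrow> complex) \<Rightarrow> real \<Rightarrow> complex" where
  "Gplus \<phi> x = (\<Sum>\<^sub>\<infinity>n::int. fourier_coeff \<phi> (2 * n) * ee (real_of_int (n ^ 2) * x))"

definition Gfull :: "(real \<Rightarrow> complex) \<Rightarrow> real \<Rightarrow> complex" where
  "Gfull \<phi> x = (\<Sum>\<^sub>\<infinity>n::int. fourier_coeff \<phi> n * ee (real_of_int (n ^ 2) * x))"

definition Gminus :: "(real \<Rightarrow> complex) \<Rightarrow> real \<Rightarrow> complex" where
  "Gminus \<phi> x = (\<Sum>\<^sub>\<infinity>n\<in>{n::int. odd n}. fourier_coeff \<phi> n * ee (real_of_int (n ^ 2) * x))"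

definition unifT :: "real measure" where
  "unifT = uniform_measure lborel {0..<1}"

definition lawX :: "complex pmf" where
  "lawX = pmf_of_set {1 + \<i>, 1 - \<i>, -1 + \<i>, -1 - \<i>}"
definition lawY :: "complex pmf" where
  "lawY = pmf_of_set {1, -1}"
definition lawZ :: "complex pmf" where
  "lawZ = pmf_of_set {1 + \<i>, 1 - \<i>}"

definition conv_distr :: "('b \<Rightarrow> 'a::topological_space measure) \<Rightarrow> 'a measure \<Rightarrow> 'b filter \<Rightarrow> bool" where
  "conv_distr \<mu> \<nu> F \<longleftrightarrow>
     (\<forall>f :: 'a \<Rightarrow> real. continuous_on UNIV f \<longrightarrow> bounded (range f) \<longrightarrow>
        ((\<lambda>n. \<integral>x. f x \<partial>(\<mu> n)) \<longlongrightarrow> (\<integral>x. f x \<partial>\<nu>)) F)"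

definition law_q :: "real set \<Rightarrow> (nat \<Rightarrow> int \<Rightarrow> 'a) \<Rightarrow> nat \<Rightarrow> 'a measure" where
  "law_q D F q = measure_pmf (map_pmf (F q) (pmf_of_set (Pset D q)))"

end

theory Submission
  imports Defs "HOL-Number_Theory.Number_Theory" "HOL-Computational_Algebra.Squarefree"
begin

text \<open>
  Expanding \<open>\<phi>\<close> in its Fourier series and completing the square gives
  \<open>g\<^sub>\<phi>(p,q) = g\<^sub>1(p,q) G(c\<^sub>q p\<^sup>*/q)\<close>, where \<open>p\<^sup>*\<close> is the inverse of \<open>p\<close> modulo \<open>q\<close> and
  \<open>gcd(c\<^sub>q, q) \<le> 2\<close>; only even (odd) frequencies survive if \<open>q\<close> is \<open>0\<close> (\<open>2\<close>) modulo \<open>4\<close>. So it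
  suffices that \<open>(p/q, c\<^sub>q p\<^sup>*/q)\<close> equidistributes on the torus, jointly with the normalised sum
  \<open>g\<^sub>1\<close>, which takes at most four values.

  The set where \<open>g\<^sub>1\<close> has a given value is invariant under multiplication by squares. Hence the
  Weyl sums are Kloosterman sums with a twist that is constant on cosets of the squares, and
  Kloosterman's argument applies: dilating by squares, such a sum occurs many times in the fourth
  moment over all frequencies, and the fourth moment counts solutions of
  \<open>(x + y)(x - z)(y - z) = 0\<close> modulo \<open>q\<close>. With the divisor bound this beats \<open>totient q\<close>.

  The zero frequency requires the exact distribution of \<open>g\<^sub>1\<close> over the units. Its square is
  computed by multiplicativity in \<open>q\<close>, and the mean of \<open>g\<^sub>1\<close> by Moebius inversion; the mean is zero
  unless \<open>q\<close> is a square, in which case it is so large that \<open>g\<^sub>1\<close> cannot change sign.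
\<close>

section \<open>Exponentials and residue systems\<close>

text \<open>In exponents: up to powers of \<open>divisor_count\<close>, \<open>totient q\<close>
  times the fourth power of a sum is at most a fibre bound q^(1/2) times a fourth moment q^(3 +
  4/3), so each sum is at most about q^(23/24). Against \<open>totient q\<close> any fixed power
  saving suffices, and so crude counting is enough in both factors. The obstacle is that q runs
  through all integers of a class: dilation and counting treat composite moduli uniformly, without a
  factorisation of the twist. Asymptotic independence of the two components needs no separate
  argument. The twist is the indicator of one value of the normalised Gauss sum, and its weighted
  averages tend to its mean times an integral over the torus. That mean is the same for every q of
  the class, and there are finitely many values, so summing over them gives the joint law. The set D
  enters only through p/q: its null frontier allows its indicator to be squeezed between continuous
  periodic functions that are close in mean.\<close>

lemma ee_add: "ee (x + y) = ee x * ee y"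
  by (simp add: ee_def cis_mult distrib_left)

lemma ee_uminus: "ee (- x) = cnj (ee x)"
  by (simp add: ee_def cis_cnj)

lemma norm_ee [simp]: "norm (ee x) = 1"
  by (simp add: ee_def)

lemma ee_0 [simp]: "ee 0 = 1"
  by (simp add: ee_def)

lemma ee_of_int [simp]: "ee (of_int k) = 1"
  using cis_multiple_2pi[of "of_int k"] by (simp add: ee_def)

lemma ee_eq_1_iff: "ee x = 1 \<longleftrightarrow> x \<in> \<int>"
proof
  assume "ee x = 1"
  hence "cos (2 * pi * x) = 1" by (simp add: ee_def complex_eq_iff)
  then obtain k :: int where "2 * pi * x = of_int k * 2 * pi"
    by (auto simp: cos_one_2pi_int)
  hence "x = of_int k" by simp
  thus "x \<in> \<int>" by simp
qed (auto elim!: Ints_cases)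

lemma ee_power: "ee x ^ n = ee (real n * x)"
  by (simp add: ee_def Complex.DeMoivre mult_ac)

text \<open>The \<open>e_q\<close> of the statement on integer arguments, where it depends only on
  the residue class modulo \<open>q\<close>.\<close>

definition em :: "nat \<Rightarrow> int \<Rightarrow> complex" where
  "em q a = ee (of_int a / real q)"

lemma em_add: "em q (a + b) = em q a * em q b"
  by (simp add: em_def add_divide_distrib ee_add)

lemma em_uminus: "em q (- a) = cnj (em q a)"
  by (simp add: em_def ee_uminus)

lemma em_diff: "em q (a - b) = em q a * cnj (em q b)"
  using em_add[of q a "-b"] by (simp add: em_uminus)

lemma norm_em [simp]: "norm (em q a) = 1"
  by (simp add: em_def)

lemma em_0 [simp]: "em q 0 = 1"
  by (simp add: em_def)

lemma em_eq_1_iff: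
  assumes "q > 0"
  shows "em q a = 1 \<longleftrightarrow> int q dvd a"
proof
  assume "em q a = 1"
  then obtain k :: int where "of_int a / real q = of_int k"
    by (auto simp: em_def ee_eq_1_iff elim: Ints_cases)
  hence "real_of_int a = real_of_int (k * int q)"
    using assms by (simp add: field_simps)
  hence "a = k * int q" by linarith
  thus "int q dvd a" by simp
next
  assume "int q dvd a"
  then obtain k where "a = int q * k" by auto
  thus "em q a = 1" using assms by (simp add: em_def)
qed

lemma em_cong:
  assumes "[a = b] (mod int q)"
  shows "em q a = em q b"
proof (cases "q = 0")
  case False
  have "em q (a - b) = 1"
    using assms False by (simp add: em_eq_1_iff cong_iff_dvd_diff)
  thus ?thesis using em_add[of q "a - b" b] by simp
qed (use assms in \<open>simp add: em_def\<close>)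

lemma em_mult_left:
  assumes "c > 0"
  shows "em (c * q) (int c * a) = em q a"
  using assms by (simp add: em_def)

lemma em_power: "em q a ^ n = em q (int n * a)"
  by (simp add: em_def ee_power)

text \<open>Equal cardinality and injectivity modulo \<open>q\<close> make a choice of
  representatives in \<open>B\<close> surjective. Changes of variables over complete or reduced
  residue systems therefore never have to check surjectivity.\<close>

lemma sum_reindex_cong_mod:
  fixes f :: "int \<Rightarrow> 'a::comm_monoid_add" and q :: int
  assumes per: "\<And>x y. [x = y] (mod q) \<Longrightarrow> f x = f y"
    and fin: "finite B" and card: "card I = card B"
    and ex: "\<And>i. i \<in> I \<Longrightarrow> \<exists>b\<in>B. [g i = b] (mod q)"
    and inj: "\<And>i j. i \<in> I \<Longrightarrow> j \<in> I \<Longrightarrow> [g i = g j] (mod q) \<Longrightarrow> i = j"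
  shows "(\<Sum>i\<in>I. f (g i)) = sum f B"
proof -
  obtain r where r: "\<And>i. i \<in> I \<Longrightarrow> r i \<in> B \<and> [g i = r i] (mod q)"
    using ex by metis
  have inj_r: "inj_on r I"
  proof (rule inj_onI)
    fix i j assume ij: "i \<in> I" "j \<in> I" "r i = r j"
    hence "[g i = g j] (mod q)"
      using r[of i] r[of j] by (metis cong_sym cong_trans)
    thus "i = j" using inj ij by blast
  qed
  have "r ` I = B"
    by (rule card_subset_eq) (use fin r card card_image[OF inj_r] in auto)
  hence "sum f B = (\<Sum>i\<in>I. f (r i))"
    using sum.reindex[OF inj_r, of f] by simp
  also have "\<dots> = (\<Sum>i\<in>I. f (g i))"
    by (intro sum.cong refl per) (use r cong_sym in blast)
  finally show ?thesis ..
qed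

lemma cong_mod_self: "[x = x mod q] (mod (q::int))"
  by (simp add: cong_def)

lemma ex_residue_atLeastLessThan: "q > 0 \<Longrightarrow> \<exists>b\<in>{0..<int q}. [x = b] (mod int q)"
  by (rule bexI[of _ "x mod int q"]) (auto simp: cong_mod_self)

lemma sum_residues:
  fixes f :: "int \<Rightarrow> 'a::comm_monoid_add"
  assumes "q > 0"
    and "\<And>x y. [x = y] (mod int q) \<Longrightarrow> f x = f y"
    and "card I = q"
    and "\<And>i j. i \<in> I \<Longrightarrow> j \<in> I \<Longrightarrow> [g i = g j] (mod int q) \<Longrightarrow> i = j"
  shows "(\<Sum>i\<in>I. f (g i)) = sum f {0..<int q}"
  by (rule sum_reindex_cong_mod[where q = "int q"])
    (use assms ex_residue_atLeastLessThan in auto)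

lemma sum_int_interval: "(\<Sum>h<q. f (int h)) = sum f {0..<int q}"
proof -
  have "{0..<int q} = int ` {..<q}"
    using image_int_atLeastLessThan[of 0 q] by (simp add: lessThan_atLeast0)
  thus ?thesis by (simp add: sum.reindex)
qed

lemma cong_interval_eq:
  assumes "x \<in> {0..<int q}" "y \<in> {0..<int q}" "[x = y] (mod int q)"
  shows "x = y"
  using assms by (auto simp: cong_def)

lemma sum_em:
  assumes "q > 0"
  shows "(\<Sum>a\<in>{0..<int q}. em q (a * n)) = (if int q dvd n then of_nat q else 0)"
proof -
  have "(\<Sum>a\<in>{0..<int q}. em q (a * n)) = (\<Sum>h<q. em q n ^ h)"
    by (subst sum_int_interval[symmetric]) (simp add: em_power)
  also have "\<dots> = (if int q dvd n then of_nat q else 0)"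
  proof (cases "int q dvd n")
    case True
    thus ?thesis using assms em_eq_1_iff[of q n] by simp
  next
    case False
    hence ne: "em q n \<noteq> 1" using assms em_eq_1_iff by blast
    have "em q n ^ q = 1"
      using assms by (simp add: em_power em_eq_1_iff)
    thus ?thesis using False ne by (simp add: geometric_sum)
  qed
  finally show ?thesis .
qed

section \<open>Reduced residue systems\<close>

definition units_mod :: "nat \<Rightarrow> int set" where
  "units_mod q = {p. 1 \<le> p \<and> p \<le> int q \<and> coprime p (int q)}"

lemma units_mod_conv_totatives: "units_mod q = int ` totatives q"
proof -
  have "x \<in> int ` totatives q" if "x \<in> units_mod q" for x
    using that by (intro image_eqI[of _ _ "nat x"])
      (auto simp: units_mod_def in_totatives_iff simp flip: coprime_int_iff)
  thus ?thesis by (auto simp: units_mod_def in_totatives_iff)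
qed

lemma finite_units_mod [simp]: "finite (units_mod q)"
  by (simp add: units_mod_conv_totatives)

lemma card_units_mod: "card (units_mod q) = totient q"
  by (simp add: units_mod_conv_totatives card_image totient_def)

lemma units_modD: "p \<in> units_mod q \<Longrightarrow> coprime p (int q)"
  by (simp add: units_mod_def)

lemma units_mod_cong_eq:
  assumes "x \<in> units_mod q" "y \<in> units_mod q" "[x = y] (mod int q)"
  shows "x = y"
proof -
  have "[x - 1 = y - 1] (mod int q)" using assms(3) by (simp add: cong_diff)
  hence "x - 1 = y - 1"
    using assms by (intro cong_interval_eq[of _ q]) (auto simp: units_mod_def)
  thus ?thesis by simp
qed

lemma ex_unit_mod:
  assumes "q > 0" "coprime x (int q)"
  shows "\<exists>b\<in>units_mod q. [x = b] (mod int q)"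
proof -
  define b where "b = (x - 1) mod int q + 1"
  have c: "[x = b] (mod int q)"
    using cong_add[OF cong_mod_self[of "x - 1" "int q"] cong_refl[of 1]] by (simp add: b_def)
  have "b \<le> int q" "b \<ge> 1"
    using assms pos_mod_bound[of "int q" "x - 1"] pos_mod_sign[of "int q" "x - 1"]
    unfolding b_def by linarith+
  hence "b \<in> units_mod q"
    using assms cong_imp_coprime[OF c] by (simp add: units_mod_def)
  thus ?thesis using c by blast
qed

lemma sum_units_mod:
  fixes f :: "int \<Rightarrow> 'a::comm_monoid_add"
  assumes "q > 0"
    and "\<And>x y. [x = y] (mod int q) \<Longrightarrow> f x = f y"
    and "card I = totient q"
    and "\<And>i. i \<in> I \<Longrightarrow> coprime (g i) (int q)"
    and "\<And>i j. i \<in> I \<Longrightarrow> j \<in> I \<Longrightarrow> [g i = g j] (mod int q) \<Longrightarrow> i = j"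
  shows "(\<Sum>i\<in>I. f (g i)) = sum f (units_mod q)"
  by (rule sum_reindex_cong_mod[where q = "int q"])
    (use assms ex_unit_mod in \<open>auto simp: card_units_mod\<close>)

lemma sum_units_mod_mult:
  fixes f :: "int \<Rightarrow> 'a::comm_monoid_add"
  assumes "q > 0" and "\<And>x y. [x = y] (mod int q) \<Longrightarrow> f x = f y" and "coprime c (int q)"
  shows "(\<Sum>p\<in>units_mod q. f (c * p)) = sum f (units_mod q)"
proof (rule sum_units_mod)
  fix i j assume "i \<in> units_mod q" "j \<in> units_mod q" "[c * i = c * j] (mod int q)"
  thus "i = j" using assms(3) units_mod_cong_eq by (metis cong_mult_lcancel coprime_commute)
qed (use assms in \<open>auto simp: card_units_mod units_modD\<close>)

section \<open>Classical Gauss sums\<close>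

lemma gauss1_em: "gauss1 p q = (\<Sum>h\<in>{0..<int q}. em q (p * h\<^sup>2))"
  by (subst sum_int_interval[symmetric]) (simp add: gauss1_def gauss_def em_def)

lemma em_quadratic_cong:
  "[x = y] (mod int q) \<Longrightarrow> em q (p * x\<^sup>2 + k * x) = em q (p * y\<^sup>2 + k * y)"
  by (intro em_cong cong_add cong_mult cong_pow cong_refl)

lemma gauss1_residues:
  assumes "q > 0" "card I = q"
    and "\<And>i j. i \<in> I \<Longrightarrow> j \<in> I \<Longrightarrow> [g i = g j] (mod int q) \<Longrightarrow> i = j"
  shows "(\<Sum>i\<in>I. em q (p * (g i)\<^sup>2)) = gauss1 p q"
  unfolding gauss1_em
  by (rule sum_residues) (use assms em_quadratic_cong[where k = 0] in auto)

lemma gauss1_cong: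
  "[p = p'] (mod int q) \<Longrightarrow> gauss1 p q = gauss1 p' q"
  unfolding gauss1_em by (intro sum.cong em_cong cong_mult cong_refl refl)

text \<open>Substitute h -> v h. This is why the set of p on which the Gauss sum has a given value
  is invariant under multiplication by squares of units.\<close>

lemma gauss1_mult_square:
  assumes "coprime v (int q)" "q > 0"
  shows "gauss1 (p * v\<^sup>2) q = gauss1 p q"
proof -
  have "gauss1 (p * v\<^sup>2) q = (\<Sum>h\<in>{0..<int q}. em q (p * (v * h)\<^sup>2))"
    by (simp add: gauss1_em power_mult_distrib mult_ac)
  also have "\<dots> = gauss1 p q"
  proof (rule gauss1_residues)
    fix i j assume ij: "i \<in> {0..<int q}" "j \<in> {0..<int q}" "[v * i = v * j] (mod int q)"
    thus "i = j" using assms(1) cong_interval_eq by (metis cong_mult_lcancel)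
  qed (use assms in auto)
  finally show ?thesis .
qed

lemma gauss1_uminus: "gauss1 (- p) q = cnj (gauss1 p q)"
  by (simp add: gauss1_em em_uminus)

section \<open>Reduction of the modulus\<close>

text \<open>Writing h = q2 x + q1 y, the cross term of the square is divisible by q1 q2, so the sum
  decouples.\<close>

lemma gauss1_mult_coprime:
  assumes "coprime q1 q2" "q1 > 0" "q2 > 0"
  shows "gauss1 p (q1 * q2) = gauss1 (p * int q1) q2 * gauss1 (p * int q2) q1"
proof -
  let ?I = "{0..<int q1} \<times> {0..<int q2}"
  have split: "em (q1 * q2) (p * (int q2 * x + int q1 * y)\<^sup>2) =
      em q1 (p * int q2 * x\<^sup>2) * em q2 (p * int q1 * y\<^sup>2)" for x y
  proof -
    have "em (q1 * q2) (p * (int q2 * x + int q1 * y)\<^sup>2) =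
        em (q1 * q2) (int q2 * (p * int q2 * x\<^sup>2) + int q1 * (p * int q1 * y\<^sup>2))"
    proof (rule em_cong)
      have "p * (int q2 * x + int q1 * y)\<^sup>2 -
          (int q2 * (p * int q2 * x\<^sup>2) + int q1 * (p * int q1 * y\<^sup>2)) = int (q1 * q2) * (2 * p * x * y)"
        by (simp add: power2_eq_square algebra_simps)
      thus "[p * (int q2 * x + int q1 * y)\<^sup>2 =
          int q2 * (p * int q2 * x\<^sup>2) + int q1 * (p * int q1 * y\<^sup>2)] (mod int (q1 * q2))"
        unfolding cong_iff_dvd_diff by (metis dvd_triv_left)
    qed
    thus ?thesis
      using em_mult_left[of q1 q2] em_mult_left[of q2 q1] assms
      by (simp add: em_add mult.commute[of q2 q1])
  qed
  have "gauss1 p (q1 * q2) = (\<Sum>i\<in>?I. em (q1 * q2) (p * (int q2 * fst i + int q1 * snd i)\<^sup>2))"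
  proof (rule gauss1_residues[symmetric])
    fix i j assume ij: "i \<in> ?I" "j \<in> ?I"
      and c: "[int q2 * fst i + int q1 * snd i = int q2 * fst j + int q1 * snd j] (mod int (q1 * q2))"
    have "[int q2 * fst i + int q1 * snd i = int q2 * fst j + int q1 * snd j] (mod int q1)"
      using cong_modulus_mult[of _ _ "int q1" "int q2"] c by simp
    hence "[int q2 * fst i = int q2 * fst j] (mod int q1)"
      by (simp add: cong_def)
    hence "[fst i = fst j] (mod int q1)"
      using assms by (metis cong_mult_lcancel coprime_commute coprime_int_iff)
    moreover have "[int q2 * fst i + int q1 * snd i = int q2 * fst j + int q1 * snd j] (mod int q2)"
      using cong_modulus_mult[of _ _ "int q2" "int q1"] c by (simp add: mult.commute)
    hence "[int q1 * snd i = int q1 * snd j] (mod int q2)"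
      by (simp add: cong_def)
    hence "[snd i = snd j] (mod int q2)"
      using assms by (metis cong_mult_lcancel coprime_int_iff)
    ultimately show "i = j"
      using ij cong_interval_eq[of "fst i" q1 "fst j"] cong_interval_eq[of "snd i" q2 "snd j"]
      by (auto simp: prod_eq_iff)
  qed (use assms in auto)
  also have "\<dots> = (\<Sum>i\<in>?I. em q1 (p * int q2 * (fst i)\<^sup>2) * em q2 (p * int q1 * (snd i)\<^sup>2))"
    by (simp only: split)
  also have "\<dots> = gauss1 (p * int q2) q1 * gauss1 (p * int q1) q2"
    by (simp add: gauss1_em sum_product sum.cartesian_product case_prod_beta)
  finally show ?thesis by (simp add: mult.commute)
qed

text \<open>Useful when the summand depends on \<open>b\<close> through a linear character or not at
  all, so that the inner sum can be evaluated.\<close>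

lemma gauss1_split_residues:
  assumes "m > 0" "c > 0"
  shows "gauss1 p (c * m) =
    (\<Sum>a\<in>{0..<int m}. \<Sum>b\<in>{0..<int c}. em (c * m) (p * (a + int m * b)\<^sup>2))"
proof -
  let ?I = "{0..<int m} \<times> {0..<int c}"
  have "(\<Sum>i\<in>?I. em (c * m) (p * (fst i + int m * snd i)\<^sup>2)) = gauss1 p (c * m)"
  proof (rule gauss1_residues)
    fix i j assume ij: "i \<in> ?I" "j \<in> ?I"
      and c: "[fst i + int m * snd i = fst j + int m * snd j] (mod int (c * m))"
    have "[fst i + int m * snd i = fst j + int m * snd j] (mod int m)"
      using cong_modulus_mult[of _ _ "int m" "int c"] c by (simp add: mult.commute)
    hence "[fst i = fst j] (mod int m)"
      by (simp add: cong_def)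
    hence f: "fst i = fst j" using ij cong_interval_eq[of "fst i" m "fst j"] by auto
    have "int m * int c dvd int m * (snd i - snd j)"
      using c f by (simp add: cong_iff_dvd_diff algebra_simps)
    hence "[snd i = snd j] (mod int c)"
      using assms by (simp add: cong_iff_dvd_diff)
    hence "snd i = snd j" using ij cong_interval_eq[of "snd i" c "snd j"] by auto
    thus "i = j" using f by (simp add: prod_eq_iff)
  qed (use assms in auto)
  thus ?thesis by (simp add: sum.cartesian_product case_prod_beta)
qed

lemma sum_multiples_interval:
  fixes F :: "int \<Rightarrow> 'a::comm_monoid_add"
  assumes "l > 0"
  shows "(\<Sum>a\<in>{0..<int (l * n)}. if int l dvd a then F a else 0) = (\<Sum>a\<in>{0..<int n}. F (int l * a))"
proof -
  have "{a \<in> {0..<int (l * n)}. int l dvd a} = (\<lambda>a. int l * a) ` {0..<int n}"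
    using assms by (auto elim!: dvdE simp: zero_le_mult_iff)
  moreover have "inj_on (\<lambda>a. int l * a) {0..<int n}"
    using assms by (auto simp: inj_on_def)
  ultimately show ?thesis
    by (simp add: sum.inter_filter[symmetric] sum.reindex)
qed

text \<open>With h = a + l n b the quadratic term in b vanishes modulo l^2 n, and the remaining
  linear character of b kills every a that is not a multiple of l.\<close>

lemma gauss1_square_mult:
  assumes "odd l" "coprime p (int l)" "l > 0" "n > 0"
  shows "gauss1 p (l\<^sup>2 * n) = of_nat l * gauss1 p n"
proof -
  have q: "l\<^sup>2 * n = l * (l * n)" by (simp add: power2_eq_square)
  have inner: "(\<Sum>b\<in>{0..<int l}. em (l * (l * n)) (p * (a + int (l * n) * b)\<^sup>2)) =
      (if int l dvd a then em (l * (l * n)) (p * a\<^sup>2) * of_nat l else 0)" for a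
  proof -
    have "em (l * (l * n)) (p * (a + int (l * n) * b)\<^sup>2) =
        em (l * (l * n)) (p * a\<^sup>2) * em l (b * (2 * p * a))" for b
    proof -
      have "em (l * (l * n)) (p * (a + int (l * n) * b)\<^sup>2) =
          em (l * (l * n)) (p * a\<^sup>2 + int (l * n) * (b * (2 * p * a)))"
      proof (rule em_cong)
        have "p * (a + int (l * n) * b)\<^sup>2 - (p * a\<^sup>2 + int (l * n) * (b * (2 * p * a))) =
            int (l * (l * n)) * (p * int n * b\<^sup>2)"
          by (simp add: power2_eq_square algebra_simps)
        thus "[p * (a + int (l * n) * b)\<^sup>2 = p * a\<^sup>2 + int (l * n) * (b * (2 * p * a))]
            (mod int (l * (l * n)))"
          unfolding cong_iff_dvd_diff by (metis dvd_triv_left)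
      qed
      thus ?thesis using em_mult_left[of "l * n" l "b * (2 * p * a)"] assms
        by (simp add: em_add mult_ac)
    qed
    moreover have "int l dvd 2 * p * a \<longleftrightarrow> int l dvd a"
      using assms by (simp add: coprime_dvd_mult_right_iff coprime_commute)
    ultimately show ?thesis
      using sum_em[of l "2 * p * a"] assms by (simp add: sum_distrib_left[symmetric])
  qed
  have "gauss1 p (l\<^sup>2 * n) =
      (\<Sum>a\<in>{0..<int (l * n)}. if int l dvd a then em (l * (l * n)) (p * a\<^sup>2) * of_nat l else 0)"
    unfolding q by (subst gauss1_split_residues) (use assms in \<open>simp_all only: inner, simp_all\<close>)
  also have "\<dots> = (\<Sum>a\<in>{0..<int n}. em (l * (l * n)) (p * (int l * a)\<^sup>2) * of_nat l)"
    using sum_multiples_interval[of l "\<lambda>a. em (l * (l * n)) (p * a\<^sup>2) * of_nat l" n] assms by simp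
  also have "\<dots> = (\<Sum>a\<in>{0..<int n}. em n (p * a\<^sup>2) * of_nat l)"
  proof (intro sum.cong refl)
    fix a
    show "em (l * (l * n)) (p * (int l * a)\<^sup>2) * of_nat l = em n (p * a\<^sup>2) * of_nat l"
      using em_mult_left[of "l * l" n "p * a\<^sup>2"] assms by (simp add: power2_eq_square mult_ac)
  qed
  also have "\<dots> = of_nat l * gauss1 p n"
    by (simp add: gauss1_em sum_distrib_left mult.commute)
  finally show ?thesis .
qed

text \<open>The prime 2 behaves differently from odd l because of the factor 2 in the cross term:
  with h = a + n b and b modulo 4, the sum over b only forces a to be even. This leaves 4 times a
  sum over half of the residues modulo n.\<close>

lemma gauss1_four_mult:
  assumes "odd p" "4 dvd n" "n > 0"
  shows "gauss1 p (4 * n) = 2 * gauss1 p n"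
proof -
  obtain k where k: "n = 4 * k" using assms by auto
  define m where "m = 2 * k"
  have nm: "n = 2 * m" "even m" "m > 0" using k assms by (auto simp: m_def)
  have inner: "(\<Sum>b\<in>{0..<int 4}. em (4 * n) (p * (a + int n * b)\<^sup>2)) =
      (if int 2 dvd a then em (4 * n) (p * a\<^sup>2) * 4 else 0)" for a
  proof -
    have s: "em (4 * n) (p * (a + int n * b)\<^sup>2) = em (4 * n) (p * a\<^sup>2) * em 4 (b * (2 * p * a))" for b
    proof -
      have "em (4 * n) (p * (a + int n * b)\<^sup>2) = em (4 * n) (p * a\<^sup>2 + int n * (b * (2 * p * a)))"
      proof (rule em_cong)
        have "p * (a + int n * b)\<^sup>2 - (p * a\<^sup>2 + int n * (b * (2 * p * a))) =
            int (4 * n) * (p * int k * b\<^sup>2)"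
          by (simp add: k power2_eq_square algebra_simps)
        thus "[p * (a + int n * b)\<^sup>2 = p * a\<^sup>2 + int n * (b * (2 * p * a))] (mod int (4 * n))"
          unfolding cong_iff_dvd_diff by (metis dvd_triv_left)
      qed
      thus ?thesis using em_mult_left[of n 4 "b * (2 * p * a)"] assms
        by (simp add: em_add mult_ac)
    qed
    have "int 4 dvd 2 * p * a \<longleftrightarrow> 2 * 2 dvd 2 * (p * a)" by (simp add: mult.assoc)
    also have "\<dots> \<longleftrightarrow> even (p * a)" unfolding dvd_mult_cancel_left by simp
    finally have "int 4 dvd 2 * p * a \<longleftrightarrow> even (p * a)" .
    hence "int 4 dvd 2 * p * a \<longleftrightarrow> int 2 dvd a" using assms(1) by simp
    thus ?thesis unfolding s sum_distrib_left[symmetric]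
      using sum_em[of 4 "2 * p * a"] by simp
  qed
  have "gauss1 p (4 * n) = (\<Sum>a\<in>{0..<int n}. if int 2 dvd a then em (4 * n) (p * a\<^sup>2) * 4 else 0)"
    using gauss1_split_residues[of n 4 p] assms unfolding inner by simp
  also have "\<dots> = (\<Sum>a\<in>{0..<int m}. em (4 * n) (p * (int 2 * a)\<^sup>2) * 4)"
    using sum_multiples_interval[of 2 "\<lambda>a. em (4 * n) (p * a\<^sup>2) * 4" m] nm by simp
  also have "\<dots> = 4 * (\<Sum>a\<in>{0..<int m}. em n (p * a\<^sup>2))"
    unfolding sum_distrib_left
  proof (rule sum.cong[OF refl])
    fix a
    show "em (4 * n) (p * (int 2 * a)\<^sup>2) * 4 = 4 * em n (p * a\<^sup>2)"
      using em_mult_left[of 4 n "p * a\<^sup>2"] by (simp add: power_mult_distrib mult_ac)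
  qed
  finally have g4: "gauss1 p (4 * n) = 4 * (\<Sum>a\<in>{0..<int m}. em n (p * a\<^sup>2))" .
  \<comment> \<open>Since \<open>4 dvd n\<close>, already \<open>m = n / 2\<close> is a period, so
    the half sum in \<open>g4\<close> is half of \<open>gauss1 p n\<close>.\<close>
  have "em (2 * m) (p * (a + int m * b)\<^sup>2) = em (2 * m) (p * a\<^sup>2)" for a b
  proof (rule em_cong)
    have "p * (a + int m * b)\<^sup>2 - p * a\<^sup>2 = int (2 * m) * (p * a * b + p * int k * b\<^sup>2)"
      by (simp add: m_def power2_eq_square algebra_simps)
    thus "[p * (a + int m * b)\<^sup>2 = p * a\<^sup>2] (mod int (2 * m))"
      unfolding cong_iff_dvd_diff by (metis dvd_triv_left)
  qed
  hence "gauss1 p n = 2 * (\<Sum>a\<in>{0..<int m}. em n (p * a\<^sup>2))"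
    unfolding nm(1) by (subst gauss1_split_residues) (use nm in \<open>simp_all add: sum_distrib_left\<close>)
  thus ?thesis using g4 by simp
qed

section \<open>Absolute value and square of the Gauss sum\<close>

text \<open>Shift the variable of the first factor by the variable k of the second. The exponent
  becomes linear in k, and since 2 p is a unit the sum over k is nonzero only for u = 0.\<close>

lemma gauss1_times_cnj:
  assumes "odd q" "coprime p (int q)"
  shows "gauss1 p q * cnj (gauss1 p q) = of_nat q"
proof -
  have q: "q > 0" using assms(1) by (cases q) auto
  let ?R = "{0..<int q}"
  have shift: "gauss1 p q = (\<Sum>u\<in>?R. em q (p * (k + u)\<^sup>2))" for k
    by (rule gauss1_residues[symmetric])
       (use q cong_interval_eq in \<open>auto simp: cong_add_lcancel\<close>)
  have "gauss1 p q * cnj (gauss1 p q) = (\<Sum>k\<in>?R. gauss1 p q * cnj (em q (p * k\<^sup>2)))"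
    by (subst (2) gauss1_em) (simp add: sum_distrib_left)
  also have "\<dots> = (\<Sum>k\<in>?R. \<Sum>u\<in>?R. em q (p * u\<^sup>2) * em q (k * (2 * p * u)))"
  proof (rule sum.cong[OF refl])
    fix k
    have "em q (p * (k + u)\<^sup>2) * cnj (em q (p * k\<^sup>2)) = em q (p * u\<^sup>2) * em q (k * (2 * p * u))" for u
      unfolding em_diff[symmetric] em_add[symmetric]
      by (rule arg_cong[where f = "em q"]) (simp add: power2_eq_square algebra_simps)
    thus "gauss1 p q * cnj (em q (p * k\<^sup>2)) = (\<Sum>u\<in>?R. em q (p * u\<^sup>2) * em q (k * (2 * p * u)))"
      by (subst shift[of k]) (simp add: sum_distrib_right)
  qed
  also have "\<dots> = (\<Sum>u\<in>?R. em q (p * u\<^sup>2) * (\<Sum>k\<in>?R. em q (k * (2 * p * u))))"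
    by (subst sum.swap) (simp add: sum_distrib_left)
  also have "\<dots> = (\<Sum>u\<in>?R. if u = 0 then of_nat q else 0)"
  proof (rule sum.cong[OF refl])
    fix u assume u: "u \<in> ?R"
    have "int q dvd 2 * p * u \<longleftrightarrow> int q dvd u"
      using assms by (simp add: coprime_dvd_mult_right_iff coprime_commute)
    also have "\<dots> \<longleftrightarrow> u = 0" using u by (auto dest: zdvd_imp_le)
    finally show "em q (p * u\<^sup>2) * (\<Sum>k\<in>?R. em q (k * (2 * p * u))) = (if u = 0 then of_nat q else 0)"
      using sum_em[OF q, of "2 * p * u"] by auto
  qed
  also have "\<dots> = of_nat q" using q by (simp add: sum.delta)
  finally show ?thesis .
qed


lemma prime_cong_eq_0_iff:
  assumes "prime l" "h \<in> {- int ((l - 1) div 2)..int ((l - 1) div 2)}"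
  shows "int l dvd h \<longleftrightarrow> h = 0"
proof -
  have l: "l > 1" using assms prime_gt_1_nat by blast
  have "\<bar>h\<bar> \<le> int ((l - 1) div 2)" using assms(2) by auto
  also have "\<dots> < int l" using l by linarith
  finally have "\<bar>h\<bar> < int l" .
  thus ?thesis by (metis dvd_0_right dvd_imp_le_int not_le of_nat_0_le_iff abs_of_nonneg)
qed

text \<open>Otherwise x and y are both units, and raising the congruence to the odd power (l - 1) /
  2 gives 1 = -1 by Fermat's theorem.\<close>

lemma minus_one_nonresidue:
  fixes x y :: int
  assumes "prime l" "l mod 4 = 3" "[x\<^sup>2 = - y\<^sup>2] (mod int l)"
  shows "int l dvd x \<and> int l dvd y"
proof -
  have pl: "prime (int l)" using assms by simp
  have l2: "l > 2" using assms by (cases "l = 2") (auto dest: prime_gt_1_nat)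
  have dxy: "int l dvd x \<longleftrightarrow> int l dvd y"
    using assms(3) pl by (metis cong_dvd_iff dvd_minus_iff prime_dvd_power_iff zero_less_numeral)
  have False if x: "\<not> int l dvd x"
  proof -
    have y: "\<not> int l dvd y" using dxy x by simp
    define k where "k = (l - 1) div 2"
    have k: "odd k" "2 * k = l - 1" using assms(2) unfolding k_def by presburger+
    have ferm: "[z ^ (l - 1) = 1] (mod int l)" if "\<not> int l dvd z" for z :: int
    proof -
      \<comment> \<open>The exponent \<open>l - 1\<close> is even, so passing to the absolute value,
        a natural number, is harmless.\<close>
      have "\<not> l dvd nat \<bar>z\<bar>" using that by (simp add: int_dvd_int_iff[symmetric])
      hence "[(nat \<bar>z\<bar>) ^ (l - 1) = 1] (mod l)"
        using fermat_theorem[OF assms(1)] by simp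
      hence "[int ((nat \<bar>z\<bar>) ^ (l - 1)) = int 1] (mod int l)"
        unfolding cong_int_iff .
      moreover have "int ((nat \<bar>z\<bar>) ^ (l - 1)) = z ^ (l - 1)"
        unfolding k(2)[symmetric] by (simp add: power_mult)
      ultimately show ?thesis by simp
    qed
    have "[(x\<^sup>2) ^ k = (- y\<^sup>2) ^ k] (mod int l)" by (rule cong_pow[OF assms(3)])
    hence "[x ^ (l - 1) = - (y ^ (l - 1))] (mod int l)"
      using k by (simp add: power_mult[symmetric] power_minus_odd)
    moreover have "[- (y ^ (l - 1)) = - 1] (mod int l)"
      using ferm[OF y] cong_minus_minus_iff by blast
    ultimately have "[1 = - 1] (mod int l)"
      using ferm[OF x] by (meson cong_sym cong_trans)
    hence "int l dvd 2" by (simp add: cong_iff_dvd_diff)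
    thus False using l2 zdvd_imp_le[of "int l" 2] by simp
  qed
  thus ?thesis using dxy by blast
qed

lemma gauss1_prime_3_mod_4:
  assumes "prime l" "l mod 4 = 3" "coprime p (int l)"
  shows "gauss1 p l + gauss1 (- p) l = 0"
proof -
  define k where "k = (l - 1) div 2"
  have l: "l > 2" using assms by (cases "l = 2") (auto dest: prime_gt_1_nat)
  have lk: "l = 2 * k + 1" using assms(2) unfolding k_def by presburger
  let ?I = "{- int k..int k}"
  have cardI: "card ?I = l" using lk by simp
  have pl: "prime (int l)" using assms by simp
  have bound: "i = j" if "i \<in> ?I" "j \<in> ?I" "[i = j] (mod int l)" for i j
  proof -
    have "[i + int k = j + int k] (mod int l)" using that by (simp add: cong_add)
    hence "i + int k = j + int k" using that lk by (intro cong_interval_eq[of _ l]) auto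
    thus ?thesis by simp
  qed
  \<comment> \<open>Since \<open>- 1\<close> is not a square, \<open>h \<mapsto> h \<bar>h\<bar>\<close> permutes the residues modulo \<open>l\<close>.\<close>
  have inj: "i = j" if ij: "i \<in> ?I" "j \<in> ?I" and c: "[i * \<bar>i\<bar> = j * \<bar>j\<bar>] (mod int l)" for i j
  proof (cases "(i \<ge> 0) = (j \<ge> 0)")
    case True
    hence "i * \<bar>i\<bar> - j * \<bar>j\<bar> = (i - j) * (i + j) \<or> i * \<bar>i\<bar> - j * \<bar>j\<bar> = - ((i - j) * (i + j))"
      by (auto simp: abs_if algebra_simps)
    hence "int l dvd (i - j) * (i + j)"
      using c by (metis cong_iff_dvd_diff dvd_minus_iff)
    hence "int l dvd i - j \<or> int l dvd i + j" using pl by (simp add: prime_dvd_mult_iff)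
    thus ?thesis
    proof
      assume "int l dvd i - j"
      thus ?thesis using bound ij by (simp add: cong_iff_dvd_diff)
    next
      assume "int l dvd i + j"
      hence "[i = - j] (mod int l)" by (simp add: cong_iff_dvd_diff)
      hence "i = - j" using bound[of i "- j"] ij by auto
      thus ?thesis using True by auto
    qed
  next
    case False
    hence "[i\<^sup>2 = - j\<^sup>2] (mod int l)"
    proof (cases "i \<ge> 0")
      case True
      with False have "i * \<bar>i\<bar> = i\<^sup>2" "j * \<bar>j\<bar> = - j\<^sup>2" by (auto simp: power2_eq_square)
      thus ?thesis using c by simp
    next
      case n: False
      with False have "i * \<bar>i\<bar> = - i\<^sup>2" "j * \<bar>j\<bar> = j\<^sup>2" by (auto simp: power2_eq_square)
      hence "[- (- i\<^sup>2) = - j\<^sup>2] (mod int l)" using c cong_minus_minus_iff by metis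
      thus ?thesis by simp
    qed
    hence "int l dvd i" "int l dvd j" using minus_one_nonresidue[OF assms(1,2)] by auto
    thus ?thesis using ij prime_cong_eq_0_iff[OF assms(1)] unfolding k_def by metis
  qed
  have zero: "(\<Sum>h\<in>?I. em l (c * (h * \<bar>h\<bar>))) = 0" if c: "coprime c (int l)" for c
  proof -
    have "(\<Sum>h\<in>?I. em l (c * (h * \<bar>h\<bar>))) = (\<Sum>h\<in>{0..<int l}. em l (c * h))"
      by (rule sum_residues)
         (use l cardI inj in \<open>auto intro!: em_cong cong_mult cong_refl\<close>)
    also have "\<dots> = (\<Sum>h\<in>{0..<int l}. em l (h * c))" by (simp add: mult.commute)
    also have "\<dots> = 0"
    proof -
      have "\<not> int l dvd c"
        using c pl by (metis coprime_common_divisor dvd_refl not_prime_unit)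
      thus ?thesis using sum_em[of l c] l by simp
    qed
    finally show ?thesis .
  qed
  have g: "gauss1 c l = (\<Sum>h\<in>?I. em l (c * h\<^sup>2))" for c
    by (rule gauss1_residues[symmetric]) (use l cardI bound in auto)
  have "gauss1 p l + gauss1 (- p) l = (\<Sum>h\<in>?I. em l (p * h\<^sup>2) + em l (- p * h\<^sup>2))"
    by (simp add: g sum.distrib)
  \<comment> \<open>Up to sign \<open>h * |h|\<close> is \<open>h\<^sup>2\<close>, so the
    replacement at most swaps the two summands.\<close>
  also have "\<dots> = (\<Sum>h\<in>?I. em l (p * (h * \<bar>h\<bar>)) + em l (- p * (h * \<bar>h\<bar>)))"
    by (intro sum.cong refl) (auto simp: abs_if power2_eq_square add.commute)
  also have "\<dots> = 0"
    using zero[of p] zero[of "- p"] assms(3) by (simp add: sum.distrib)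
  finally show ?thesis .
qed

text \<open>By Euler's criterion -1 is a square modulo l, so \<open>gauss1_mult_square\<close>
  applies to it.\<close>

lemma gauss1_prime_1_mod_4:
  assumes "prime l" "l mod 4 = 1"
  shows "gauss1 (- p) l = gauss1 p l"
proof -
  have l: "l > 2" using assms by (cases "l = 2") (auto dest: prime_gt_1_nat)
  have "[Legendre (- 1) (int l) = (- 1) ^ ((l - 1) div 2)] (mod int l)"
    using euler_criterion[of l "- 1"] assms l by simp
  moreover have "even ((l - 1) div 2)" using assms(2) by presburger
  ultimately have "[Legendre (- 1) (int l) = 1] (mod int l)" by simp
  hence "Legendre (- 1) (int l) \<noteq> - 1"
    using l zdvd_imp_le[of "int l" 2] by (auto simp: cong_iff_dvd_diff)
  moreover have "\<not> [- 1 = 0] (mod int l)"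
    using l by (auto simp: cong_iff_dvd_diff)
  ultimately have "QuadRes (int l) (- 1)"
    by (auto simp: Legendre_def split: if_splits)
  then obtain y where y: "[y\<^sup>2 = - 1] (mod int l)" by (auto simp: QuadRes_def)
  have "coprime (y\<^sup>2) (int l)" using cong_imp_coprime[OF cong_sym[OF y]] by simp
  hence "gauss1 (p * y\<^sup>2) l = gauss1 p l" using l by (intro gauss1_mult_square) auto
  moreover have "gauss1 (p * y\<^sup>2) l = gauss1 (p * (- 1)) l"
    by (intro gauss1_cong cong_mult cong_refl y)
  ultimately show ?thesis by simp
qed

lemma eps_square: "odd q \<Longrightarrow> (eps q)\<^sup>2 = (if q mod 4 = 1 then 1 else - 1)"
  by (auto simp: eps_def) presburger+

lemma eps_square_mult:
  assumes "odd a" "odd b"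
  shows "(eps (a * b))\<^sup>2 = (eps a)\<^sup>2 * (eps b)\<^sup>2"
proof -
  have "a mod 4 = 1 \<or> a mod 4 = 3" "b mod 4 = 1 \<or> b mod 4 = 3" using assms by presburger+
  thus ?thesis using assms mod_mult_eq[of a 4 b] by (auto simp: eps_def)
qed

lemma gauss1_prime_square:
  assumes "prime l" "odd l" "coprime p (int l)"
  shows "(gauss1 p l)\<^sup>2 = (eps l)\<^sup>2 * of_nat l"
proof -
  have n: "gauss1 p l * gauss1 (- p) l = of_nat l"
    using gauss1_times_cnj[of l p] assms by (simp add: gauss1_uminus)
  show ?thesis
  proof (cases "l mod 4 = 1")
    case True
    thus ?thesis
      using n gauss1_prime_1_mod_4[OF assms(1) True, of p] assms(2)
      using eps_square[OF assms(2)] by (simp add: power2_eq_square)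
  next
    case False
    hence l3: "l mod 4 = 3" using assms(2) by presburger
    hence "gauss1 (- p) l = - gauss1 p l"
      using gauss1_prime_3_mod_4[OF assms(1) l3 assms(3)] by (simp add: add_eq_0_iff)
    hence "(gauss1 p l)\<^sup>2 = - of_nat l" using n by (simp add: power2_eq_square minus_equation_iff)
    thus ?thesis using False assms(2) by (simp add: eps_square)
  qed
qed

text \<open>Strong induction, splitting off a squared prime or a prime coprime to the rest. The
  square is the right quantity: \<open>eps\<close> is not multiplicative, but its square is. The
  lost sign is recovered on average from \<open>sum_units_gauss1\<close>.\<close>

lemma gauss1_odd_square:
  assumes "odd q" "coprime p (int q)"
  shows "(gauss1 p q)\<^sup>2 = (eps q)\<^sup>2 * of_nat q"
  using assms
proof (induction q arbitrary: p rule: less_induct)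
  case (less q)
  have q: "q > 0" using less.prems(1) by (cases q) auto
  show ?case
  proof (cases "q = 1")
    case True
    have "{0..<1} = {0::int}" by auto
    thus ?thesis using True by (simp add: gauss1_em eps_def)
  next
    case False
    then obtain l where l: "prime l" "l dvd q" using prime_factor_nat by blast
    have l1: "l > 1" using l prime_gt_1_nat by blast
    have odd_l: "odd l" using l less.prems(1) dvd_trans by blast
    show ?thesis
    proof (cases "l\<^sup>2 dvd q")
      case True
      then obtain n where n: "q = l\<^sup>2 * n" by auto
      have "n > 0" "odd n" using n q less.prems by auto
      moreover have "n < q" using n l1 \<open>n > 0\<close> one_less_power[of l 2] by simp
      moreover have "coprime p (int n)" "coprime p (int l)"
        using less.prems(2) n by auto
      ultimately show ?thesis
        using less.IH[of n p] gauss1_square_mult[of l p n] odd_l l1 n eps_square_mult[of "l\<^sup>2" n]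
          eps_square_mult[of l l] eps_square[of l]
        by (auto simp: power_mult_distrib power2_eq_square split: if_splits)
    next
      case False
      from l obtain m where m: "q = l * m" by auto
      have "\<not> l dvd m" using False m l1 by (auto simp: power2_eq_square)
      hence cop: "coprime l m" using l prime_imp_coprime by blast
      have "m > 0" "odd m" using m q less.prems by auto
      moreover have "m < q" using m l1 \<open>m > 0\<close> by simp
      moreover have "coprime (p * int l) (int m)" "coprime (p * int m) (int l)"
        using less.prems(2) m cop by (auto simp: coprime_commute)
      ultimately show ?thesis
        using less.IH[of m "p * int l"] gauss1_prime_square[OF l(1) odd_l, of "p * int m"]
          gauss1_mult_coprime[OF cop, of p] m l1 eps_square_mult[of l m] odd_l
        by (simp add: power_mult_distrib)
    qed
  qed
qed

lemma em_2: "em 2 a = (if even a then 1 else - 1)"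
proof (cases "even a")
  case False
  have "em 2 a = em 2 1"
    by (rule em_cong) (use False in \<open>simp add: cong_def odd_iff_mod_2_eq_one\<close>)
  also have "\<dots> = - 1" by (simp add: em_def ee_def)
  finally show ?thesis using False by simp
qed (simp add: em_eq_1_iff)

lemma em_4:
  assumes "odd a"
  shows "em 4 a = (if a mod 4 = 1 then \<i> else - \<i>)"
proof -
  have "em 4 a = em 4 (a mod 4)" by (rule em_cong) (simp add: cong_def)
  moreover have "a mod 4 = 1 \<or> a mod 4 = 3" using assms by presburger
  moreover have "em 4 1 = \<i>" by (simp add: em_def ee_def complex_eq_iff)
  moreover have "em 4 3 = em 4 (- 1)" by (rule em_cong) (simp add: cong_def)
  hence "em 4 3 = - \<i>" using \<open>em 4 1 = \<i>\<close> by (simp add: em_uminus)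
  ultimately show ?thesis by auto
qed

lemma gauss1_4_square:
  assumes "odd a"
  shows "(gauss1 a 4)\<^sup>2 = 8 * em 4 a"
proof -
  have "{0..<int 4} = {0,1,2,3}" by auto
  hence "gauss1 a 4 = 1 + em 4 a + em 4 (a * 4) + em 4 (a * 9)" by (simp add: gauss1_em)
  moreover have "em 4 (a * 4) = 1" by (simp add: em_eq_1_iff)
  moreover have "em 4 (a * 9) = em 4 a" by (rule em_cong) (simp add: cong_iff_dvd_diff algebra_simps)
  ultimately have "gauss1 a 4 = 2 + 2 * em 4 a" by simp
  thus ?thesis using assms by (auto simp: em_4 power2_eq_square algebra_simps)
qed

lemma gauss1_8_square:
  assumes "odd a"
  shows "(gauss1 a 8)\<^sup>2 = 16 * em 4 a"
proof -
  have "{0..<int 8} = {0,1,2,3,4,5,6,7}" by auto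
  hence "gauss1 a 8 = 1 + em 8 a + em 8 (a * 4) + em 8 (a * 9) + em 8 (a * 16) + em 8 (a * 25)
      + em 8 (a * 36) + em 8 (a * 49)" by (simp add: gauss1_em)
  moreover have "em 8 (a * 9) = em 8 a" "em 8 (a * 25) = em 8 a" "em 8 (a * 49) = em 8 a"
      "em 8 (a * 36) = em 8 (a * 4)" "em 8 (a * 16) = em 8 0"
    by (rule em_cong; simp add: cong_iff_dvd_diff algebra_simps)+
  moreover have "em 8 (a * 4) = - 1"
    using em_mult_left[of 4 2 a] assms by (simp add: em_2 mult.commute)
  ultimately have "gauss1 a 8 = 4 * em 8 a" by simp
  moreover have "(em 8 a)\<^sup>2 = em 4 a"
    using em_mult_left[of 2 4 a] by (simp add: em_power)
  ultimately show ?thesis by (simp add: power_mult_distrib)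
qed

text \<open>Glue for the coprime splitting into an odd part and a power of 2: the sign contributed
  by the odd part cancels the twist by \<open>m\<close> at the prime 2.\<close>

lemma em_4_mult:
  assumes "odd m" "odd a"
  shows "(eps m)\<^sup>2 * em 4 (a * int m) = em 4 a"
proof -
  have "m mod 4 = 1 \<or> m mod 4 = 3" using assms(1) by presburger
  hence "int m mod 4 = 1 \<or> int m mod 4 = 3" by (metis of_nat_1 of_nat_mod of_nat_numeral)
  moreover have "a mod 4 = 1 \<or> a mod 4 = 3" using assms(2) by presburger
  moreover have "m mod 4 = 1 \<longleftrightarrow> int m mod 4 = 1" by presburger
  ultimately show ?thesis
    using assms mod_mult_eq[of a 4 "int m"] by (auto simp: em_4 eps_square)
qed

text \<open>A factor 4 can be removed as long as the quotient is still divisible by 4. What remains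
  is 4 m or 8 m with m odd, where the Gauss sums modulo 4 and 8 are computed by hand.\<close>

lemma gauss1_0_mod_4_square:
  assumes "4 dvd q" "coprime p (int q)" "q > 0"
  shows "(gauss1 p q)\<^sup>2 = 2 * em 4 p * of_nat q"
  using assms
proof (induction q arbitrary: p rule: less_induct)
  case (less q)
  have "even (int q)" using less.prems(1) by auto
  hence odd_p: "odd p" using less.prems(2) by (metis coprime_common_divisor odd_one)
  show ?case
  proof (cases "16 dvd q")
    case True
    then obtain k where "q = 16 * k" by auto
    then obtain n where n: "q = 4 * n" "4 dvd n" "n > 0" "n < q"
      using less.prems(3) by (intro that[of "4 * k"]) auto
    have "coprime p (int n)" using less.prems(2) n by auto
    hence "(gauss1 p n)\<^sup>2 = 2 * em 4 p * of_nat n" using less.IH[OF n(4,2)] n by blast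
    thus ?thesis using gauss1_four_mult[OF odd_p n(2,3)] n(1) by (simp add: power_mult_distrib)
  next
    case False
    obtain c m where cm: "q = c * m" "odd m" "c = 4 \<or> c = 8"
    proof (cases "8 dvd q")
      case True
      then obtain m where "q = 8 * m" by auto
      moreover from this False have "odd m" by auto
      ultimately show ?thesis using that by blast
    next
      case F: False
      obtain m where "q = 4 * m" using less.prems(1) by auto
      moreover from this F have "odd m" by auto
      ultimately show ?thesis using that by blast
    qed
    have "coprime (2 ^ k) m" for k using cm(2) by simp
    from this[of 2] this[of 3] have cop: "coprime c m" using cm(3) by auto
    have "coprime (p * int c) (int m)"
      using less.prems(2) cm(1) cop by (auto simp: coprime_commute)
    hence a: "(gauss1 (p * int c) m)\<^sup>2 = (eps m)\<^sup>2 * of_nat m"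
      by (intro gauss1_odd_square cm)
    have "odd (p * int m)" using odd_p cm by simp
    hence b: "(gauss1 (p * int m) c)\<^sup>2 = 2 * of_nat c * em 4 (p * int m)"
      using gauss1_4_square gauss1_8_square cm(3) by auto
    have "m > 0" using cm(2) by (cases m) auto
    thus ?thesis
      using a b gauss1_mult_coprime[OF cop, of p] cm em_4_mult[OF cm(2) odd_p]
      by (auto simp: power_mult_distrib mult_ac)
  qed
qed


section \<open>Mean of the Gauss sum over the units\<close>

text \<open>Each fraction k/q is sorted by its reduced denominator d.\<close>

lemma sum_gcd_split:
  fixes F :: "int \<Rightarrow> 'a::comm_monoid_add"
  assumes "q > 0"
  shows "sum F {1..int q} = (\<Sum>d | d dvd q. \<Sum>k\<in>units_mod d. F (k * int (q div d)))"
proof -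
  define A where "A = (\<lambda>d. {k\<in>{0<..q}. gcd k q = d})"
  have *: "(\<Sum>k\<in>A d. F (int k)) = (\<Sum>k\<in>units_mod (q div d). F (k * int d))" if d: "d dvd q" for d
  proof -
    have "(\<Sum>k\<in>A d. F (int k)) = (\<Sum>k\<in>totatives (q div d). F (int (k * d)))"
      unfolding A_def
      by (rule sum.reindex_bij_betw[OF bij_betw_totatives_gcd_eq[OF d assms], symmetric])
    thus ?thesis by (simp add: units_mod_conv_totatives sum.reindex)
  qed
  have "{1..int q} = int ` {0<..q}"
    using image_int_atLeastAtMost[of 1 q] by (simp add: atLeastSucAtMost_greaterThanAtMost[symmetric])
  hence "sum F {1..int q} = (\<Sum>k\<in>{0<..q}. F (int k))"
    by (simp add: sum.reindex)
  also have "{0<..q} = (\<Union>d\<in>{d. d dvd q}. A d)" by safe (auto simp: A_def)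
  also have "(\<Sum>k\<in>(\<Union>d\<in>{d. d dvd q}. A d). F (int k)) = (\<Sum>d | d dvd q. \<Sum>k\<in>A d. F (int k))"
    using assms by (intro sum.UNION_disjoint) (auto simp: A_def)
  also have "\<dots> = (\<Sum>d | d dvd q. \<Sum>k\<in>units_mod (q div d). F (k * int d))"
    by (intro sum.cong refl *) auto
  also have "\<dots> = (\<Sum>d | d dvd q. \<Sum>k\<in>units_mod d. F (k * int (q div d)))"
    using assms by (intro sum.reindex_bij_witness[of _ "(div) q" "(div) q"]) (auto elim: dvdE)
  finally show ?thesis .
qed

text \<open>The summand only sees h modulo q, so every residue is counted c times. Together with
  \<open>sum_gcd_split\<close> this expresses non-reduced p through smaller moduli.\<close>

lemma gauss1_mult_period:
  assumes "c > 0" "q > 0"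
  shows "gauss1 (p * int c) (c * q) = of_nat c * gauss1 p q"
proof -
  have "em (c * q) (p * int c * (a + int q * b)\<^sup>2) = em q (p * a\<^sup>2)" for a b
  proof -
    have "em (c * q) (p * int c * (a + int q * b)\<^sup>2) = em q (p * (a + int q * b)\<^sup>2)"
      using em_mult_left[of c q "p * (a + int q * b)\<^sup>2"] assms by (simp add: mult_ac)
    also have "\<dots> = em q (p * a\<^sup>2)"
      using em_quadratic_cong[of "a + int q * b" a q p 0] by (simp add: cong_def)
    finally show ?thesis .
  qed
  thus ?thesis
    by (subst gauss1_split_residues) (use assms in \<open>simp_all add: gauss1_em sum_distrib_left\<close>)
qed

lemma squarefree_dvd_square:
  fixes f :: nat
  assumes "squarefree f" "f dvd h\<^sup>2"
  shows "f dvd h"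
proof -
  have "f > 0" using assms(1) by (cases f) auto
  show ?thesis
  proof (cases "h = 0")
    case False
    have "multiplicity p f \<le> multiplicity p h" if p: "prime p" for p
    proof (cases "multiplicity p f = 0")
      case nz: False
      hence "p dvd f" using not_dvd_imp_multiplicity_0[of p f] by metis
      hence "p dvd h\<^sup>2" using assms(2) by (rule dvd_trans)
      hence "p dvd h" by (rule prime_dvd_power[OF p])
      hence "multiplicity p h > 0"
        using False p by (simp add: prime_multiplicity_gt_zero_iff)
      moreover have "multiplicity p f \<le> 1"
        using assms(1) \<open>f > 0\<close> p by (auto simp: squarefree_factorial_semiring'')
      ultimately show ?thesis by simp
    qed auto
    thus ?thesis using False \<open>f > 0\<close> prime_multiplicity_le_imp_dvd[of f h] by blast
  qed auto
qed

text \<open>Write q = f t^2 with f squarefree. Then q divides h^2 exactly when t f divides h, and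
  there are q / (t f) = t such residues.\<close>

lemma card_square_multiples:
  assumes "q > 0"
  shows "card {h\<in>{0..<int q}. int q dvd h\<^sup>2} = square_part q"
proof -
  define t where "t = square_part q"
  define f where "f = squarefree_part q"
  have q: "q = f * t\<^sup>2" unfolding f_def t_def by (rule squarefree_decompose)
  have pos: "t > 0" "f > 0" using assms q by (auto intro: gr0I)
  have sf: "squarefree f" unfolding f_def using assms squarefree_squarefree_part[of q] by simp
  have iff: "int q dvd h\<^sup>2 \<longleftrightarrow> int (t * f) dvd h" for h
  proof -
    have "q dvd n\<^sup>2 \<longleftrightarrow> t * f dvd n" for n
    proof
      assume d: "q dvd n\<^sup>2"
      hence "t\<^sup>2 dvd n\<^sup>2" using q dvd_trans by (metis dvd_triv_right)
      then obtain m where m: "n = t * m" by auto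
      have "f dvd m\<^sup>2" using d pos unfolding q m by (simp add: power_mult_distrib mult.commute)
      hence "f dvd m" using squarefree_dvd_square[OF sf] by blast
      thus "t * f dvd n" using m by simp
    next
      assume "t * f dvd n"
      then obtain m where "n = t * f * m" by auto
      thus "q dvd n\<^sup>2" unfolding q by (simp add: power2_eq_square mult_ac)
    qed
    note nat_iff = this
    have "int q dvd h\<^sup>2 \<longleftrightarrow> int q dvd int ((nat \<bar>h\<bar>)\<^sup>2)" by simp
    also have "\<dots> \<longleftrightarrow> int (t * f) dvd int (nat \<bar>h\<bar>)" unfolding int_dvd_int_iff by (rule nat_iff)
    finally show ?thesis by simp
  qed
  have "card {h\<in>{0..<int q}. int q dvd h\<^sup>2} = (\<Sum>h\<in>{0..<int (t * f * t)}. if int (t * f) dvd h then 1 else 0)"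
    unfolding iff by (simp add: sum.inter_filter[symmetric] q power2_eq_square mult_ac)
  also have "\<dots> = t" using sum_multiples_interval[of "t * f" "\<lambda>_. 1::nat" t] pos by simp
  finally show ?thesis unfolding t_def .
qed

text \<open>Moebius inversion in disguise: summing over the divisors of \<open>q\<close>, both sides count
  the \<open>h\<close> modulo \<open>q\<close> with \<open>q\<close> dividing \<open>h\<^sup>2\<close>.\<close>
lemma sum_units_gauss1:
  assumes "q > 0"
  shows "(\<Sum>p\<in>units_mod q. gauss1 p q) =
    (if is_square q then of_nat (q * totient (square_part q)) else 0)"
  using assms
proof (induction q rule: less_induct)
  case (less q)
  define T where "T = (\<lambda>d. \<Sum>p\<in>units_mod d. gauss1 p d)"
  define E where "E = (\<lambda>d. if is_square d then totient (square_part d) else 0)"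
  have sq: "square_part (k\<^sup>2) = k" for k :: nat
  proof (rule dvd_antisym)
    show "k dvd square_part (k\<^sup>2)" by (simp add: dvd_square_part_iff)
    have "square_part (k\<^sup>2) ^ 2 dvd k\<^sup>2" by (rule square_part_square_dvd)
    thus "square_part (k\<^sup>2) dvd k" by (simp only: pow_divides_pow_iff[OF pos2])
  qed
  have "(\<Sum>p\<in>{1..int q}. gauss1 p q) = (\<Sum>p\<in>{1..int q}. \<Sum>h\<in>{0..<int q}. em q (p * h\<^sup>2))"
    by (simp add: gauss1_em)
  also have "\<dots> = (\<Sum>h\<in>{0..<int q}. \<Sum>p\<in>{1..int q}. em q (p * h\<^sup>2))"
    by (rule sum.swap)
  also have "\<dots> = (\<Sum>h\<in>{0..<int q}. if int q dvd h\<^sup>2 then of_nat q else 0)"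
  proof (rule sum.cong[OF refl])
    fix h
    have "(\<Sum>p\<in>{1..int q}. em q (p * h\<^sup>2)) = (\<Sum>p\<in>{0..<int q}. em q (p * h\<^sup>2))"
    proof (rule sum_residues[where g = "\<lambda>p. p"])
      fix i j assume ij: "i \<in> {1..int q}" "j \<in> {1..int q}" "[i = j] (mod int q)"
      hence "[i - 1 = j - 1] (mod int q)" by (simp add: cong_diff)
      hence "i - 1 = j - 1" using ij by (intro cong_interval_eq[of _ q]) auto
      thus "i = j" by simp
    qed (use less.prems in \<open>auto intro!: em_cong cong_mult cong_refl\<close>)
    thus "(\<Sum>p\<in>{1..int q}. em q (p * h\<^sup>2)) = (if int q dvd h\<^sup>2 then of_nat q else 0)"
      using sum_em[OF less.prems] by simp
  qed
  also have "\<dots> = of_nat q * of_nat (card {h\<in>{0..<int q}. int q dvd h\<^sup>2})"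
    by (simp add: sum.inter_filter[symmetric])
  also have "\<dots> = of_nat q * of_nat (square_part q)"
    using card_square_multiples[OF less.prems] by simp
  finally have A: "(\<Sum>p\<in>{1..int q}. gauss1 p q) = of_nat q * of_nat (square_part q)" .
  have B: "(\<Sum>p\<in>{1..int q}. gauss1 p q) = (\<Sum>d | d dvd q. of_nat (q div d) * T d)"
    unfolding sum_gcd_split[OF less.prems]
  proof (intro sum.cong refl)
    fix d assume "d \<in> {d. d dvd q}"
    then obtain c where c: "q = d * c" by auto
    hence "c > 0" "d > 0" using less.prems by auto
    thus "(\<Sum>k\<in>units_mod d. gauss1 (k * int (q div d)) q) = of_nat (q div d) * T d"
      using gauss1_mult_period[of c d] c by (simp add: T_def sum_distrib_left mult.commute)
  qed
  \<comment> \<open>The square divisors of \<open>q\<close> are the squares of the divisors of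
    \<open>square_part q\<close>, so this is the divisor sum of the totient.\<close>
  have C: "(\<Sum>d | d dvd q. E d) = square_part q"
  proof -
    have "(\<Sum>d | d dvd q. E d) = (\<Sum>d | d dvd q \<and> is_square d. totient (square_part d))"
      unfolding E_def using less.prems by (subst sum.inter_filter[symmetric]) (auto intro: sum.cong)
    also have "{d. d dvd q \<and> is_square d} = (\<lambda>e. e\<^sup>2) ` {e. e dvd square_part q}"
      by (auto simp: is_square_def dvd_square_part_iff)
    also have "(\<Sum>d\<in>(\<lambda>e. e\<^sup>2) ` {e. e dvd square_part q}. totient (square_part d)) =
        (\<Sum>e | e dvd square_part q. totient e)"
      by (subst sum.reindex) (auto simp: inj_on_def sq)
    finally show ?thesis by (simp add: totient_divisor_sum)
  qed
  let ?P = "{d. d dvd q \<and> d \<noteq> q}"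
  have fin: "finite ?P" using less.prems by simp
  have ins: "{d. d dvd q} = insert q ?P" by auto
  have IH: "T d = of_nat (d * E d)" if "d \<in> ?P" for d
  proof -
    have "d < q" "d > 0" using that less.prems by (auto intro!: le_neq_implies_less dvd_imp_le gr0I)
    thus ?thesis using less.IH[of d] by (auto simp: T_def E_def)
  qed
  have "(\<Sum>d\<in>?P. of_nat (q div d) * T d) = of_nat q * of_nat (\<Sum>d\<in>?P. E d)"
  proof -
    have "of_nat (q div d) * T d = of_nat q * of_nat (E d)" if "d \<in> ?P" for d
    proof -
      have "of_nat (q div d) * T d = of_nat (q div d * d) * of_nat (E d)"
        using IH[OF that] by simp
      moreover have "q div d * d = q" using that by simp
      ultimately show ?thesis by simp
    qed
    thus ?thesis by (simp add: sum_distrib_left)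
  qed
  \<comment> \<open>\<open>A\<close>, \<open>B\<close> and \<open>C\<close> give two sums over all
    divisors with the same value. By induction their terms agree at the proper divisors, hence also
    at \<open>q\<close>.\<close>
  hence "of_nat q * of_nat (square_part q) = T q + of_nat q * of_nat (\<Sum>d\<in>?P. E d)"
    using A B fin less.prems unfolding ins by simp
  moreover have "square_part q = E q + (\<Sum>d\<in>?P. E d)"
    using C fin unfolding ins by simp
  ultimately have "T q = of_nat (q * E q)" by (simp add: algebra_simps)
  thus ?case by (simp add: T_def E_def)
qed

section \<open>Twisted Kloosterman sums\<close>

definition divisor_count :: "nat \<Rightarrow> nat" where
  "divisor_count n = card {d. d dvd n}"

text \<open>A divisor is determined by its exponents at the primes dividing n.\<close>

lemma divisor_count_le_prod:
  assumes "n > 0"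
  shows "divisor_count n \<le> (\<Prod>p\<in>prime_factors n. multiplicity p n + 1)"
proof -
  define F where "F = (\<lambda>d. \<lambda>p\<in>prime_factors n. multiplicity p d)"
  let ?P = "PiE (prime_factors n) (\<lambda>p. {0..multiplicity p n})"
  have "inj_on F {d. d dvd n}"
  proof (rule inj_onI)
    fix a b assume ab: "a \<in> {d. d dvd n}" "b \<in> {d. d dvd n}" "F a = F b"
    hence nz: "a > 0" "b > 0" using assms by (auto intro: gr0I)
    have "multiplicity p a = multiplicity p b" if p: "prime p" for p
    proof (cases "p dvd n")
      case True
      hence "p \<in> prime_factors n" using p assms by (simp add: prime_factors_dvd)
      thus ?thesis using fun_cong[OF ab(3), of p] by (simp add: F_def)
    next
      case False
      hence "\<not> p dvd a" "\<not> p dvd b" using ab dvd_trans by blast+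
      thus ?thesis by (simp add: not_dvd_imp_multiplicity_0)
    qed
    thus "a = b" using multiplicity_eq_nat[OF nz] by blast
  qed
  moreover have "F ` {d. d dvd n} \<subseteq> ?P"
    using assms by (auto simp: F_def PiE_def intro: dvd_imp_multiplicity_le)
  ultimately have "divisor_count n \<le> card ?P"
    unfolding divisor_count_def by (intro card_inj_on_le[of F]) (auto intro: finite_PiE)
  thus ?thesis by (simp add: card_PiE)
qed

text \<open>The bound n^(1/K) for the divisor function, raised to the power K so that it can be
  checked prime by prime in natural numbers.\<close>

lemma divisor_count_power_le:
  assumes "K > 0"
  shows "\<exists>C>0. \<forall>n>0. real (divisor_count n) ^ K \<le> C * real n"
proof -
  \<comment> \<open>The value comes from
    \<open>a + 1 <= K * (a div K + 1) <= K * 2 ^ (a div K)\<close>, raised to the power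
    \<open>K\<close>.\<close>
  define B where "B = K ^ K"
  have B1: "B \<ge> 1" using assms by (simp add: B_def)
  have exp2: "a + 1 \<le> 2 ^ a" for a :: nat by (induction a) auto
  have B: "(a + 1) ^ K \<le> B * 2 ^ a" for a
  proof -
    have "a mod K < K" "K * (a div K) + a mod K = a" "K * (a div K + 1) = K * (a div K) + K"
      using assms by simp_all
    hence "a + 1 \<le> K * (a div K + 1)" by linarith
    also have "\<dots> \<le> K * 2 ^ (a div K)" by (rule mult_left_mono[OF exp2]) simp
    finally have "(a + 1) ^ K \<le> (K * 2 ^ (a div K)) ^ K" by (rule power_mono) simp
    also have "\<dots> = B * 2 ^ (a div K * K)" by (simp add: power_mult_distrib power_mult B_def)
    also have "\<dots> \<le> B * 2 ^ a" by (intro mult_left_mono power_increasing) auto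
    finally show ?thesis .
  qed
  \<comment> \<open>A prime \<open>p >= 2 ^ K\<close> satisfies
    \<open>(a + 1) ^ K <= (2 ^ K) ^ a <= p ^ a\<close> without a constant. So \<open>B\<close> is
    paid fewer than \<open>2 ^ K + 1\<close> times, independently of \<open>n\<close>.\<close>
  define c where "c = (\<lambda>p::nat. if p < 2 ^ K then B else 1)"
  have loc: "(a + 1) ^ K \<le> c p * p ^ a" if p: "prime p" for p a :: nat
  proof (cases "p < 2 ^ K")
    case True
    have "2 ^ a \<le> p ^ a" using prime_ge_2_nat[OF p] by (intro power_mono) auto
    hence "B * 2 ^ a \<le> B * p ^ a" by (rule mult_left_mono) simp
    with B[of a] have "(a + 1) ^ K \<le> B * p ^ a" by (rule order_trans)
    thus ?thesis using True by (simp only: c_def if_True)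
  next
    case False
    have "(a + 1) ^ K \<le> (2 ^ a) ^ K" by (rule power_mono[OF exp2]) simp
    also have "\<dots> = (2 ^ K) ^ a" by (simp add: power_mult[symmetric] mult.commute)
    also have "\<dots> \<le> p ^ a" using False by (intro power_mono) auto
    finally show ?thesis using False by (simp add: c_def)
  qed
  have main: "divisor_count n ^ K \<le> B ^ (2 ^ K) * n" if n: "n > 0" for n
  proof -
    let ?P = "prime_factors n"
    have "divisor_count n ^ K \<le> (\<Prod>p\<in>?P. multiplicity p n + 1) ^ K"
      using divisor_count_le_prod[OF n] by (rule power_mono) simp
    also have "\<dots> = (\<Prod>p\<in>?P. (multiplicity p n + 1) ^ K)"
      by (rule prod_power_distrib)
    also have "\<dots> \<le> (\<Prod>p\<in>?P. c p * p ^ multiplicity p n)"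
      by (intro prod_mono conjI loc) auto
    also have "\<dots> = (\<Prod>p\<in>?P. c p) * (\<Prod>p\<in>?P. p ^ multiplicity p n)"
      by (rule prod.distrib)
    also have "(\<Prod>p\<in>?P. p ^ multiplicity p n) = n"
      by (rule prime_factorization_nat[OF n, symmetric])
    also have "(\<Prod>p\<in>?P. c p) \<le> B ^ (2 ^ K)"
    proof -
      have "(\<Prod>p\<in>?P. c p) = (\<Prod>p\<in>{p\<in>?P. p < 2 ^ K}. B)"
        unfolding c_def by (rule prod.inter_filter[symmetric]) simp
      also have "\<dots> = B ^ card {p\<in>?P. p < 2 ^ K}" by simp
      also have "\<dots> \<le> B ^ card {..<2 ^ K :: nat}"
        using B1 by (intro power_increasing card_mono) auto
      finally show ?thesis by simp
    qed
    finally show ?thesis by (simp add: mult_right_mono)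
  qed
  have "real (divisor_count n) ^ K \<le> real (B ^ (2 ^ K)) * real n" if "n > 0" for n
    unfolding of_nat_power[symmetric] of_nat_mult[symmetric] of_nat_le_iff by (rule main[OF that])
  moreover have "real (B ^ (2 ^ K)) > 0" using B1 by simp
  ultimately show ?thesis by blast
qed

text \<open>None of the terms in the divisor sum of the totient exceeds \<open>totient q\<close>.
  This turns a saving relative to q into one relative to the number of units.\<close>

lemma le_divisor_count_totient: "q \<le> divisor_count q * totient q"
proof (cases "q = 0")
  case False
  have "q = (\<Sum>d | d dvd q. totient d)" by (simp add: totient_divisor_sum)
  also have "\<dots> \<le> (\<Sum>d | d dvd q. totient q)"
    using False by (intro sum_mono totient_dvd_mono) auto
  finally show ?thesis by (simp add: divisor_count_def)
qed simp

section \<open>Modular inverses and dilation\<close>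

abbreviation minv :: "nat \<Rightarrow> int \<Rightarrow> int" where
  "minv q p \<equiv> modular_inverse (int q) p"

lemma minv_unique:
  assumes "[p * x = 1] (mod int q)"
  shows "[x = minv q p] (mod int q)"
proof -
  have cop: "coprime p (int q)"
    using assms by (metis coprime_1_left cong_imp_coprime cong_sym coprime_mult_left_iff)
  have "[p * x = p * minv q p] (mod int q)"
    using assms cong_modular_inverse1[OF cop] by (meson cong_sym cong_trans)
  thus ?thesis using cop by (simp add: cong_mult_lcancel)
qed

lemma minv_cong:
  assumes "[p = p'] (mod int q)"
  shows "[minv q p = minv q p'] (mod int q)"
proof (cases "coprime p (int q)")
  case True
  have "[p' * minv q p = p * minv q p] (mod int q)"
    by (intro cong_mult cong_refl cong_sym[OF assms])
  hence "[p' * minv q p = 1] (mod int q)"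
    using cong_modular_inverse1[OF True] cong_trans by blast
  thus ?thesis by (rule minv_unique)
next
  \<comment> \<open>For non-units both inverses are the same default value, so the congruence holds
    for all integers.\<close>
  case False
  hence "\<not> coprime p' (int q)" using cong_imp_coprime[OF cong_sym[OF assms]] by blast
  thus ?thesis using False by (simp add: modular_inverse_def coprime_commute)
qed

lemma minv_mult:
  assumes "coprime a (int q)" "coprime b (int q)"
  shows "[minv q a * minv q b = minv q (a * b)] (mod int q)"
proof (rule minv_unique)
  have "[(a * minv q a) * (b * minv q b) = 1 * 1] (mod int q)"
    using assms by (intro cong_mult cong_modular_inverse1)
  thus "[a * b * (minv q a * minv q b) = 1] (mod int q)" by (simp add: mult_ac)
qed

text \<open>Twisted Kloosterman sums. The relevant twists need not be characters: being constant on the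
  cosets of the squares is all that the dilation argument uses.\<close>
definition ksum :: "(int \<Rightarrow> complex) \<Rightarrow> nat \<Rightarrow> int \<Rightarrow> int \<Rightarrow> complex" where
  "ksum w q m n = (\<Sum>p\<in>units_mod q. w p * em q (m * p + n * minv q p))"

definition square_invariant :: "nat \<Rightarrow> (int \<Rightarrow> complex) \<Rightarrow> bool" where
  "square_invariant q w \<longleftrightarrow>
     (\<forall>p. norm (w p) \<le> 1) \<and> (\<forall>p p'. [p = p'] (mod int q) \<longrightarrow> w p = w p') \<and>
     (\<forall>p v. coprime p (int q) \<longrightarrow> coprime v (int q) \<longrightarrow> w (p * v\<^sup>2) = w p)"

lemma ksum_cong:
  assumes "[m = m'] (mod int q)" "[n = n'] (mod int q)"
  shows "ksum w q m n = ksum w q m' n'"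
  unfolding ksum_def
  by (intro sum.cong refl arg_cong2[where f = "(*)"] em_cong cong_add cong_mult cong_refl assms)

text \<open>Substituting p -> v^2 p leaves the twist alone and moves the dilation onto the two
  frequencies, in opposite directions.\<close>

lemma ksum_dilate:
  assumes w: "square_invariant q w" and q: "q > 0" and v: "coprime v (int q)"
  shows "ksum w q (m * v\<^sup>2) (n * (minv q v)\<^sup>2) = ksum w q m n"
proof -
  define f where "f = (\<lambda>p. w p * em q (m * p + n * minv q p))"
  have per: "f x = f y" if "[x = y] (mod int q)" for x y
    unfolding f_def using w that
    by (intro arg_cong2[where f = "(*)"] em_cong cong_add cong_mult cong_refl minv_cong)
       (auto simp: square_invariant_def)
  have "ksum w q (m * v\<^sup>2) (n * (minv q v)\<^sup>2) = (\<Sum>p\<in>units_mod q. f (v\<^sup>2 * p))"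
    unfolding ksum_def
  proof (intro sum.cong refl)
    fix p assume p: "p \<in> units_mod q"
    have c: "coprime p (int q)" "coprime (v\<^sup>2) (int q)" using units_modD[OF p] v by simp_all
    have "w (v\<^sup>2 * p) = w p"
      using w c v by (auto simp: square_invariant_def mult.commute)
    moreover have "em q (m * v\<^sup>2 * p + n * (minv q v)\<^sup>2 * minv q p) =
        em q (m * (v\<^sup>2 * p) + n * minv q (v\<^sup>2 * p))"
    proof (rule em_cong)
      have "[minv q v * minv q v * minv q p = minv q (v * v) * minv q p] (mod int q)"
        using v by (intro cong_mult cong_refl minv_mult)
      hence "[(minv q v)\<^sup>2 * minv q p = minv q (v\<^sup>2 * p)] (mod int q)"
        using minv_mult[OF c(2) c(1)] unfolding power2_eq_square by (rule cong_trans)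
      hence "[m * (v\<^sup>2 * p) + n * ((minv q v)\<^sup>2 * minv q p) =
          m * (v\<^sup>2 * p) + n * minv q (v\<^sup>2 * p)] (mod int q)"
        by (intro cong_add cong_mult cong_refl)
      thus "[m * v\<^sup>2 * p + n * (minv q v)\<^sup>2 * minv q p =
          m * (v\<^sup>2 * p) + n * minv q (v\<^sup>2 * p)] (mod int q)"
        by (simp only: mult.assoc)
    qed
    ultimately show "w p * em q (m * v\<^sup>2 * p + n * (minv q v)\<^sup>2 * minv q p) = f (v\<^sup>2 * p)"
      by (simp add: f_def)
  qed
  also have "\<dots> = sum f (units_mod q)"
    by (rule sum_units_mod_mult) (use q per v in auto)
  finally show ?thesis by (simp add: ksum_def f_def)
qed

section \<open>The fourth moment by counting\<close>

text \<open>Parseval on pairs of residues modulo q: after expanding the square, orthogonality keeps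
  only pairs (i, j) with equal frequencies, each contributing at most q^2 as the coefficients are
  bounded by 1.\<close>

lemma sum_norm_square_em_le:
  assumes q: "q > 0" and fin: "finite I" and c: "\<And>i. i \<in> I \<Longrightarrow> norm (c i) \<le> 1"
  shows "(\<Sum>a\<in>{0..<int q}. \<Sum>b\<in>{0..<int q}. (norm (\<Sum>i\<in>I. c i * em q (a * s i + b * t i)))\<^sup>2) \<le>
    real q ^ 2 * card {(i, j) \<in> I \<times> I. [s i = s j] (mod int q) \<and> [t i = t j] (mod int q)}"
    (is "?L \<le> _ * real (card ?N)")
proof -
  let ?R = "{0..<int q}"
  let ?\<delta> = "\<lambda>n. if int q dvd n then of_nat q else (0::complex)"
  have "of_real ?L = (\<Sum>a\<in>?R. \<Sum>b\<in>?R. \<Sum>i\<in>I. \<Sum>j\<in>I.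
      (c i * cnj (c j)) * (em q (a * (s i - s j)) * em q (b * (t i - t j))))"
  proof -
    have "of_real ((norm (\<Sum>i\<in>I. c i * em q (a * s i + b * t i)))\<^sup>2) =
        (\<Sum>i\<in>I. \<Sum>j\<in>I. (c i * cnj (c j)) * (em q (a * (s i - s j)) * em q (b * (t i - t j))))" for a b
    proof -
      have e: "em q (a * s i + b * t i) * cnj (em q (a * s j + b * t j)) =
          em q (a * (s i - s j)) * em q (b * (t i - t j))" for i j
        unfolding em_diff[symmetric] em_add[symmetric]
        by (rule arg_cong[where f = "em q"]) (simp add: algebra_simps)
      have "of_real ((norm (\<Sum>i\<in>I. c i * em q (a * s i + b * t i)))\<^sup>2) =
          (\<Sum>i\<in>I. c i * em q (a * s i + b * t i)) * cnj (\<Sum>i\<in>I. c i * em q (a * s i + b * t i))"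
        by (rule complex_norm_square)
      also have "\<dots> = (\<Sum>i\<in>I. \<Sum>j\<in>I. (c i * cnj (c j)) *
          (em q (a * s i + b * t i) * cnj (em q (a * s j + b * t j))))"
        by (simp add: sum_product mult_ac)
      finally show ?thesis by (simp only: e)
    qed
    thus ?thesis by simp
  qed
  also have "\<dots> = (\<Sum>i\<in>I. \<Sum>j\<in>I. \<Sum>a\<in>?R. \<Sum>b\<in>?R.
      (c i * cnj (c j)) * (em q (a * (s i - s j)) * em q (b * (t i - t j))))"
  proof -
    have swap: "(\<Sum>a\<in>A. \<Sum>b\<in>B. \<Sum>i\<in>I. \<Sum>j\<in>I. F a b i j) = (\<Sum>i\<in>I. \<Sum>j\<in>I. \<Sum>a\<in>A. \<Sum>b\<in>B. F a b i j)"
      for A B :: "int set" and F :: "int \<Rightarrow> int \<Rightarrow> _ \<Rightarrow> _ \<Rightarrow> complex"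
    proof -
      have "(\<Sum>a\<in>A. \<Sum>b\<in>B. \<Sum>i\<in>I. \<Sum>j\<in>I. F a b i j) = (\<Sum>a\<in>A. \<Sum>i\<in>I. \<Sum>b\<in>B. \<Sum>j\<in>I. F a b i j)"
        by (rule sum.cong[OF refl], rule sum.swap)
      also have "\<dots> = (\<Sum>i\<in>I. \<Sum>a\<in>A. \<Sum>j\<in>I. \<Sum>b\<in>B. F a b i j)"
        by (subst sum.swap, rule sum.cong[OF refl], rule sum.cong[OF refl], rule sum.swap)
      also have "\<dots> = (\<Sum>i\<in>I. \<Sum>j\<in>I. \<Sum>a\<in>A. \<Sum>b\<in>B. F a b i j)"
        by (rule sum.cong[OF refl], rule sum.swap)
      finally show ?thesis .
    qed
    show ?thesis by (rule swap)
  qed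
  also have "\<dots> = (\<Sum>i\<in>I. \<Sum>j\<in>I. (c i * cnj (c j)) * (?\<delta> (s i - s j) * ?\<delta> (t i - t j)))"
    unfolding sum_distrib_left[symmetric] sum_distrib_right[symmetric] sum_em[OF q] sum_product[symmetric] by (rule refl)
  also have "\<dots> = (\<Sum>z\<in>I \<times> I. (c (fst z) * cnj (c (snd z))) *
      (?\<delta> (s (fst z) - s (snd z)) * ?\<delta> (t (fst z) - t (snd z))))"
    by (simp add: sum.cartesian_product case_prod_beta)
  also have "\<dots> = (\<Sum>z\<in>?N. (c (fst z) * cnj (c (snd z))) * of_nat (q\<^sup>2))"
    using fin by (intro sum.mono_neutral_cong_right)
      (auto simp: cong_iff_dvd_diff power2_eq_square split: if_splits)
  finally have "norm (of_real ?L :: complex) = norm (\<Sum>z\<in>?N. (c (fst z) * cnj (c (snd z))) * of_nat (q\<^sup>2))"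
    by (rule arg_cong)
  also have "\<dots> \<le> (\<Sum>z\<in>?N. real (q\<^sup>2))"
  proof (rule sum_norm_le)
    fix z assume "z \<in> ?N"
    hence "norm (c (fst z)) * norm (c (snd z)) \<le> 1 * 1"
      using c by (intro mult_mono) auto
    hence "norm (c (fst z)) * norm (c (snd z)) * real (q\<^sup>2) \<le> 1 * real (q\<^sup>2)"
      by (intro mult_right_mono) auto
    thus "norm ((c (fst z) * cnj (c (snd z))) * of_nat (q\<^sup>2)) \<le> real (q\<^sup>2)"
      by (simp add: norm_mult norm_power)
  qed
  finally have "\<bar>?L\<bar> \<le> real q ^ 2 * card ?N" unfolding norm_of_real by (simp add: mult.commute)
  thus ?thesis by (meson abs_ge_self order_trans)
qed

lemma card_residue_class_le:
  assumes "d dvd q" "q > 0"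
  shows "card {x\<in>{1..int q}. int d dvd x - a} \<le> q div d"
proof -
  obtain c where c: "q = d * c" using assms by auto
  have pos: "d > 0" "c > 0" using assms c by auto
  let ?f = "\<lambda>x. (x - 1) div int d"
  have "inj_on ?f {x\<in>{1..int q}. int d dvd x - a}"
  proof (rule inj_onI)
    fix x y assume xy: "x \<in> {x\<in>{1..int q}. int d dvd x - a}" "y \<in> {x\<in>{1..int q}. int d dvd x - a}"
      and eq: "?f x = ?f y"
    have "int d dvd (x - a) - (y - a)" using xy dvd_diff[of "int d" "x - a" "y - a"] by blast
    hence "(x - 1) mod int d = (y - 1) mod int d" by (simp add: mod_eq_dvd_iff)
    hence "x - 1 = y - 1" using eq by (metis div_mult_mod_eq)
    thus "x = y" by simp
  qed
  moreover have "?f ` {x\<in>{1..int q}. int d dvd x - a} \<subseteq> {0..<int c}"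
  proof safe
    fix x assume x: "x \<in> {1..int q}"
    have "?f x * int d \<le> x - 1" by (metis div_mult_mod_eq le_add_same_cancel1 of_nat_0_le_iff of_nat_0_less_iff pos(1) pos_mod_sign)
    also have "x - 1 < int c * int d" using x c by (simp add: mult.commute)
    finally have "?f x < int c" using pos by (simp only: mult_less_cancel_right)
    thus "?f x \<in> {0..<int c}" using x pos by (simp add: pos_imp_zdiv_nonneg_iff)
  qed
  ultimately have "card {x\<in>{1..int q}. int d dvd x - a} \<le> card {0..<int c}"
    by (intro card_inj_on_le[of ?f]) auto
  thus ?thesis using c pos by simp
qed

lemma card_Sigma_le:
  assumes "finite X" "card X \<le> m" "\<And>x. x \<in> X \<Longrightarrow> finite (Y x)" "\<And>x. x \<in> X \<Longrightarrow> card (Y x) \<le> n"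
  shows "card (Sigma X Y) \<le> m * n"
proof -
  have "card (Sigma X Y) = (\<Sum>x\<in>X. card (Y x))" using assms by (intro card_SigmaI) auto
  also have "\<dots> \<le> (\<Sum>x\<in>X. n)" by (intro sum_mono assms)
  also have "\<dots> \<le> m * n" using assms(2) by simp
  finally show ?thesis .
qed

text \<open>Any two of the three congruences confine x and y to residue classes. The product of the
  three resulting bounds is q^6 / (d1 d2 d3)^2 = q^4; its cube root is the source of the exponent
  4/3.\<close>

lemma card_three_divisors_le:
  assumes q: "q = d1 * d2 * d3" "q > 0"
  shows "card {(x, y) \<in> {1..int q} \<times> {1..int q}.
    int d1 dvd x + y \<and> int d2 dvd x - z \<and> int d3 dvd y - z} ^ 3 \<le> q ^ 4"
    (is "card ?Q ^ 3 \<le> _")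
proof -
  let ?C = "\<lambda>d a. {x\<in>{1..int q}. int d dvd x - a}"
  have C: "card (?C d a) \<le> q div d" "finite (?C d a)" if "d dvd q" for d a
    by (rule card_residue_class_le[OF that q(2)], rule finite_subset[of _ "{1..int q}"]) auto
  have d: "d1 dvd q" "d2 dvd q" "d3 dvd q" using q by auto
  have "card ?Q \<le> card (Sigma (?C d2 z) (\<lambda>_. ?C d3 z))"
    by (rule card_mono) (use C d in auto)
  also have "\<dots> \<le> (q div d2) * (q div d3)" using C d by (intro card_Sigma_le)
  finally have 1: "card ?Q \<le> (q div d2) * (q div d3)" .
  have "card ?Q \<le> card (Sigma (?C d2 z) (\<lambda>x. ?C d1 (- x)))"
    by (rule card_mono, rule finite_SigmaI, rule C(2)[OF d(2)], rule C(2)[OF d(1)])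
       (auto simp: add.commute)
  also have "\<dots> \<le> (q div d2) * (q div d1)" using C d by (intro card_Sigma_le)
  finally have 2: "card ?Q \<le> (q div d2) * (q div d1)" .
  have "card ?Q = card (prod.swap ` ?Q)" by (rule card_image[symmetric]) simp
  also have "\<dots> \<le> card (Sigma (?C d3 z) (\<lambda>x. ?C d1 (- x)))"
    by (rule card_mono, rule finite_SigmaI, rule C(2)[OF d(3)], rule C(2)[OF d(1)])
       (auto simp: add.commute)
  also have "\<dots> \<le> (q div d3) * (q div d1)" using C d by (intro card_Sigma_le)
  finally have 3: "card ?Q \<le> (q div d3) * (q div d1)" .
  have pos: "d1 > 0" "d2 > 0" "d3 > 0" using q by auto
  have e: "q div d1 = d2 * d3" "q div d2 = d1 * d3" "q div d3 = d1 * d2"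
    using pos unfolding q by (auto simp: mult_ac)
  have "card ?Q ^ 3 = card ?Q * card ?Q * card ?Q" by (simp add: power3_eq_cube)
  also have "\<dots> \<le> ((q div d2) * (q div d3)) * ((q div d2) * (q div d1)) * ((q div d3) * (q div d1))"
    using 1 2 3 by (intro mult_le_mono)
  also have "\<dots> = q ^ 4" unfolding e unfolding q by (simp add: power4_eq_xxxx mult_ac)
  finally show ?thesis .
qed

lemma dvd_int_mult_split:
  assumes "int q dvd a * b"
  shows "\<exists>d e. q = d * e \<and> int d dvd a \<and> int e dvd b"
proof -
  obtain b' c' where bc: "int q = b' * c'" "b' dvd a" "c' dvd b"
    using division_decomp[OF assms] by blast
  have "q = nat \<bar>b'\<bar> * nat \<bar>c'\<bar>"
    using bc(1) by (metis abs_mult nat_abs_mult_distrib nat_int abs_of_nat)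
  thus ?thesis using bc by (intro exI[of _ "nat \<bar>b'\<bar>"] exI[of _ "nat \<bar>c'\<bar>"]) simp
qed

lemma power_le_power_imp_le:
  fixes a b :: real
  assumes "a ^ n \<le> b ^ n" "0 \<le> b" "0 < n"
  shows "a \<le> b"
proof (rule ccontr)
  assume "\<not> a \<le> b"
  hence "b ^ n < a ^ n" using assms by (intro power_strict_mono) auto
  thus False using assms(1) by simp
qed

text \<open>If q divides a product of three factors, it splits as d1 d2 d3 with each part dividing
  its factor. A splitting is fixed by d1 and d2, so there are at most
  \<open>divisor_count q ^ 2\<close> of them.\<close>

lemma card_three_factors_le:
  assumes q: "q > 0"
  shows "real (card {(x, y) \<in> {1..int q} \<times> {1..int q}. int q dvd (x + y) * ((x - z) * (y - z))}) \<le>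
    real (divisor_count q) ^ 2 * real q powr (4/3)"
proof -
  let ?D = "{(d1, d2). d1 dvd q \<and> d2 dvd q \<and> d1 * d2 dvd q}"
  let ?Q = "\<lambda>d1 d2 d3. {(x, y) \<in> {1..int q} \<times> {1..int q}.
      int d1 dvd x + y \<and> int d2 dvd x - z \<and> int d3 dvd y - z}"
  let ?U = "\<Union>(d1, d2)\<in>?D. ?Q d1 d2 (q div (d1 * d2))"
  have D: "?D \<subseteq> {d. d dvd q} \<times> {d. d dvd q}" by auto
  have finD: "finite ?D" by (rule finite_subset[OF D]) (use q in auto)
  have "card ?D \<le> card ({d. d dvd q} \<times> {d. d dvd q})"
    by (rule card_mono[OF _ D]) (use q in auto)
  hence cardD: "card ?D \<le> divisor_count q ^ 2"
    by (simp add: divisor_count_def power2_eq_square card_cartesian_product)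
  have finQ: "finite (?Q a b c)" for a b c
    by (rule finite_subset[of _ "{1..int q} \<times> {1..int q}"]) auto
  have cardQ: "real (card (?Q d1 d2 (q div (d1 * d2)))) \<le> real q powr (4/3)"
    if "(d1, d2) \<in> ?D" for d1 d2
  proof -
    let ?c = "card (?Q d1 d2 (q div (d1 * d2)))"
    have "q = d1 * d2 * (q div (d1 * d2))" using that by simp
    hence "?c ^ 3 \<le> q ^ 4" using q by (rule card_three_divisors_le)
    hence "real ?c ^ 3 \<le> real q ^ 4"
      unfolding of_nat_power[symmetric] of_nat_le_iff .
    also have "real q ^ 4 = (real q powr (4/3)) ^ 3"
      using q by (simp add: powr_power)
    finally show ?thesis by (rule power_le_power_imp_le) simp_all
  qed
  have "{(x, y) \<in> {1..int q} \<times> {1..int q}. int q dvd (x + y) * ((x - z) * (y - z))} \<subseteq> ?U"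
  proof safe
    fix x y assume xy: "x \<in> {1..int q}" "y \<in> {1..int q}" "int q dvd (x + y) * ((x - z) * (y - z))"
    obtain d1 e where 1: "q = d1 * e" "int d1 dvd x + y" "int e dvd (x - z) * (y - z)"
      using dvd_int_mult_split[OF xy(3)] by blast
    obtain d2 d3 where 2: "e = d2 * d3" "int d2 dvd x - z" "int d3 dvd y - z"
      using dvd_int_mult_split[OF 1(3)] by blast
    have m: "(d1, d2) \<in> ?D" using 1 2 by auto
    have "q div (d1 * d2) = d3" using 1(1) 2(1) q by auto
    hence "(x, y) \<in> ?Q d1 d2 (q div (d1 * d2))" using 1 2 xy by simp
    thus "(x, y) \<in> ?U" by (intro UN_I[OF m]) simp
  qed
  hence "card {(x, y) \<in> {1..int q} \<times> {1..int q}. int q dvd (x + y) * ((x - z) * (y - z))} \<le> card ?U"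
    by (rule card_mono[rotated]) (use finD finQ in auto)
  also have "\<dots> \<le> (\<Sum>d\<in>?D. card (case d of (d1, d2) \<Rightarrow> ?Q d1 d2 (q div (d1 * d2))))"
    by (rule card_UN_le[OF finD])
  finally have "real (card {(x, y) \<in> {1..int q} \<times> {1..int q}. int q dvd (x + y) * ((x - z) * (y - z))}) \<le>
      (\<Sum>d\<in>?D. real (card (case d of (d1, d2) \<Rightarrow> ?Q d1 d2 (q div (d1 * d2)))))"
    unfolding of_nat_sum[symmetric] of_nat_le_iff .
  also have "\<dots> \<le> (\<Sum>d\<in>?D. real q powr (4/3))"
    by (rule sum_mono) (use cardQ in \<open>auto split: prod.split\<close>)
  also have "\<dots> = real (card ?D) * real q powr (4/3)" by simp
  also have "\<dots> \<le> real (divisor_count q ^ 2) * real q powr (4/3)"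
    using cardD unfolding of_nat_le_iff[symmetric, where 'a = real] by (rule mult_right_mono) simp
  finally show ?thesis by simp
qed

text \<open>Eliminating x3 and clearing inverses turns the two congruences into a single factored
  one in x1 and x2, with x4 as parameter z. Summing over x4 costs a factor q.\<close>

lemma card_fourfold_le:
  assumes q: "q > 0"
  defines "I \<equiv> units_mod q \<times> units_mod q"
  shows "real (card {(i, j) \<in> I \<times> I. [fst i + snd i = fst j + snd j] (mod int q) \<and>
      [minv q (fst i) + minv q (snd i) = minv q (fst j) + minv q (snd j)] (mod int q)}) \<le>
    real q * (real (divisor_count q) ^ 2 * real q powr (4/3))" (is "real (card ?N) \<le> _")
proof -
  let ?P = "\<lambda>z. {(x, y) \<in> {1..int q} \<times> {1..int q}. int q dvd (x + y) * ((x - z) * (y - z))}"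
  \<comment> \<open>Forgets \<open>x3\<close>, which the first congruence determines, and puts
    \<open>x4\<close> first as the parameter.\<close>
  let ?f = "\<lambda>(i, j). (snd j, i)"
  have finP: "finite (?P z)" for z
    by (rule finite_subset[of _ "{1..int q} \<times> {1..int q}"]) auto
  have "inj_on ?f ?N"
  proof (rule inj_onI)
    fix a b assume a: "a \<in> ?N" and b: "b \<in> ?N" and f: "?f a = ?f b"
    obtain x1 x2 x3 x4 y1 y2 y3 y4 where ab: "a = ((x1, x2), (x3, x4))" "b = ((y1, y2), (y3, y4))"
      by (metis prod.exhaust)
    have eq: "y1 = x1" "y2 = x2" "y4 = x4" using f ab by auto
    have "[x3 + x4 = x1 + x2] (mod int q)" "[x1 + x2 = y3 + x4] (mod int q)"
      using a b unfolding ab eq by (auto simp: cong_sym_eq)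
    hence "[x3 + x4 = y3 + x4] (mod int q)" by (rule cong_trans)
    hence "[x3 = y3] (mod int q)" by (simp add: cong_add_rcancel)
    moreover have "x3 \<in> units_mod q" "y3 \<in> units_mod q" using a b unfolding ab by (auto simp: I_def)
    ultimately have "x3 = y3" using units_mod_cong_eq by blast
    thus "a = b" using ab eq by simp
  qed
  moreover have "?f ` ?N \<subseteq> Sigma (units_mod q) ?P"
  proof (clarsimp simp: I_def)
    fix x1 x2 x3 x4
    assume u: "x1 \<in> units_mod q" "x2 \<in> units_mod q" "x3 \<in> units_mod q" "x4 \<in> units_mod q"
    assume c1: "[x1 + x2 = x3 + x4] (mod int q)"
      and c2: "[minv q x1 + minv q x2 = minv q x3 + minv q x4] (mod int q)"
    note inv = u[THEN units_modD, THEN cong_modular_inverse1]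
    let ?y1 = "minv q x1" and ?y2 = "minv q x2" and ?y3 = "minv q x3" and ?y4 = "minv q x4"
    \<comment> \<open>Multiplying the congruence between the inverses by
      \<open>x1 * x2 * x3 * x4\<close> removes all inverses.\<close>
    have "[(x1 * ?y1) * (x2 * (x3 * x4)) + (x2 * ?y2) * (x1 * (x3 * x4)) =
        1 * (x2 * (x3 * x4)) + 1 * (x1 * (x3 * x4))] (mod int q)"
      by (intro cong_add cong_mult inv cong_refl)
    moreover have "[(x3 * ?y3) * (x4 * (x1 * x2)) + (x4 * ?y4) * (x3 * (x1 * x2)) =
        1 * (x4 * (x1 * x2)) + 1 * (x3 * (x1 * x2))] (mod int q)"
      by (intro cong_add cong_mult inv cong_refl)
    moreover have "[(x1 * x2 * x3 * x4) * (?y1 + ?y2) = (x1 * x2 * x3 * x4) * (?y3 + ?y4)] (mod int q)"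
      by (intro cong_mult cong_refl c2)
    ultimately have "[(x1 + x2) * (x3 * x4) = (x3 + x4) * (x1 * x2)] (mod int q)"
      by (simp add: cong_def algebra_simps)
    moreover have "[(x3 + x4) * (x1 * x2) = (x1 + x2) * (x1 * x2)] (mod int q)"
      by (intro cong_mult cong_refl cong_sym[OF c1])
    \<comment> \<open>With \<open>x3\<close> replaced by \<open>x1 + x2 - x4\<close>, the difference
      \<open>x3 * x4 - x1 * x2\<close> becomes \<open>- ((x1 - x4) * (x2 - x4))\<close>.\<close>
    moreover have "[(x1 + x2) * ((x1 + x2 - x4) * x4) = (x1 + x2) * (x3 * x4)] (mod int q)"
      using cong_diff[OF c1 cong_refl[of x4]] by (intro cong_mult cong_refl) simp
    ultimately have "[(x1 + x2) * ((x1 + x2 - x4) * x4) = (x1 + x2) * (x1 * x2)] (mod int q)"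
      using cong_trans by blast
    hence "int q dvd - ((x1 + x2) * ((x1 - x4) * (x2 - x4)))"
      by (simp add: cong_iff_dvd_diff algebra_simps)
    hence "int q dvd (x1 + x2) * ((x1 - x4) * (x2 - x4))" by simp
    thus "1 \<le> x1 \<and> x1 \<le> int q \<and> 1 \<le> x2 \<and> x2 \<le> int q \<and>
        int q dvd (x1 + x2) * ((x1 - x4) * (x2 - x4))"
      using u by (simp add: units_mod_def)
  qed
  ultimately have "card ?N \<le> card (Sigma (units_mod q) ?P)"
    by (rule card_inj_on_le) (use finP in auto)
  also have "\<dots> = (\<Sum>z\<in>units_mod q. card (?P z))" using finP by (intro card_SigmaI) auto
  finally have "real (card ?N) \<le> (\<Sum>z\<in>units_mod q. real (card (?P z)))"
    unfolding of_nat_sum[symmetric] of_nat_le_iff .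
  also have "\<dots> \<le> (\<Sum>z\<in>units_mod q. real (divisor_count q) ^ 2 * real q powr (4/3))"
    by (intro sum_mono card_three_factors_le q)
  also have "\<dots> = real (totient q) * (real (divisor_count q) ^ 2 * real q powr (4/3))"
    by (simp add: card_units_mod)
  also have "\<dots> \<le> real q * (real (divisor_count q) ^ 2 * real q powr (4/3))"
    using totient_le[of q] by (intro mult_right_mono) auto
  finally show ?thesis .
qed

text \<open>The square of a twisted Kloosterman sum is again an exponential sum with bounded
  coefficients, now over pairs of units, so Parseval applies to it.\<close>

lemma ksum_fourth_moment:
  assumes w: "square_invariant q w" and q: "q > 0"
  shows "(\<Sum>a\<in>{0..<int q}. \<Sum>b\<in>{0..<int q}. norm (ksum w q a b) ^ 4) \<le>
    real q ^ 2 * (real q * (real (divisor_count q) ^ 2 * real q powr (4/3)))"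
proof -
  let ?I = "units_mod q \<times> units_mod q"
  have e: "norm (ksum w q a b) ^ 4 = (norm (\<Sum>i\<in>?I. (w (fst i) * w (snd i)) *
      em q (a * (fst i + snd i) + b * (minv q (fst i) + minv q (snd i)))))\<^sup>2" for a b
  proof -
    have "ksum w q a b * ksum w q a b = (\<Sum>i\<in>?I. (w (fst i) * em q (a * fst i + b * minv q (fst i))) *
        (w (snd i) * em q (a * snd i + b * minv q (snd i))))"
      by (simp add: ksum_def sum_product sum.cartesian_product case_prod_beta)
    also have "\<dots> = (\<Sum>i\<in>?I. (w (fst i) * w (snd i)) *
        em q (a * (fst i + snd i) + b * (minv q (fst i) + minv q (snd i))))"
      by (intro sum.cong refl) (simp add: em_add algebra_simps)
    finally have "ksum w q a b * ksum w q a b = (\<Sum>i\<in>?I. (w (fst i) * w (snd i)) *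
        em q (a * (fst i + snd i) + b * (minv q (fst i) + minv q (snd i))))" .
    moreover have "norm (ksum w q a b) ^ 4 = (norm (ksum w q a b * ksum w q a b))\<^sup>2"
      by (simp add: norm_mult power4_eq_xxxx power2_eq_square mult_ac)
    ultimately show ?thesis by simp
  qed
  have n: "norm (w (fst i) * w (snd i)) \<le> 1" for i
    using w unfolding norm_mult square_invariant_def by (intro mult_le_one) auto
  have "(\<Sum>a\<in>{0..<int q}. \<Sum>b\<in>{0..<int q}. norm (ksum w q a b) ^ 4) \<le>
      real q ^ 2 * real (card {(i, j) \<in> ?I \<times> ?I. [fst i + snd i = fst j + snd j] (mod int q) \<and>
        [minv q (fst i) + minv q (snd i) = minv q (fst j) + minv q (snd j)] (mod int q)})"
    unfolding e by (rule sum_norm_square_em_le) (use q n in auto)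
  also have "\<dots> \<le> real q ^ 2 * (real q * (real (divisor_count q) ^ 2 * real q powr (4/3)))"
    by (intro mult_left_mono card_fourfold_le q) auto
  finally show ?thesis .
qed

section \<open>Bounding a single sum\<close>

text \<open>After removing g = gcd(n, q) a number q' = d e divides (v - v0)(v + v0), which puts v in
  a class modulo d and in one modulo e. The two bounds q/d and q/e have product q g, so the better
  one is at most the square root of q g.\<close>

lemma card_square_fibre_le:
  assumes q: "q > 0" and g: "gcd n (int q) \<le> int C"
  shows "real (card {v\<in>{1..int q}. int q dvd n * (v\<^sup>2 - v0\<^sup>2)}) \<le>
    real (divisor_count q) * sqrt (real q * real C)"
proof -
  define g where "g = nat (gcd n (int q))"
  have g0: "g > 0" "int g = gcd n (int q)" using q by (auto simp: g_def)
  have "int g dvd int q" using g0 by simp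
  then obtain q' where q': "q = g * q'" by (auto simp: int_dvd_int_iff)
  have q'0: "q' > 0" using q q' by auto
  have gC: "g \<le> C" using g g0 by simp
  let ?Q = "\<lambda>d e. {v\<in>{1..int q}. int d dvd v - v0 \<and> int e dvd v + v0}"
  have finQ: "finite (?Q d e)" for d e by (rule finite_subset[of _ "{1..int q}"]) auto
  have cardQ: "real (card (?Q d (q' div d))) \<le> sqrt (real q * real C)" if d: "d dvd q'" for d
  proof -
    obtain e where e: "q' = d * e" using d by auto
    have de: "d > 0" "e > 0" using e q'0 by auto
    have "card (?Q d e) \<le> card {x\<in>{1..int q}. int d dvd x - v0}"
      by (rule card_mono, rule finite_subset[of _ "{1..int q}"]) auto
    also have "\<dots> \<le> q div d" by (rule card_residue_class_le) (use q e q' in auto)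
    finally have 1: "card (?Q d e) \<le> g * e" using e q' de by (simp add: mult_ac)
    have "card (?Q d e) \<le> card {x\<in>{1..int q}. int e dvd x - (- v0)}"
      by (rule card_mono, rule finite_subset[of _ "{1..int q}"]) auto
    also have "\<dots> \<le> q div e" by (rule card_residue_class_le) (use q e q' in auto)
    finally have 2: "card (?Q d e) \<le> g * d" using e q' de by (simp add: mult_ac)
    have "card (?Q d e) ^ 2 \<le> (g * e) * (g * d)"
      unfolding power2_eq_square using 1 2 by (rule mult_le_mono)
    also have "\<dots> = q * g" by (simp add: q' e mult_ac)
    also have "\<dots> \<le> q * C" using gC by simp
    finally have "real (card (?Q d e)) ^ 2 \<le> real q * real C"
      unfolding of_nat_power[symmetric] of_nat_mult[symmetric] of_nat_le_iff .
    thus ?thesis using e de real_le_rsqrt by simp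
  qed
  have "{v\<in>{1..int q}. int q dvd n * (v\<^sup>2 - v0\<^sup>2)} \<subseteq> (\<Union>d\<in>{d. d dvd q'}. ?Q d (q' div d))"
  proof clarify
    fix v assume v: "v \<in> {1..int q}" "int q dvd n * (v\<^sup>2 - v0\<^sup>2)"
    have "int g dvd n" using g0 by simp
    then obtain n' where n': "n = int g * n'" by auto
    have "gcd (int g * n') (int g * int q') = int g" using g0(2) n' q' by simp
    hence "gcd n' (int q') = 1" using g0(1) by (simp add: gcd_mult_distrib_int[symmetric])
    hence cop: "coprime (int q') n'" by (simp add: coprime_iff_gcd_eq_1 gcd.commute)
    have "int g * int q' dvd int g * (n' * (v\<^sup>2 - v0\<^sup>2))" using v(2) n' q' by (simp add: mult_ac)
    hence "int q' dvd n' * (v\<^sup>2 - v0\<^sup>2)" using g0(1) by simp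
    hence "int q' dvd v\<^sup>2 - v0\<^sup>2" using cop by (simp add: coprime_dvd_mult_right_iff)
    hence "int q' dvd (v - v0) * (v + v0)" by (simp add: power2_eq_square algebra_simps)
    then obtain d e where de: "q' = d * e" "int d dvd v - v0" "int e dvd v + v0"
      using dvd_int_mult_split by blast
    have "q' div d = e" using de q'0 by auto
    thus "v \<in> (\<Union>d\<in>{d. d dvd q'}. ?Q d (q' div d))"
      using de v by (intro UN_I[of d]) auto
  qed
  hence "card {v\<in>{1..int q}. int q dvd n * (v\<^sup>2 - v0\<^sup>2)} \<le> card (\<Union>d\<in>{d. d dvd q'}. ?Q d (q' div d))"
    by (rule card_mono[rotated]) (use finQ q'0 in auto)
  also have "\<dots> \<le> (\<Sum>d | d dvd q'. card (?Q d (q' div d)))"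
    by (rule card_UN_le) (use q'0 in auto)
  finally have "real (card {v\<in>{1..int q}. int q dvd n * (v\<^sup>2 - v0\<^sup>2)}) \<le>
      (\<Sum>d | d dvd q'. real (card (?Q d (q' div d))))"
    unfolding of_nat_sum[symmetric] of_nat_le_iff .
  also have "\<dots> \<le> (\<Sum>d | d dvd q'. sqrt (real q * real C))"
    by (intro sum_mono cardQ) auto
  also have "\<dots> = real (divisor_count q') * sqrt (real q * real C)"
    by (simp add: divisor_count_def)
  also have "divisor_count q' \<le> divisor_count q"
    unfolding divisor_count_def using q q' by (intro card_mono) auto
  hence "real (divisor_count q') * sqrt (real q * real C) \<le> real (divisor_count q) * sqrt (real q * real C)"
    by (intro mult_right_mono) auto
  finally show ?thesis .
qed

text \<open>All dilations of (m, n) by squares of units give the same sum. As v runs through the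
  units, each frequency pair is met at most as often as the fibre bound allows, so
  \<open>totient q\<close> copies of the fourth power fit into that many fourth moments.\<close>

lemma ksum_power4_le:
  assumes w: "square_invariant q w" and q: "q > 0"
    and g: "gcd m (int q) \<le> int C \<or> gcd n (int q) \<le> int C"
  shows "real (totient q) * norm (ksum w q m n) ^ 4 \<le>
    (real (divisor_count q) * sqrt (real q * real C)) *
    (real q ^ 2 * (real q * (real (divisor_count q) ^ 2 * real q powr (4/3))))"
proof -
  let ?U = "units_mod q" and ?R = "{0..<int q}"
  let ?M = "real (divisor_count q) * sqrt (real q * real C)"
  define r where "r = (\<lambda>v. ((m * v\<^sup>2) mod int q, (n * (minv q v)\<^sup>2) mod int q))"
  define F where "F = (\<lambda>z. norm (ksum w q (fst z) (snd z)) ^ 4)"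
  have Fr: "F (r v) = norm (ksum w q m n) ^ 4" if "v \<in> ?U" for v
  proof -
    have "ksum w q (fst (r v)) (snd (r v)) = ksum w q (m * v\<^sup>2) (n * (minv q v)\<^sup>2)"
      by (rule ksum_cong) (auto simp: r_def cong_def)
    thus ?thesis using ksum_dilate[OF w q units_modD[OF that]] by (simp add: F_def)
  qed
  have fibre: "real (card {v\<in>?U. r v = z}) \<le> ?M" for z
  proof (cases "{v\<in>?U. r v = z} = {}")
    case False
    then obtain v0 where v0: "v0 \<in> ?U" "r v0 = z" by blast
    have a: "int q dvd m * (v\<^sup>2 - v0\<^sup>2)" "int q dvd n * (v\<^sup>2 - v0\<^sup>2)" "v \<in> {1..int q}"
      if v: "v \<in> ?U" "r v = z" for v
    proof -
      have c: "[m * v\<^sup>2 = m * v0\<^sup>2] (mod int q)" "[n * (minv q v)\<^sup>2 = n * (minv q v0)\<^sup>2] (mod int q)"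
        using v v0 by (auto simp: r_def cong_def)
      show "int q dvd m * (v\<^sup>2 - v0\<^sup>2)" using c(1) by (simp add: cong_iff_dvd_diff algebra_simps)
      \<comment> \<open>Multiplying by \<open>v\<^sup>2 * v0\<^sup>2\<close> clears the inverses, so
        both coordinates of \<open>r\<close> restrict \<open>v\<close> by a congruence of the same
        shape.\<close>
      have i: "[(v * minv q v)\<^sup>2 = 1\<^sup>2] (mod int q)" "[(v0 * minv q v0)\<^sup>2 = 1\<^sup>2] (mod int q)"
        using v v0 by (intro cong_pow cong_modular_inverse1 units_modD; simp)+
      have "[n * v0\<^sup>2 * (v * minv q v)\<^sup>2 = n * v0\<^sup>2 * 1\<^sup>2] (mod int q)"
        by (intro cong_mult cong_refl i)
      moreover have "[n * v\<^sup>2 * (v0 * minv q v0)\<^sup>2 = n * v\<^sup>2 * 1\<^sup>2] (mod int q)"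
        by (intro cong_mult cong_refl i)
      moreover have "[(n * (minv q v)\<^sup>2) * (v\<^sup>2 * v0\<^sup>2) = (n * (minv q v0)\<^sup>2) * (v\<^sup>2 * v0\<^sup>2)] (mod int q)"
        by (intro cong_mult cong_refl c)
      ultimately have "[n * v\<^sup>2 = n * v0\<^sup>2] (mod int q)"
        by (simp add: cong_def power_mult_distrib mult_ac)
      thus "int q dvd n * (v\<^sup>2 - v0\<^sup>2)" by (simp add: cong_iff_dvd_diff algebra_simps)
      show "v \<in> {1..int q}" using v by (simp add: units_mod_def)
    qed
    obtain k where k: "k = m \<or> k = n" "gcd k (int q) \<le> int C" using g by blast
    have "card {v\<in>?U. r v = z} \<le> card {v\<in>{1..int q}. int q dvd k * (v\<^sup>2 - v0\<^sup>2)}"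
      by (rule card_mono, rule finite_subset[of _ "{1..int q}"]) (use a k in auto)
    hence "real (card {v\<in>?U. r v = z}) \<le> real (card {v\<in>{1..int q}. int q dvd k * (v\<^sup>2 - v0\<^sup>2)})"
      by simp
    thus ?thesis using card_square_fibre_le[OF q k(2), of v0] by linarith
  next
    case True
    show ?thesis unfolding True by simp
  qed
  have "real (totient q) * norm (ksum w q m n) ^ 4 = (\<Sum>v\<in>?U. F (r v))"
    using Fr by (simp add: card_units_mod)
  also have "\<dots> = (\<Sum>z\<in>?R \<times> ?R. \<Sum>v\<in>{v\<in>?U. r v = z}. F (r v))"
    by (rule sum.group[symmetric]) (use q in \<open>auto simp: r_def\<close>)
  also have "\<dots> = (\<Sum>z\<in>?R \<times> ?R. real (card {v\<in>?U. r v = z}) * F z)"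
    by (intro sum.cong refl) simp
  also have "\<dots> \<le> (\<Sum>z\<in>?R \<times> ?R. ?M * F z)"
    by (intro sum_mono mult_right_mono fibre) (simp add: F_def)
  also have "\<dots> = ?M * (\<Sum>a\<in>?R. \<Sum>b\<in>?R. norm (ksum w q a b) ^ 4)"
    by (simp add: F_def sum_distrib_left sum.cartesian_product case_prod_beta)
  also have "\<dots> \<le> ?M * (real q ^ 2 * (real q * (real (divisor_count q) ^ 2 * real q powr (4/3))))"
    by (intro mult_left_mono ksum_fourth_moment[OF w q]) auto
  finally show ?thesis .
qed

text \<open>The threshold is uniform in the twist and the frequencies, because in the application
  \<open>w\<close> and the second frequency change with \<open>q\<close>.\<close>

lemma ksum_small:
  assumes "e > 0"
  shows "\<exists>Q. \<forall>q\<ge>Q. \<forall>w m n. square_invariant q w \<longrightarrow>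
    (gcd m (int q) \<le> int C \<or> gcd n (int q) \<le> int C) \<longrightarrow> norm (ksum w q m n) \<le> e * real (totient q)"
proof -
  \<comment> \<open>The divisor function enters to the power 8: three from
    \<open>ksum_power4_le\<close> and five from replacing \<open>q\<close> by
    \<open>totient q\<close>. The exponent 96 = 8 * 12 bounds this by \<open>q powr (1/12)\<close>,
    half of the available saving \<open>q powr (1/6)\<close>.\<close>
  obtain B where B: "B > 0" "\<And>n. n > 0 \<Longrightarrow> real (divisor_count n) ^ 96 \<le> B * real n"
    using divisor_count_power_le[of 96] by auto
  have "((\<lambda>q. sqrt (real C) * (B * real q) powr (1/12) * real q powr (-1/6)) \<longlongrightarrow> 0) at_top"
  proof -
    have "((\<lambda>q. sqrt (real C) * B powr (1/12) * real q powr (-1/12)) \<longlongrightarrow> sqrt (real C) * B powr (1/12) * 0) at_top"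
      by (intro tendsto_mult tendsto_const tendsto_neg_powr filterlim_real_sequentially) auto
    moreover have "\<forall>\<^sub>F q in at_top. sqrt (real C) * B powr (1/12) * real q powr (-1/12) =
        sqrt (real C) * (B * real q) powr (1/12) * real q powr (-1/6)"
      using eventually_gt_at_top[of 0]
      by eventually_elim (use B in \<open>simp add: powr_mult powr_add[symmetric]\<close>)
    ultimately show ?thesis
      by (intro Lim_transform_eventually[OF _ \<open>eventually _ _\<close>]) simp
  qed
  hence "\<forall>\<^sub>F q in at_top. sqrt (real C) * (B * real q) powr (1/12) * real q powr (-1/6) < e ^ 4"
    using assms by (intro order_tendstoD) auto
  then obtain Q0 where Q0: "\<And>q. q \<ge> Q0 \<Longrightarrow>
      sqrt (real C) * (B * real q) powr (1/12) * real q powr (-1/6) < e ^ 4"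
    by (auto simp: eventually_at_top_linorder)
  show ?thesis
  proof (intro exI[of _ "max Q0 1"] allI impI)
    fix q w m n assume qQ: "max Q0 1 \<le> q" and w: "square_invariant q w"
      and g: "gcd m (int q) \<le> int C \<or> gcd n (int q) \<le> int C"
    hence q: "q > 0" by simp
    let ?t = "real (divisor_count q)" and ?f = "real (totient q)" and ?S = "norm (ksum w q m n)"
    have f: "?f > 0" using q by simp
    have tf: "real q \<le> ?t * ?f"
      using le_divisor_count_totient[of q] by (metis of_nat_le_iff of_nat_mult)
    have t8: "?t ^ 8 \<le> (B * real q) powr (1/12)"
    proof -
      have "(?t ^ 8) ^ 12 \<le> ((B * real q) powr (1/12)) ^ 12"
      proof -
        have "(?t ^ 8) ^ 12 = ?t ^ 96" by (simp only: power_mult[symmetric]) simp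
        also have "\<dots> \<le> B * real q" by (rule B(2)[OF q])
        also have "\<dots> = ((B * real q) powr (1/12)) ^ 12" using B(1) q by (simp add: powr_power)
        finally show ?thesis .
      qed
      thus ?thesis by (rule power_le_power_imp_le) simp_all
    qed
    \<comment> \<open>The factor \<open>q ^ 5\<close> is the least integral power above 1/2 + 3 +
      4/3 = 29/6; the gap is the saving 1/6.\<close>
    have "real q ^ 5 * ?S ^ 4 \<le> (?t * ?f) ^ 5 * ?S ^ 4"
      using tf by (intro mult_right_mono power_mono) auto
    also have "\<dots> = ?t ^ 5 * ?f ^ 4 * (?f * ?S ^ 4)" by (simp add: power_mult_distrib eval_nat_numeral)
    also have "\<dots> \<le> ?t ^ 5 * ?f ^ 4 * ((?t * sqrt (real q * real C)) *
        (real q ^ 2 * (real q * (?t ^ 2 * real q powr (4/3)))))"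
      by (intro mult_left_mono ksum_power4_le[OF w q g]) auto
    also have "\<dots> = ?f ^ 4 * (?t ^ 8 * sqrt (real C) * (sqrt (real q) * real q ^ 3 * real q powr (4/3)))"
      by (simp add: real_sqrt_mult eval_nat_numeral mult_ac)
    also have "sqrt (real q) * real q ^ 3 * real q powr (4/3) = real q ^ 5 * real q powr (-1/6)"
    proof -
      have p: "real q ^ k = real q powr real k" for k using q by (simp add: powr_realpow)
      show ?thesis unfolding p powr_half_sqrt[OF of_nat_0_le_iff, symmetric] powr_add[symmetric] by simp
    qed
    also have "?f ^ 4 * (?t ^ 8 * sqrt (real C) * (real q ^ 5 * real q powr (-1/6))) \<le>
        ?f ^ 4 * ((B * real q) powr (1/12) * sqrt (real C) * (real q ^ 5 * real q powr (-1/6)))"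
      by (intro mult_left_mono mult_right_mono t8) auto
    also have "\<dots> = real q ^ 5 * (?f ^ 4 * (sqrt (real C) * (B * real q) powr (1/12) * real q powr (-1/6)))"
      by (simp add: mult_ac)
    also have "\<dots> \<le> real q ^ 5 * (?f ^ 4 * e ^ 4)"
      using Q0[of q] qQ by (intro mult_left_mono) auto
    finally have "?S ^ 4 \<le> ?f ^ 4 * e ^ 4" using q by simp
    hence "?S ^ 4 \<le> (e * ?f) ^ 4" by (simp add: power_mult_distrib mult.commute)
    thus "?S \<le> e * ?f" by (rule power_le_power_imp_le) (use assms in auto)
  qed
qed

section \<open>Fourier series\<close>

lemma periodic_add_int:
  fixes f :: "real \<Rightarrow> 'a"
  assumes per: "\<And>x. f (x + 1) = f x"
  shows "f (x + of_int k) = f x"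
proof (induction k rule: int_induct[of _ 0])
  case (step1 i)
  have "f (x + of_int (i + 1)) = f ((x + of_int i) + 1)" by (simp add: add_ac)
  thus ?case using per step1 by simp
next
  case (step2 i)
  have "x + of_int i = (x + of_int (i - 1)) + 1" by simp
  thus ?case using per[of "x + of_int (i - 1)"] step2 by metis
qed simp

lemma ee_eq_imp_periodic_eq:
  assumes per: "\<And>x. f (x + 1) = f x" and "ee x = ee y"
  shows "f x = f y"
proof -
  have "ee (x - y) = 1"
    using assms(2) ee_add[of x "- y"] ee_add[of y "- y"] by simp
  then obtain k where "x - y = of_int k" by (auto simp: ee_eq_1_iff elim: Ints_cases)
  hence "x = y + of_int k" by simp
  thus ?thesis using periodic_add_int[of f y k] per by simp
qed

lemma ee_divide_2pi: "ee (t / (2 * pi)) = cis t"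
  by (simp add: ee_def)

lemma continuous_on_ee [continuous_intros]:
  "continuous_on S f \<Longrightarrow> continuous_on S (\<lambda>x. ee (f x))"
  unfolding ee_def cis_conv_exp by (intro continuous_intros)

text \<open>An inductive predicate instead of a finite sum: statements linear in the function only
  need checking on monomials.\<close>

inductive trig_poly :: "(real \<Rightarrow> complex) \<Rightarrow> bool" where
  monom: "trig_poly (\<lambda>x. c * ee (of_int k * x))"
| add: "trig_poly f \<Longrightarrow> trig_poly g \<Longrightarrow> trig_poly (\<lambda>x. f x + g x)"

lemma trig_poly_const: "trig_poly (\<lambda>x. c)"
  using trig_poly.monom[of c 0] by simp

lemma trig_poly_mult:
  assumes "trig_poly f" "trig_poly g"
  shows "trig_poly (\<lambda>x. f x * g x)"
  using assms(1)
proof induction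
  case (monom c k)
  show ?case using assms(2)
  proof induction
    case (monom d l)
    have "(\<lambda>x. (c * ee (of_int k * x)) * (d * ee (of_int l * x))) =
        (\<lambda>x. (c * d) * ee (of_int (k + l) * x))"
      by (simp add: ee_add algebra_simps)
    thus ?case by (simp only:) (rule trig_poly.monom)
  next
    case (add f g)
    show ?case unfolding distrib_left using add.IH by (rule trig_poly.add)
  qed
next
  case (add f g)
  show ?case unfolding distrib_right using add.IH by (rule trig_poly.add)
qed

text \<open>On the unit circle the real and imaginary parts are combinations of z and its conjugate,
  that is of e(x) and e(-x). This carries Stone-Weierstrass on the circle over to trigonometric
  polynomials.\<close>

lemma trig_poly_real_polynomial:
  fixes p :: "complex \<Rightarrow> real"
  assumes "real_polynomial_function p"
  shows "trig_poly (\<lambda>x. of_real (p (ee x)))"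
  using assms
proof induction
  case (linear f)
  interpret bounded_linear f by fact
  have l: "complex_of_real (f z) = of_real (f 1) * of_real (Re z) + of_real (f \<i>) * of_real (Im z)" for z
  proof -
    have "f z = f (Re z *\<^sub>R 1 + Im z *\<^sub>R \<i>)"
      by (rule arg_cong[where f = f]) (simp add: complex_eq_iff)
    also have "\<dots> = f 1 * Re z + f \<i> * Im z" by (simp add: add scaleR mult.commute)
    finally show ?thesis by simp
  qed
  have r: "of_real (Re z) = (z + cnj z) / 2" "of_real (Im z) = (z - cnj z) / (2 * \<i>)" for z
    by (auto simp: complex_eq_iff Re_divide Im_divide)
  have lr: "complex_of_real (f z) = (of_real (f 1) / 2 + of_real (f \<i>) / (2 * \<i>)) * z +
      (of_real (f 1) / 2 - of_real (f \<i>) / (2 * \<i>)) * cnj z" for z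
    unfolding l[of z] r by (simp add: algebra_simps add_divide_distrib diff_divide_distrib)
  have "(\<lambda>x. complex_of_real (f (ee x))) =
      (\<lambda>x. (of_real (f 1) / 2 + of_real (f \<i>) / (2 * \<i>)) * ee (of_int 1 * x) +
           (of_real (f 1) / 2 - of_real (f \<i>) / (2 * \<i>)) * ee (of_int (- 1) * x))"
    by (rule ext, subst lr) (simp add: ee_uminus)
  thus ?case by (simp only:) (intro trig_poly.intros)
next
  case (const c)
  show ?case by (rule trig_poly_const)
next
  case (add f g)
  show ?case unfolding of_real_add using add.IH by (rule trig_poly.add)
next
  case (mult f g)
  show ?case unfolding of_real_mult using mult.IH by (rule trig_poly_mult)
qed

text \<open>A continuous 1-periodic function descends to a continuous function on the unit circle,
  where Stone-Weierstrass provides the approximation.\<close>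

lemma trig_poly_approx:
  assumes cont: "continuous_on UNIV f" and per: "\<And>x. f (x + 1) = f x" and "e > 0"
  obtains g where "trig_poly g" "\<And>x. norm (f x - g x) < e"
proof -
  define F where "F = (\<lambda>z. f (Arg z / (2 * pi)))"
  \<comment> \<open>\<open>Arg\<close> jumps on the negative real axis and \<open>Arg2pi\<close> on
    the positive one. By periodicity both branches give the same \<open>F\<close>, so
    \<open>F\<close> is continuous away from 0.\<close>
  have F2: "F z = f (Arg2pi z / (2 * pi))" for z
  proof (cases "z = 0")
    case False
    have "of_real (norm z) * cis (Arg z) = z" "of_real (norm z) * cis (Arg2pi z) = z"
      using False is_Arg_Arg[of z] Arg2pi[of z] by (simp_all add: is_Arg_def cis_conv_exp)
    hence "cis (Arg z) = cis (Arg2pi z)" using False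
      by (metis mult_left_cancel norm_eq_zero of_real_eq_0_iff)
    thus ?thesis unfolding F_def
      by (intro ee_eq_imp_periodic_eq[where f = f, OF per]) (simp add: ee_divide_2pi)
  qed (simp add: F_def Arg_zero)
  have isf: "isCont f x" for x
    using cont by (simp add: continuous_on_eq_continuous_at)
  have "isCont F z" if "z \<noteq> 0" for z
  proof (cases "z \<in> \<real>\<^sub>\<le>\<^sub>0")
    case False
    have "isCont (\<lambda>z. Arg z / (2 * pi)) z"
      using continuous_at_Arg[OF False] by (intro continuous_intros) auto
    from isCont_o2[OF this isf] show ?thesis by (simp add: F_def)
  next
    case True
    hence "z \<notin> \<real>\<^sub>\<ge>\<^sub>0" using that
      by (auto simp: complex_nonneg_Reals_iff complex_nonpos_Reals_iff complex_eq_iff)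
    hence "isCont (\<lambda>z. Arg2pi z / (2 * pi)) z"
      using continuous_at_Arg2pi[of z] by (intro continuous_intros) auto
    from isCont_o2[OF this isf] show ?thesis unfolding F2[abs_def] .
  qed
  hence "continuous_on (sphere 0 1) F"
    by (intro continuous_at_imp_continuous_on ballI)
       (metis dist_0_norm mem_sphere norm_zero zero_neq_one)
  then obtain G where G: "polynomial_function G" "\<And>z. z \<in> sphere 0 1 \<Longrightarrow> norm (F z - G z) < e"
    using Stone_Weierstrass_polynomial_function[of "sphere 0 1" F e] assms(3) by auto
  have "real_polynomial_function (\<lambda>z. Re (G z))" "real_polynomial_function (\<lambda>z. Im (G z))"
    using G(1) bounded_linear_Re bounded_linear_Im unfolding polynomial_function_def o_def by blast+
  hence "trig_poly (\<lambda>x. of_real (Re (G (ee x))) + \<i> * of_real (Im (G (ee x))))"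
    by (intro trig_poly.add trig_poly_mult trig_poly_const trig_poly_real_polynomial)
  moreover have "norm (f x - (of_real (Re (G (ee x))) + \<i> * of_real (Im (G (ee x))))) < e" for x
  proof -
    have "f x = F (ee x)" unfolding F_def
    proof (rule ee_eq_imp_periodic_eq[where f = f, OF per])
      have "is_Arg (ee x) (Arg (ee x))" by (rule is_Arg_Arg) (metis norm_ee norm_zero zero_neq_one)
      thus "ee x = ee (Arg (ee x) / (2 * pi))"
        by (simp add: is_Arg_def ee_divide_2pi cis_conv_exp)
    qed
    thus ?thesis using G(2)[of "ee x"] by (simp add: complex_eq[symmetric])
  qed
  ultimately show ?thesis using that by blast
qed

section \<open>Fourier series of functions in \<open>BT\<close>\<close>

lemma BT_periodic: "\<phi> \<in> BT \<Longrightarrow> \<phi> (x + 1) = \<phi> x"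
  and BT_continuous: "\<phi> \<in> BT \<Longrightarrow> continuous_on UNIV \<phi>"
  by (auto simp: BT_def)

lemma BT_summable:
  assumes "\<phi> \<in> BT"
  shows "(\<lambda>k. norm (fourier_coeff \<phi> k)) summable_on UNIV"
proof -
  have "(\<lambda>k. of_int (k ^ 2) * norm (fourier_coeff \<phi> k)) summable_on UNIV"
    using assms by (simp add: BT_def)
  hence "(\<lambda>k. of_int (k ^ 2) * norm (fourier_coeff \<phi> k)) summable_on (UNIV - {0})"
    by (rule summable_on_subset) simp
  hence "(\<lambda>k. norm (fourier_coeff \<phi> k)) summable_on (UNIV - {0})"
  proof (rule summable_on_comparison_test)
    fix k :: int assume "k \<in> UNIV - {0}"
    hence "0 < k ^ 2" by simp
    hence "1 \<le> k ^ 2" by linarith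
    hence "real_of_int 1 \<le> of_int (k ^ 2)" unfolding of_int_le_iff .
    thus "norm (fourier_coeff \<phi> k) \<le> of_int (k ^ 2) * norm (fourier_coeff \<phi> k)"
      using mult_right_mono[of 1 "of_int (k ^ 2)" "norm (fourier_coeff \<phi> k)"] by simp
  qed simp
  hence "(\<lambda>k. norm (fourier_coeff \<phi> k)) summable_on insert 0 (UNIV - {0})"
    by (simp only: summable_on_insert_iff)
  moreover have "insert 0 (UNIV - {0}) = (UNIV :: int set)" by auto
  ultimately show ?thesis by (simp only:)
qed

lemma uniform_limit_trig_series:
  assumes "(\<lambda>n. norm (a n)) summable_on A"
  shows "uniform_limit Y (\<lambda>X x. \<Sum>n\<in>X. a n * ee (u n * x)) (\<lambda>x. \<Sum>\<^sub>\<infinity>n\<in>A. a n * ee (u n * x))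
    (finite_subsets_at_top A)"
  by (rule Weierstrass_m_test_general[OF _ assms]) (simp add: norm_mult)

lemma continuous_on_trig_series:
  assumes "(\<lambda>n. norm (a n)) summable_on A"
  shows "continuous_on UNIV (\<lambda>x. \<Sum>\<^sub>\<infinity>n\<in>A. a n * ee (u n * x))"
  by (rule uniform_limit_theorem[OF _ uniform_limit_trig_series[OF assms]])
     (auto intro!: always_eventually continuous_intros)

lemma integral_ee: "integral {0..1} (\<lambda>x. ee (of_int k * x)) = (if k = 0 then 1 else 0)"
proof (cases "k = 0")
  case False
  define c where "c = 2 * pi * of_int k * \<i>"
  have c0: "c \<noteq> 0" using False by (simp add: c_def)
  have "((\<lambda>x. ee (of_int k * x)) has_integral (ee (of_int k * 1) / c - ee (of_int k * 0) / c)) {0..1}"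
  proof (rule fundamental_theorem_of_calculus)
    fix x :: real
    have "((\<lambda>x. exp (c * of_real x) / c) has_vector_derivative (exp (c * of_real x))) (at x within {0..1})"
      using c0 by (intro has_vector_derivative_real_field) (auto intro!: derivative_eq_intros)
    moreover have "exp (c * of_real x) = ee (of_int k * x)" for x
      by (simp add: ee_def cis_conv_exp c_def mult_ac)
    ultimately show "((\<lambda>x. ee (of_int k * x) / c) has_vector_derivative ee (of_int k * x)) (at x within {0..1})"
      by simp
  qed simp
  thus ?thesis using False ee_of_int[of k] by (simp add: integral_unique)
qed simp

lemma continuous_imp_integrable_01:
  fixes f :: "real \<Rightarrow> complex"
  shows "continuous_on UNIV f \<Longrightarrow> f integrable_on {0..1}"
  using integrable_continuous_real continuous_on_subset by blast

text \<open>By linearity psi integrates to 0 against every trigonometric polynomial. Approximating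
  its conjugate uniformly by such polynomials makes the integral of |psi|^2 arbitrarily
  small.\<close>

lemma fourier_uniqueness:
  assumes cont: "continuous_on UNIV \<psi>" and per: "\<And>x. \<psi> (x + 1) = \<psi> x"
    and zero: "\<And>k. fourier_coeff \<psi> k = 0" and x: "x \<in> {0..1}"
  shows "\<psi> x = 0"
proof -
  have orth: "integral {0..1} (\<lambda>x. \<psi> x * g x) = 0" if "trig_poly g" for g
    using that
  proof induction
    case (monom c k)
    have "integral {0..1} (\<lambda>x. \<psi> x * (c * ee (of_int k * x))) =
        c * integral {0..1} (\<lambda>x. \<psi> x * ee (- (of_int (- k) * x)))"
      by (simp add: mult_ac flip: integral_mult_right)
    thus ?case using zero[of "- k"] by (simp add: fourier_coeff_def)
  next
    case (add f g)
    have c: "continuous_on UNIV h" if "trig_poly h" for h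
      using that by induction (auto intro!: continuous_intros)
    have "integral {0..1} (\<lambda>x. \<psi> x * (f x + g x)) =
        integral {0..1} (\<lambda>x. \<psi> x * f x) + integral {0..1} (\<lambda>x. \<psi> x * g x)"
      unfolding distrib_left
      by (intro integral_add continuous_imp_integrable_01 continuous_intros cont c add)
    thus ?case using add by simp
  qed
  have cont01: "continuous_on {0..1} \<psi>" using cont continuous_on_subset by blast
  obtain M where M: "\<And>x. x \<in> {0..1} \<Longrightarrow> norm (\<psi> x) \<le> M" "M > 0"
  proof -
    have "bounded (\<psi> ` {0..1})" using cont01 compact_imp_bounded compact_continuous_image by blast
    then obtain M where "M > 0" "\<forall>y\<in>\<psi> ` {0..1}. norm y \<le> M" unfolding bounded_pos by blast
    thus ?thesis using that by blast
  qed
  have small: "integral {0..1} (\<lambda>x. (norm (\<psi> x))\<^sup>2) \<le> M * e" if e: "e > 0" for e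
  proof -
    obtain g where g: "trig_poly g" "\<And>x. norm (cnj (\<psi> x) - g x) < e"
      using trig_poly_approx[of "\<lambda>x. cnj (\<psi> x)" e] cont per e by (auto intro: continuous_intros)
    have cg: "continuous_on UNIV g"
      using g(1) by induction (auto intro!: continuous_intros)
    have "complex_of_real (integral {0..1} (\<lambda>x. (norm (\<psi> x))\<^sup>2)) =
        integral {0..1} (\<lambda>x. of_real ((norm (\<psi> x))\<^sup>2))"
    proof -
      have "((\<lambda>x. (norm (\<psi> x))\<^sup>2) has_integral integral {0..1} (\<lambda>x. (norm (\<psi> x))\<^sup>2)) {0..1}"
        by (intro integrable_integral integrable_continuous_real continuous_intros cont01)
      hence "((\<lambda>x. complex_of_real ((norm (\<psi> x))\<^sup>2)) has_integral
          of_real (integral {0..1} (\<lambda>x. (norm (\<psi> x))\<^sup>2))) {0..1}"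
        by (rule has_integral_of_real)
      thus ?thesis by (simp add: integral_unique)
    qed
    also have "\<dots> = integral {0..1} (\<lambda>x. \<psi> x * (cnj (\<psi> x) - g x))"
    proof -
      have "integral {0..1} (\<lambda>x. \<psi> x * (cnj (\<psi> x) - g x)) =
          integral {0..1} (\<lambda>x. \<psi> x * cnj (\<psi> x)) - integral {0..1} (\<lambda>x. \<psi> x * g x)"
        unfolding right_diff_distrib
        by (intro integral_diff continuous_imp_integrable_01 continuous_intros cont cg)
      thus ?thesis using orth[OF g(1)] by (simp only: complex_norm_square) simp
    qed
    finally have "norm (complex_of_real (integral {0..1} (\<lambda>x. (norm (\<psi> x))\<^sup>2))) =
        norm (integral {0..1} (\<lambda>x. \<psi> x * (cnj (\<psi> x) - g x)))" by (rule arg_cong)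
    also have "\<dots> \<le> (M * e) * (1 - 0)"
    proof (rule integral_bound)
      show "continuous_on {0..1} (\<lambda>x. \<psi> x * (cnj (\<psi> x) - g x))"
        using continuous_on_subset[OF cg] by (intro continuous_intros cont01) auto
      fix t :: real assume t: "t \<in> {0..1}"
      show "norm (\<psi> t * (cnj (\<psi> t) - g t)) \<le> M * e"
        unfolding norm_mult using M(1)[OF t] g(2)[of t] M(2) by (intro mult_mono) auto
    qed simp
    finally show ?thesis by (simp add: abs_le_iff)
  qed
  have "integral {0..1} (\<lambda>x. (norm (\<psi> x))\<^sup>2) \<le> 0"
  proof (rule field_le_epsilon)
    fix e :: real assume "e > 0"
    thus "integral {0..1} (\<lambda>x. (norm (\<psi> x))\<^sup>2) \<le> 0 + e"
      using small[of "e / M"] M(2) by simp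
  qed
  moreover have "integral {0..1} (\<lambda>x. (norm (\<psi> x))\<^sup>2) \<ge> 0"
    by (intro integral_nonneg integrable_continuous_real continuous_intros cont01) auto
  ultimately have "integral {0..1} (\<lambda>x. (norm (\<psi> x))\<^sup>2) = 0" by simp
  moreover have "continuous_on {0..1} (\<lambda>x. (norm (\<psi> x))\<^sup>2)" by (intro continuous_intros cont01)
  ultimately have "(norm (\<psi> x))\<^sup>2 = 0"
    using integral_eq_0_iff[of 0 1 "\<lambda>x. (norm (\<psi> x))\<^sup>2"] x by simp
  thus ?thesis by simp
qed

text \<open>The series converges uniformly, so its sum is continuous and termwise integration gives
  it the coefficients of phi. Uniqueness applies to the difference.\<close>

lemma BT_fourier_series:
  assumes "\<phi> \<in> BT" and x: "x \<in> {0..1}"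
  shows "((\<lambda>k. fourier_coeff \<phi> k * ee (of_int k * x)) has_sum \<phi> x) UNIV"
proof -
  define S where "S = (\<lambda>x. \<Sum>\<^sub>\<infinity>k. fourier_coeff \<phi> k * ee (of_int k * x))"
  have summ: "(\<lambda>k. norm (fourier_coeff \<phi> k)) summable_on UNIV" by (rule BT_summable[OF assms(1)])
  have contS: "continuous_on UNIV S" unfolding S_def by (rule continuous_on_trig_series[OF summ])
  have perS: "S (x + 1) = S x" for x
    unfolding S_def by (simp add: distrib_left ee_add)
  have coeffS: "fourier_coeff S j = fourier_coeff \<phi> j" for j
  proof -
    have e: "ee (of_int k * x) * ee (- (of_int j * x)) = ee (of_int (k - j) * x)" for k x
      by (simp add: ee_add[symmetric] left_diff_distrib)
    have "uniform_limit {0..1} (\<lambda>X x. \<Sum>k\<in>X. fourier_coeff \<phi> k * ee (of_int (k - j) * x))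
        (\<lambda>x. S x * ee (- (of_int j * x))) (finite_subsets_at_top UNIV)"
    proof -
      have "uniform_limit {0..1} (\<lambda>X x. \<Sum>k\<in>X. fourier_coeff \<phi> k * ee (of_int (k - j) * x))
          (\<lambda>x. \<Sum>\<^sub>\<infinity>k. fourier_coeff \<phi> k * ee (of_int (k - j) * x)) (finite_subsets_at_top UNIV)"
        by (rule uniform_limit_trig_series[OF summ])
      moreover have "(\<Sum>\<^sub>\<infinity>k. fourier_coeff \<phi> k * ee (of_int (k - j) * x)) = S x * ee (- (of_int j * x))" for x
        unfolding S_def infsum_cmult_left'[symmetric] mult.assoc e ..
      ultimately show ?thesis by simp
    qed
    then obtain I J where IJ: "\<And>X. ((\<lambda>x. \<Sum>k\<in>X. fourier_coeff \<phi> k * ee (of_int (k - j) * x)) has_integral I X) {0..1}"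
        "((\<lambda>x. S x * ee (- (of_int j * x))) has_integral J) {0..1}" "(I \<longlongrightarrow> J) (finite_subsets_at_top UNIV)"
      by (rule uniform_limit_integral) (auto intro!: continuous_intros)
    have "I X = fourier_coeff \<phi> j" if X: "finite X" "j \<in> X" for X
    proof -
      have "I X = integral {0..1} (\<lambda>x. \<Sum>k\<in>X. fourier_coeff \<phi> k * ee (of_int (k - j) * x))"
        using IJ(1)[of X] by (simp add: integral_unique)
      also have "\<dots> = (\<Sum>k\<in>X. integral {0..1} (\<lambda>x. fourier_coeff \<phi> k * ee (of_int (k - j) * x)))"
        by (intro integral_sum X continuous_imp_integrable_01 continuous_intros)
      also have "\<dots> = (\<Sum>k\<in>X. if k = j then fourier_coeff \<phi> k else 0)"
        by (intro sum.cong refl) (simp only: integral_mult_right integral_ee, simp)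
      finally show ?thesis using X by simp
    qed
    hence "\<forall>\<^sub>F X in finite_subsets_at_top UNIV. I X = fourier_coeff \<phi> j"
      unfolding eventually_finite_subsets_at_top by (intro exI[of _ "{j}"]) auto
    hence "(I \<longlongrightarrow> fourier_coeff \<phi> j) (finite_subsets_at_top UNIV)"
      by (rule tendsto_eventually)
    hence "J = fourier_coeff \<phi> j" using IJ(3) tendsto_unique by (metis finite_subsets_at_top_neq_bot)
    thus ?thesis using IJ(2) by (simp add: fourier_coeff_def integral_unique)
  qed
  have "\<phi> x - S x = 0"
  proof (rule fourier_uniqueness[OF _ _ _ x])
    show "continuous_on UNIV (\<lambda>x. \<phi> x - S x)"
      by (intro continuous_intros contS BT_continuous assms)
    show "\<phi> (x + 1) - S (x + 1) = \<phi> x - S x" for x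
      by (simp add: perS BT_periodic[OF assms(1)])
    fix k
    have "fourier_coeff (\<lambda>x. \<phi> x - S x) k = fourier_coeff \<phi> k - fourier_coeff S k"
      unfolding fourier_coeff_def left_diff_distrib
      by (intro integral_diff continuous_imp_integrable_01 continuous_intros contS BT_continuous assms)
    thus "fourier_coeff (\<lambda>x. \<phi> x - S x) k = 0" by (simp add: coeffS)
  qed
  moreover have "(\<lambda>k. fourier_coeff \<phi> k * ee (of_int k * x)) summable_on UNIV"
    by (rule abs_summable_summable) (use summ in \<open>simp add: norm_mult\<close>)
  ultimately show ?thesis by (simp add: has_sum_iff S_def)
qed

section \<open>Incomplete Gauss sums and the distribution of the normalised Gauss sum\<close>

text \<open>The contribution of the k-th Fourier mode to the incomplete Gauss sum.\<close>

definition lgauss :: "int \<Rightarrow> int \<Rightarrow> nat \<Rightarrow> complex" where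
  "lgauss p k q = (\<Sum>h\<in>{0..<int q}. em q (p * h\<^sup>2 + k * h))"

lemma lgauss_residues:
  assumes "q > 0" "card I = q"
    and "\<And>i j. i \<in> I \<Longrightarrow> j \<in> I \<Longrightarrow> [g i = g j] (mod int q) \<Longrightarrow> i = j"
  shows "(\<Sum>i\<in>I. em q (p * (g i)\<^sup>2 + k * g i)) = lgauss p k q"
  unfolding lgauss_def
  by (rule sum_residues) (use assms em_quadratic_cong in auto)

lemma lgauss_shift:
  assumes "q > 0"
  shows "(\<Sum>h\<in>{0..<int q}. em q (p * (h + t)\<^sup>2 + k * (h + t))) = lgauss p k q"
  by (rule lgauss_residues)
     (use assms cong_interval_eq in \<open>auto simp: cong_add_rcancel\<close>)

lemma lgauss_complete_square:
  assumes q: "q > 0" and t: "[2 * p * t = k] (mod int q)"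
  shows "lgauss p k q = em q (- (p * t\<^sup>2)) * gauss1 p q"
proof -
  have "gauss1 p q = (\<Sum>h\<in>{0..<int q}. em q (p * (h + t)\<^sup>2))"
    by (rule gauss1_residues[symmetric])
       (use q cong_interval_eq in \<open>auto simp: cong_add_rcancel\<close>)
  moreover have "em q (p * h\<^sup>2 + k * h) = em q (- (p * t\<^sup>2)) * em q (p * (h + t)\<^sup>2)" for h
    unfolding em_add[symmetric]
  proof (rule em_cong)
    have "[p * h\<^sup>2 + k * h = p * h\<^sup>2 + 2 * p * t * h] (mod int q)"
      by (intro cong_add cong_mult cong_refl cong_sym[OF t])
    also have "p * h\<^sup>2 + 2 * p * t * h = - (p * t\<^sup>2) + p * (h + t)\<^sup>2"
      by (simp add: power2_eq_square algebra_simps)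
    finally show "[p * h\<^sup>2 + k * h = - (p * t\<^sup>2) + p * (h + t)\<^sup>2] (mod int q)" .
  qed
  ultimately show ?thesis by (simp add: lgauss_def sum_distrib_left)
qed

text \<open>Here s = 1/(4 p) and t = 2 s k = k/(2 p) modulo q, so the phase is - p t^2 = - k^2
  s.\<close>

lemma lgauss_odd:
  assumes "coprime p (int q)" "odd q"
  shows "lgauss p k q = em q (k\<^sup>2 * (- minv q 4 * minv q p)) * gauss1 p q"
proof -
  have q: "q > 0" using assms(2) by (cases q) auto
  define s where "s = minv q 4 * minv q p"
  have "coprime 4 (int q)" using coprime_power_left_iff[of "2::int" 2 "int q"] assms(2) by simp
  hence "[(4 * minv q 4) * (p * minv q p) = 1 * 1] (mod int q)"
    using assms(1) by (intro cong_mult cong_modular_inverse1)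
  hence s: "[4 * p * s = 1] (mod int q)" by (simp add: s_def mult_ac)
  have "[4 * p * s * k = 1 * k] (mod int q)" by (intro cong_mult cong_refl s)
  hence "[2 * p * (2 * s * k) = k] (mod int q)" by (simp add: mult_ac)
  from lgauss_complete_square[OF q this]
  have "lgauss p k q = em q (- (p * (2 * s * k)\<^sup>2)) * gauss1 p q" .
  also have "em q (- (p * (2 * s * k)\<^sup>2)) = em q (k\<^sup>2 * (- s))"
  proof (rule em_cong)
    have "[4 * p * s * (- s * k\<^sup>2) = 1 * (- s * k\<^sup>2)] (mod int q)" by (intro cong_mult cong_refl s)
    thus "[- (p * (2 * s * k)\<^sup>2) = k\<^sup>2 * (- s)] (mod int q)"
      by (simp add: power2_eq_square mult_ac)
  qed
  finally show ?thesis by (simp add: s_def)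
qed

text \<open>The square is completed by t = k/p, which needs no division by 2. The factor
  \<open>- 1\<close> keeps the shape \<open>c q * minv q p\<close> used for
  equidistribution.\<close>

lemma lgauss_even_even:
  assumes "coprime p (int q)" "q > 0"
  shows "lgauss p (2 * k) q = em q (k\<^sup>2 * (- 1 * minv q p)) * gauss1 p q"
proof -
  let ?s = "minv q p"
  have s: "[p * ?s = 1] (mod int q)" by (rule cong_modular_inverse1[OF assms(1)])
  have "[p * ?s * (2 * k) = 1 * (2 * k)] (mod int q)" by (intro cong_mult cong_refl s)
  hence "[2 * p * (?s * k) = 2 * k] (mod int q)" by (simp add: mult_ac)
  from lgauss_complete_square[OF assms(2) this]
  have "lgauss p (2 * k) q = em q (- (p * (?s * k)\<^sup>2)) * gauss1 p q" .
  also have "em q (- (p * (?s * k)\<^sup>2)) = em q (k\<^sup>2 * (- 1 * ?s))"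
  proof (rule em_cong)
    have "[p * ?s * (- ?s * k\<^sup>2) = 1 * (- ?s * k\<^sup>2)] (mod int q)" by (intro cong_mult cong_refl s)
    thus "[- (p * (?s * k)\<^sup>2) = k\<^sup>2 * (- 1 * ?s)] (mod int q)"
      by (simp add: power2_eq_square mult_ac)
  qed
  finally show ?thesis .
qed

text \<open>Translating by half the modulus multiplies the sum by a sign.\<close>
lemma lgauss_eq_0:
  assumes "r > 0" "odd (p * int r + k)"
  shows "lgauss p k (2 * r) = 0"
proof -
  have "em (2 * r) (p * (h + int r)\<^sup>2 + k * (h + int r)) = - em (2 * r) (p * h\<^sup>2 + k * h)" for h
  proof -
    have "em (2 * r) (p * (h + int r)\<^sup>2 + k * (h + int r)) =
        em (2 * r) (p * h\<^sup>2 + k * h) * em (2 * r) (int r * (p * int r + k + 2 * p * h))"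
      unfolding em_add[symmetric]
      by (rule arg_cong[where f = "em _"]) (simp add: power2_eq_square algebra_simps)
    also have "em (2 * r) (int r * (p * int r + k + 2 * p * h)) = em 2 (p * int r + k + 2 * p * h)"
      using em_mult_left[of r 2 "p * int r + k + 2 * p * h"] assms(1) by (simp add: mult.commute[of r])
    also have "\<dots> = - 1" using assms(2) by (simp add: em_2)
    finally show ?thesis by simp
  qed
  hence "lgauss p k (2 * r) = - lgauss p k (2 * r)"
    using lgauss_shift[of "2 * r" p "int r" k] assms(1) by (simp add: lgauss_def sum_negf)
  thus ?thesis by simp
qed

text \<open>With h = 2 a + r b the part depending on b is a sign with exponent of the parity of b (p
  r b + k), which is even for b = 0 and b = 1.\<close>

lemma lgauss_two_mult_odd:
  assumes "odd r" "odd p" "odd k"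
  shows "lgauss p k (2 * r) = 2 * lgauss (2 * p) k r"
proof -
  have r: "r > 0" using assms(1) by (cases r) auto
  let ?I = "{0..<int r} \<times> {0..<2::int}"
  let ?g = "\<lambda>i. 2 * fst i + int r * snd i"
  have "lgauss p k (2 * r) = (\<Sum>i\<in>?I. em (2 * r) (p * (?g i)\<^sup>2 + k * ?g i))"
  proof (rule lgauss_residues[symmetric])
    fix i j assume ij: "i \<in> ?I" "j \<in> ?I" and c: "[?g i = ?g j] (mod int (2 * r))"
    have "[?g i = ?g j] (mod int r)" using cong_modulus_mult[of "?g i" "?g j" "int r" 2] c
      by (simp add: mult.commute)
    hence "[2 * fst i = 2 * fst j] (mod int r)" by (simp add: cong_def)
    hence "[fst i = fst j] (mod int r)" using assms(1) by (simp add: cong_mult_lcancel)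
    hence f: "fst i = fst j" using ij cong_interval_eq[of "fst i" r "fst j"] by auto
    have "int r * 2 dvd int r * (snd i - snd j)"
      using c f by (simp add: cong_iff_dvd_diff algebra_simps)
    hence "2 dvd snd i - snd j" using r by simp
    moreover have "0 \<le> snd i \<and> snd i < 2" "0 \<le> snd j \<and> snd j < 2" using ij by auto
    ultimately have "snd i = snd j" by presburger
    thus "i = j" using f by (simp add: prod_eq_iff)
  qed (use r in auto)
  also have "\<dots> = (\<Sum>i\<in>?I. em r (2 * p * (fst i)\<^sup>2 + k * fst i))"
  proof (intro sum.cong refl)
    fix i assume i: "i \<in> ?I"
    have "em (2 * r) (p * (?g i)\<^sup>2 + k * ?g i) =
        em (2 * r) (int 2 * (2 * p * (fst i)\<^sup>2 + k * fst i)) *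
        em (2 * r) (int r * (snd i * (p * int r * snd i + k + 4 * p * fst i)))"
      unfolding em_add[symmetric]
      by (rule arg_cong[where f = "em _"]) (simp add: power2_eq_square algebra_simps)
    also have "em (2 * r) (int r * (snd i * (p * int r * snd i + k + 4 * p * fst i))) =
        em 2 (snd i * (p * int r * snd i + k + 4 * p * fst i))"
      using em_mult_left[of r 2 "snd i * (p * int r * snd i + k + 4 * p * fst i)"] r
      by (simp add: mult.commute[of r])
    also have "\<dots> = 1" using assms by (auto simp: em_2)
    finally show "em (2 * r) (p * (?g i)\<^sup>2 + k * ?g i) = em r (2 * p * (fst i)\<^sup>2 + k * fst i)"
      using em_mult_left[of 2 r "2 * p * (fst i)\<^sup>2 + k * fst i"] by simp
  qed
  also have "\<dots> = (\<Sum>a\<in>{0..<int r}. \<Sum>b\<in>{0..<2::int}. em r (2 * p * a\<^sup>2 + k * a))"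
    unfolding sum.cartesian_product by (simp add: case_prod_beta)
  also have "\<dots> = 2 * lgauss (2 * p) k r"
    by (simp add: lgauss_def sum_distrib_left)
  finally show ?thesis .
qed

text \<open>Completing the square modulo r gives the phase - k^2 s with s = 1/(8 p). Rewriting it
  with modulus 2 r, so that the inverse of p is taken modulo q itself, introduces the factor 2 in
  the coefficient.\<close>

lemma lgauss_2_mod_4:
  assumes "coprime p (int (2 * r))" "odd r" "odd k"
  shows "lgauss p k (2 * r) =
    em (2 * r) (k\<^sup>2 * (- 2 * minv r 8 * minv (2 * r) p)) * (2 * gauss1 (2 * p) r)"
proof -
  have r: "r > 0" using assms(2) by (cases r) auto
  have odd_p: "odd p" using assms(1) by auto
  define s where "s = minv r 8 * minv (2 * r) p"
  have c8: "coprime 8 (int r)" using coprime_power_left_iff[of "2::int" 3 "int r"] assms(2) by simp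
  have "[p * minv (2 * r) p = 1] (mod int r)"
    using cong_modular_inverse1[OF assms(1)]
      cong_modulus_mult[of "p * minv (2 * r) p" 1 "int r" 2] by (simp add: mult.commute)
  hence "[(8 * minv r 8) * (p * minv (2 * r) p) = 1 * 1] (mod int r)"
    using c8 by (intro cong_mult cong_modular_inverse1)
  hence s: "[8 * p * s = 1] (mod int r)" by (simp add: s_def mult_ac)
  have "[8 * p * s * k = 1 * k] (mod int r)" by (intro cong_mult cong_refl s)
  hence "[2 * (2 * p) * (2 * s * k) = k] (mod int r)" by (simp add: mult_ac)
  from lgauss_complete_square[OF r this]
  have "lgauss (2 * p) k r = em r (- (2 * p * (2 * s * k)\<^sup>2)) * gauss1 (2 * p) r" .
  also have "em r (- (2 * p * (2 * s * k)\<^sup>2)) = em r (k\<^sup>2 * (- s))"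
  proof (rule em_cong)
    have "[8 * p * s * (- s * k\<^sup>2) = 1 * (- s * k\<^sup>2)] (mod int r)" by (intro cong_mult cong_refl s)
    thus "[- (2 * p * (2 * s * k)\<^sup>2) = k\<^sup>2 * (- s)] (mod int r)"
      by (simp add: power2_eq_square mult_ac)
  qed
  also have "\<dots> = em (2 * r) (k\<^sup>2 * (- 2 * minv r 8 * minv (2 * r) p))"
    using em_mult_left[of 2 r "k\<^sup>2 * (- s)"] by (simp add: s_def mult_ac)
  finally show ?thesis
    using lgauss_two_mult_odd[OF assms(2) odd_p assms(3)] by simp
qed

section \<open>Fourier expansion of the incomplete Gauss sum\<close>

lemma has_sum_finite_sum:
  fixes f :: "'i \<Rightarrow> 'a \<Rightarrow> complex"
  assumes "finite I" "\<And>i. i \<in> I \<Longrightarrow> (f i has_sum s i) A"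
  shows "((\<lambda>x. \<Sum>i\<in>I. f i x) has_sum (\<Sum>i\<in>I. s i)) A"
  using assms by (induction I rule: finite_induct) (auto intro!: has_sum_add)

lemma gauss_fourier:
  assumes "\<phi> \<in> BT" "q > 0"
  shows "gauss \<phi> p q = (\<Sum>\<^sub>\<infinity>k. fourier_coeff \<phi> k * lgauss p k q)"
proof -
  have "((\<lambda>k. \<Sum>h<q. fourier_coeff \<phi> k * ee (of_int k * (real h / real q)) * em q (p * (int h)\<^sup>2))
      has_sum (\<Sum>h<q. \<phi> (real h / real q) * em q (p * (int h)\<^sup>2))) UNIV"
    by (intro has_sum_finite_sum has_sum_cmult_left BT_fourier_series assms) auto
  moreover have "(\<Sum>h<q. \<phi> (real h / real q) * em q (p * (int h)\<^sup>2)) = gauss \<phi> p q"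
    by (simp add: gauss_def em_def)
  moreover have "(\<Sum>h<q. fourier_coeff \<phi> k * ee (of_int k * (real h / real q)) * em q (p * (int h)\<^sup>2)) =
      fourier_coeff \<phi> k * lgauss p k q" for k
  proof -
    have "ee (of_int k * (real h / real q)) * em q (p * (int h)\<^sup>2) = em q (p * (int h)\<^sup>2 + k * int h)" for h
      by (simp add: em_add) (simp add: em_def)
    thus ?thesis unfolding lgauss_def
      by (subst sum_int_interval[symmetric]) (simp add: sum_distrib_left mult.assoc)
  qed
  ultimately show ?thesis by (simp add: infsumI)
qed

lemma em_conv_ee: "em q (k\<^sup>2 * a) = ee (real_of_int (k\<^sup>2) * (of_int a / real q))"
  by (simp add: em_def)

lemma gauss_odd:
  assumes "\<phi> \<in> BT" "odd q" "coprime p (int q)"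
  shows "gauss \<phi> p q = gauss1 p q * Gfull \<phi> (of_int (- minv q 4 * minv q p) / real q)"
proof -
  have "q > 0" using assms(2) by (cases q) auto
  hence "gauss \<phi> p q = (\<Sum>\<^sub>\<infinity>k. fourier_coeff \<phi> k * em q (k\<^sup>2 * (- minv q 4 * minv q p)) * gauss1 p q)"
    by (simp only: gauss_fourier[OF assms(1)] lgauss_odd[OF assms(3,2)] mult.assoc)
  also have "\<dots> = Gfull \<phi> (of_int (- minv q 4 * minv q p) / real q) * gauss1 p q"
    unfolding Gfull_def em_conv_ee by (rule infsum_cmult_left')
  finally show ?thesis by (simp add: mult.commute)
qed

lemma gauss_0_mod_4:
  assumes "\<phi> \<in> BT" "4 dvd q" "q > 0" "coprime p (int q)"
  shows "gauss \<phi> p q = gauss1 p q * Gplus \<phi> (of_int (- 1 * minv q p) / real q)"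
proof -
  obtain r where r: "q = 2 * r" "even r" "r > 0"
    using assms(2,3) by (metis dvd_def even_mult_iff mult.assoc nat_0_less_mult_iff numeral_Bit0 mult_2 even_numeral mult_2_right)
  have zero: "lgauss p k q = 0" if "odd k" for k
    unfolding r(1) using r that by (intro lgauss_eq_0) auto
  have "gauss \<phi> p q = (\<Sum>\<^sub>\<infinity>k\<in>range (\<lambda>k. 2 * k). fourier_coeff \<phi> k * lgauss p k q)"
    unfolding gauss_fourier[OF assms(1,3)]
    by (rule infsum_cong_neutral) (auto intro!: zero)
  also have "\<dots> = (\<Sum>\<^sub>\<infinity>k. fourier_coeff \<phi> (2 * k) * lgauss p (2 * k) q)"
    by (subst infsum_reindex) (auto simp: inj_on_def o_def)
  also have "\<dots> = (\<Sum>\<^sub>\<infinity>k. fourier_coeff \<phi> (2 * k) * em q (k\<^sup>2 * (- 1 * minv q p)) * gauss1 p q)"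
    by (simp only: lgauss_even_even[OF assms(4,3)] mult.assoc)
  also have "\<dots> = Gplus \<phi> (of_int (- 1 * minv q p) / real q) * gauss1 p q"
    unfolding Gplus_def em_conv_ee by (rule infsum_cmult_left')
  finally show ?thesis by (simp add: mult.commute)
qed

lemma gauss_2_mod_4:
  assumes "\<phi> \<in> BT" "q = 2 * r" "odd r" "coprime p (int q)"
  shows "gauss \<phi> p q = 2 * gauss1 (2 * p) r * Gminus \<phi> (of_int (- 2 * minv r 8 * minv q p) / real q)"
proof -
  have r: "r > 0" using assms(3) by (cases r) auto
  hence q: "q > 0" using assms(2) by simp
  have odd_p: "odd p" using assms(2,4) by auto
  have zero: "lgauss p k q = 0" if "even k" for k
    unfolding assms(2) using r odd_p assms(3) that by (intro lgauss_eq_0) auto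
  have "gauss \<phi> p q = (\<Sum>\<^sub>\<infinity>k\<in>{k. odd k}. fourier_coeff \<phi> k * lgauss p k q)"
    unfolding gauss_fourier[OF assms(1) q]
    by (rule infsum_cong_neutral) (auto intro!: zero)
  also have "\<dots> = (\<Sum>\<^sub>\<infinity>k\<in>{k. odd k}. fourier_coeff \<phi> k *
      em q (k\<^sup>2 * (- 2 * minv r 8 * minv q p)) * (2 * gauss1 (2 * p) r))"
    using lgauss_2_mod_4[of p r] assms(3,4) unfolding assms(2)
    by (intro infsum_cong) (simp add: mult.assoc)
  also have "\<dots> = Gminus \<phi> (of_int (- 2 * minv r 8 * minv q p) / real q) * (2 * gauss1 (2 * p) r)"
    unfolding Gminus_def em_conv_ee by (rule infsum_cmult_left')
  finally show ?thesis by (simp add: mult_ac)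
qed

lemma continuous_Gfull: "\<phi> \<in> BT \<Longrightarrow> continuous_on UNIV (Gfull \<phi>)"
  unfolding Gfull_def[abs_def] by (rule continuous_on_trig_series[OF BT_summable])

lemma continuous_Gplus:
  assumes "\<phi> \<in> BT"
  shows "continuous_on UNIV (Gplus \<phi>)"
  unfolding Gplus_def[abs_def]
proof (rule continuous_on_trig_series)
  have "(\<lambda>k. norm (fourier_coeff \<phi> k)) summable_on range (\<lambda>k. 2 * k)"
    by (rule summable_on_subset[OF BT_summable[OF assms]]) simp
  thus "(\<lambda>k. norm (fourier_coeff \<phi> (2 * k))) summable_on UNIV"
    by (subst (asm) summable_on_reindex) (auto simp: inj_on_def o_def)
qed

lemma continuous_Gminus: "\<phi> \<in> BT \<Longrightarrow> continuous_on UNIV (Gminus \<phi>)"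
  unfolding Gminus_def[abs_def]
  by (intro continuous_on_trig_series summable_on_subset[OF BT_summable]) auto

lemma ee_square_periodic: "ee (real_of_int (n\<^sup>2) * (x + 1)) = ee (real_of_int (n\<^sup>2) * x)"
  by (simp only: distrib_left ee_add mult_1_right ee_of_int)

lemma Gfull_periodic: "Gfull \<phi> (x + 1) = Gfull \<phi> x"
  and Gplus_periodic: "Gplus \<phi> (x + 1) = Gplus \<phi> x"
  and Gminus_periodic: "Gminus \<phi> (x + 1) = Gminus \<phi> x"
  unfolding Gfull_def Gplus_def Gminus_def ee_square_periodic by (rule refl)+

section \<open>Exact law of the normalised Gauss sum\<close>

text \<open>Turns a maximal mean into a pointwise identity: the terms 1 - u are nonnegative and add
  up to 0.\<close>

lemma sum_signs_eq_card:
  fixes u :: "'a \<Rightarrow> complex"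
  assumes "finite A" "\<And>x. x \<in> A \<Longrightarrow> u x = 1 \<or> u x = - 1" "sum u A = of_nat (card A)" "x \<in> A"
  shows "u x = 1"
proof -
  have "(\<Sum>x\<in>A. 1 - Re (u x)) = Re (of_nat (card A) - sum u A)"
    by (simp add: sum_subtractf)
  hence "(\<Sum>x\<in>A. 1 - Re (u x)) = 0" using assms(3) by simp
  moreover have "1 - Re (u x) \<ge> 0" if "x \<in> A" for x using assms(2)[OF that] by auto
  ultimately have "1 - Re (u x) = 0"
    using sum_nonneg_eq_0_iff[OF assms(1), of "\<lambda>x. 1 - Re (u x)"] assms(4) by simp
  thus ?thesis using assms(2)[OF assms(4)] by auto
qed

text \<open>For signs, 1 + z u is twice the indicator of u = z.\<close>

lemma card_signs:
  fixes u :: "'a \<Rightarrow> complex"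
  assumes "finite A" "\<And>x. x \<in> A \<Longrightarrow> u x = 1 \<or> u x = - 1" "sum u A = 0" "z = 1 \<or> z = - 1"
  shows "2 * card {x\<in>A. u x = z} = card A"
proof -
  have "2 * (\<Sum>x\<in>A. if u x = z then 1 else 0) = (\<Sum>x\<in>A. 1 + z * u x)"
    unfolding sum_distrib_left
  proof (intro sum.cong refl)
    fix x assume x: "x \<in> A"
    show "2 * (if u x = z then 1 else 0) = 1 + z * u x" using assms(2)[OF x] assms(4) by auto
  qed
  also have "\<dots> = of_nat (card A)" using assms(3) by (simp add: sum.distrib sum_distrib_left[symmetric])
  finally have "complex_of_nat (2 * card {x\<in>A. u x = z}) = of_nat (card A)"
    using assms(1) by (simp add: sum.inter_filter[symmetric])
  thus ?thesis by (simp only: of_nat_eq_iff)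
qed

text \<open>Since (1 + a u)(1 + b v) is four times the indicator of u = a and v = b, the joint law
  of two signs is determined by three means.\<close>

lemma card_signs2:
  fixes u v :: "'a \<Rightarrow> complex"
  assumes "finite A" "\<And>x. x \<in> A \<Longrightarrow> u x = 1 \<or> u x = - 1" "\<And>x. x \<in> A \<Longrightarrow> v x = 1 \<or> v x = - 1"
    "sum u A = 0" "sum v A = 0" "(\<Sum>x\<in>A. u x * v x) = 0" "a = 1 \<or> a = - 1" "b = 1 \<or> b = - 1"
  shows "4 * card {x\<in>A. u x = a \<and> v x = b} = card A"
proof -
  have "4 * (\<Sum>x\<in>A. if u x = a \<and> v x = b then 1 else 0) = (\<Sum>x\<in>A. 1 + a * u x + b * v x + a * b * (u x * v x))"
    unfolding sum_distrib_left
  proof (intro sum.cong refl)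
    fix x assume x: "x \<in> A"
    show "4 * (if u x = a \<and> v x = b then 1 else 0) = 1 + a * u x + b * v x + a * b * (u x * v x)"
      using assms(2,3)[OF x] assms(7,8) by auto
  qed
  also have "\<dots> = of_nat (card A)"
    using assms(4-6) by (simp add: sum.distrib sum_distrib_left[symmetric])
  finally have "complex_of_nat (4 * card {x\<in>A. u x = a \<and> v x = b}) = of_nat (card A)"
    using assms(1) by (simp add: sum.inter_filter[symmetric])
  thus ?thesis by (simp only: of_nat_eq_iff)
qed

lemma is_square_square_part:
  fixes q :: nat
  assumes "is_square q" "q > 0"
  shows "q = (square_part q)\<^sup>2"
proof (rule dvd_antisym)
  obtain k where k: "q = k\<^sup>2" using assms by (auto simp: is_square_def)
  have "k dvd square_part q" by (simp add: dvd_square_part_iff k)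
  thus "q dvd (square_part q)\<^sup>2" unfolding k by (rule dvd_power_same)
qed (rule square_part_square_dvd)

text \<open>For q = k^2 the unnormalised sum is k^2 times \<open>totient k\<close>, while
  \<open>totient q\<close> is k times \<open>totient k\<close>. So the normalised mean is exactly
  1.\<close>

lemma sum_units_gauss1_normalized:
  assumes "q > 0"
  shows "(\<Sum>p\<in>units_mod q. gauss1 p q / sqrt (real q)) = (if is_square q then of_nat (totient q) else 0)"
proof (cases "is_square q")
  case True
  define k where "k = square_part q"
  have k: "q = k\<^sup>2" unfolding k_def by (rule is_square_square_part[OF True assms])
  have k0: "k > 0" using k assms by (auto intro: gr0I)
  have "sqrt (real q) = real k" by (simp add: k)
  moreover have "totient q = k * totient k" unfolding k using totient_power_Suc[of k 1] by (simp add: power2_eq_square)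
  moreover have "(\<Sum>p\<in>units_mod q. gauss1 p q) = of_nat q * of_nat (totient k)"
    using sum_units_gauss1[OF assms] True by (simp add: k_def)
  moreover have "complex_of_nat q = of_nat k * of_nat k" by (subst k) (simp add: power2_eq_square)
  ultimately show ?thesis using True k0
    by (simp add: sum_divide_distrib[symmetric])
next
  case False
  thus ?thesis using sum_units_gauss1[OF assms] by (simp add: sum_divide_distrib[symmetric])
qed

lemma eps_nonzero: "odd q \<Longrightarrow> eps q \<noteq> 0"
  by (auto simp: eps_def) presburger+

lemma complex_sqrt_square: "(complex_of_real (sqrt (real q)))\<^sup>2 = of_nat q"
  by (simp add: of_real_power[symmetric] del: of_real_power)

lemma gauss1_odd_sign:
  assumes "odd q" "coprime p (int q)"
  shows "gauss1 p q / (eps q * sqrt (real q)) = 1 \<or> gauss1 p q / (eps q * sqrt (real q)) = - 1"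
proof -
  have q: "q > 0" using assms(1) by (cases q) auto
  have "(gauss1 p q / (eps q * sqrt (real q)))\<^sup>2 = 1"
    using gauss1_odd_square[OF assms] eps_nonzero[OF assms(1)] q
    by (simp add: power_divide power_mult_distrib complex_sqrt_square)
  thus ?thesis by (simp add: power2_eq_1_iff)
qed

lemma sum_gauss1_odd_sign:
  assumes "odd q"
  shows "(\<Sum>p\<in>units_mod q. gauss1 p q / (eps q * sqrt (real q))) =
    (if is_square q then of_nat (totient q) else 0)"
proof -
  have q: "q > 0" using assms by (cases q) auto
  have "(\<Sum>p\<in>units_mod q. gauss1 p q / (eps q * sqrt (real q))) =
      (\<Sum>p\<in>units_mod q. gauss1 p q / sqrt (real q)) / eps q"
    by (simp add: sum_divide_distrib mult.commute)
  moreover have "eps q = 1" if sq: "is_square q"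
  proof -
    obtain k where k: "q = k\<^sup>2" using sq by (auto simp: is_square_def)
    have "k mod 4 = 1 \<or> k mod 4 = 3" using assms unfolding k by simp presburger
    hence "q mod 4 = 1" unfolding k power2_eq_square using mod_mult_eq[of k 4 k] by auto
    thus ?thesis by (simp add: eps_def)
  qed
  ultimately show ?thesis using sum_units_gauss1_normalized[OF q] by simp
qed

text \<open>A sign with mean 1 is constant. The representative \<open>b\<close> extends this to p
  outside the interval of representatives, as required for the argument 2 p when q is 2 modulo
  4.\<close>

lemma gauss1_odd_sign_square:
  assumes "odd q" "is_square q" "coprime p (int q)"
  shows "gauss1 p q / (eps q * sqrt (real q)) = 1"
proof -
  have q: "q > 0" using assms(1) by (cases q) auto
  obtain b where b: "b \<in> units_mod q" "[p = b] (mod int q)" using ex_unit_mod[OF q assms(3)] by blast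
  have "gauss1 b q / (eps q * sqrt (real q)) = 1"
    by (rule sum_signs_eq_card[OF finite_units_mod _ _ b(1)])
       (use assms sum_gauss1_odd_sign[OF assms(1)] gauss1_odd_sign units_modD in
         \<open>auto simp: card_units_mod\<close>)
  thus ?thesis using gauss1_cong[OF b(2)] by simp
qed

text \<open>For \<open>4 dvd q\<close> the normalised Gauss sum splits as a sign times \<open>1 \<plusminus> \<i>\<close>.\<close>
definition gsign :: "nat \<Rightarrow> int \<Rightarrow> complex" where
  "gsign q p = gauss1 p q / (sqrt (real q) * (1 + em 4 p))"

text \<open>On odd p this is the nontrivial character modulo 4, because \<open>em 4 p\<close> is the
  p-th power of i.\<close>

definition chi4 :: "int \<Rightarrow> complex" where
  "chi4 p = em 4 p / \<i>"

lemma chi4_sign: "odd p \<Longrightarrow> chi4 p = 1 \<or> chi4 p = - 1"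
  by (auto simp: chi4_def em_4)

lemma coprime_4_dvd_odd:
  assumes "4 dvd q" "coprime p (int q)"
  shows "odd p"
proof
  assume "even p"
  moreover have "even (int q)" using assms(1) by auto
  ultimately show False using assms(2) by (metis coprime_common_divisor odd_one)
qed

lemma one_plus_em_4_square:
  assumes "odd p"
  shows "(1 + em 4 p)\<^sup>2 = 2 * em 4 p" and "1 + em 4 p \<noteq> 0"
  using assms by (auto simp: em_4 power2_eq_square algebra_simps complex_eq_iff)

lemma gsign_sign:
  assumes "4 dvd q" "q > 0" "coprime p (int q)"
  shows "gsign q p = 1 \<or> gsign q p = - 1"
proof -
  have p: "odd p" using coprime_4_dvd_odd assms by blast
  have "em 4 p \<noteq> 0" using p by (auto simp: em_4)
  hence "(gsign q p)\<^sup>2 = 1"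
    using gauss1_0_mod_4_square[OF assms(1,3,2)] one_plus_em_4_square[OF p] assms(2)
    by (simp add: gsign_def power_divide power_mult_distrib complex_sqrt_square)
  thus ?thesis by (simp add: power2_eq_1_iff)
qed

lemma gauss1_conv_gsign:
  assumes "4 dvd q" "q > 0" "coprime p (int q)"
  shows "gauss1 p q / sqrt (real q) = gsign q p * (1 + \<i> * chi4 p)"
  using one_plus_em_4_square(2)[OF coprime_4_dvd_odd[OF assms(1,3)]] by (simp add: gsign_def chi4_def)

lemma gsign_chi4_cong:
  assumes "4 dvd q" "[p = p'] (mod int q)"
  shows "gsign q p = gsign q p'" "chi4 p = chi4 p'"
proof -
  have "int 4 dvd int q" using assms(1) by (simp only: int_dvd_int_iff)
  hence "[p = p'] (mod int 4)" using assms(2) cong_dvd_modulus by blast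
  hence "em 4 p = em 4 p'" by (rule em_cong)
  thus "gsign q p = gsign q p'" "chi4 p = chi4 p'"
    using gauss1_cong[OF assms(2)] by (simp_all add: gsign_def chi4_def)
qed

lemma sum_odd_function:
  assumes "q > 0" and per: "\<And>x y. [x = y] (mod int q) \<Longrightarrow> f x = f y"
    and odd: "\<And>p. coprime p (int q) \<Longrightarrow> f (- p) = - f p"
  shows "(\<Sum>p\<in>units_mod q. f p) = (0::complex)"
proof -
  have "(\<Sum>p\<in>units_mod q. f p) = (\<Sum>p\<in>units_mod q. f (- 1 * p))"
    by (rule sum_units_mod_mult[symmetric]) (use assms in auto)
  also have "\<dots> = (\<Sum>p\<in>units_mod q. - f p)"
    by (intro sum.cong refl) (simp add: odd units_modD)
  finally show ?thesis by (simp add: sum_negf)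
qed

text \<open>Under p -> -p both \<open>gauss1 p q\<close> and \<open>1 + em 4 p\<close> are
  conjugated, so the real sign \<open>gsign\<close> is even, while \<open>chi4\<close> is
  odd.\<close>

lemma sum_chi4:
  assumes "4 dvd q" "q > 0"
  shows "(\<Sum>p\<in>units_mod q. chi4 p) = 0" and "(\<Sum>p\<in>units_mod q. gsign q p * chi4 p) = 0"
proof -
  have c: "chi4 (- p) = - chi4 p" if "coprime p (int q)" for p
    using coprime_4_dvd_odd[OF assms(1) that] by (auto simp: chi4_def em_uminus em_4)
  have g: "gsign q (- p) = gsign q p" if p: "coprime p (int q)" for p
  proof -
    have "gsign q (- p) = cnj (gsign q p)"
      by (simp add: gsign_def gauss1_uminus em_uminus)
    thus ?thesis using gsign_sign[OF assms p] by auto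
  qed
  show "(\<Sum>p\<in>units_mod q. chi4 p) = 0"
    by (rule sum_odd_function[OF assms(2)]) (use c gsign_chi4_cong[OF assms(1)] in auto)
  show "(\<Sum>p\<in>units_mod q. gsign q p * chi4 p) = 0"
  proof (rule sum_odd_function[OF assms(2)])
    fix x y assume "[x = y] (mod int q)"
    thus "gsign q x * chi4 x = gsign q y * chi4 y" using gsign_chi4_cong[OF assms(1)] by metis
  qed (use c g in simp)
qed

text \<open>The normalised Gauss sum is \<open>gsign\<close> plus i times
  \<open>gsign * chi4\<close>, and the second part averages to 0.\<close>

lemma sum_gsign:
  assumes "4 dvd q" "q > 0"
  shows "(\<Sum>p\<in>units_mod q. gsign q p) = (if is_square q then of_nat (totient q) else 0)"
proof -
  have "(\<Sum>p\<in>units_mod q. gauss1 p q / sqrt (real q)) =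
      (\<Sum>p\<in>units_mod q. gsign q p + \<i> * (gsign q p * chi4 p))"
    by (intro sum.cong refl) (simp add: gauss1_conv_gsign[OF assms] units_modD algebra_simps)
  also have "\<dots> = (\<Sum>p\<in>units_mod q. gsign q p)"
    using sum_chi4(2)[OF assms] by (simp add: sum.distrib sum_distrib_left[symmetric])
  finally show ?thesis using sum_units_gauss1_normalized[OF assms(2)] by simp
qed

lemma signs_eq_iff:
  assumes "a = 1 \<or> a = - 1" "b = 1 \<or> b = - 1" "a' = 1 \<or> a' = - 1" "b' = 1 \<or> b' = - 1"
  shows "a * (1 + \<i> * b) = a' * (1 + \<i> * b') \<longleftrightarrow> a = a' \<and> b = (b' :: complex)"
  using assms by (auto simp: complex_eq_iff)

text \<open>The means of \<open>gsign\<close>, \<open>chi4\<close> and their product all vanish, so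
  the pair of signs is uniform; this is the law of X.\<close>

lemma gauss1_law_0_mod_4_nonsquare:
  assumes q: "4 dvd q" "q > 0" and ns: "\<not> is_square q"
    and z: "z \<in> {1 + \<i>, 1 - \<i>, -1 + \<i>, -1 - \<i>}"
  shows "4 * card {p\<in>units_mod q. gauss1 p q / sqrt (real q) = z} = totient q"
proof -
  obtain a b :: complex where ab: "a = 1 \<or> a = - 1" "b = 1 \<or> b = - 1" "z = a * (1 + \<i> * b)"
    using z by (elim insertE emptyE) (auto intro: that[of 1 1] that[of 1 "-1"] that[of "-1" "-1"] that[of "-1" 1])
  have "{p\<in>units_mod q. gauss1 p q / sqrt (real q) = z} = {p\<in>units_mod q. gsign q p = a \<and> chi4 p = b}"
  proof (intro Collect_cong conj_cong refl)
    fix p assume "p \<in> units_mod q"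
    hence p: "coprime p (int q)" by (rule units_modD)
    show "gauss1 p q / sqrt (real q) = z \<longleftrightarrow> gsign q p = a \<and> chi4 p = b"
      unfolding gauss1_conv_gsign[OF q p] ab(3)
      by (rule signs_eq_iff) (use ab gsign_sign[OF q p] chi4_sign[OF coprime_4_dvd_odd[OF q(1) p]] in auto)
  qed
  thus ?thesis
    using card_signs2[of "units_mod q" "gsign q" chi4 a b] gsign_sign[OF q] chi4_sign
      coprime_4_dvd_odd[OF q(1)] units_modD sum_chi4[OF q] sum_gsign[OF q] ns ab
    by (simp add: card_units_mod)
qed

text \<open>Mean 1 forces \<open>gsign\<close> to be 1 on all units, and only the balanced sign
  \<open>chi4\<close> remains; this is the law of Z.\<close>

lemma gauss1_law_0_mod_4_square:
  assumes q: "4 dvd q" "q > 0" and sq: "is_square q" and z: "z \<in> {1 + \<i>, 1 - \<i>}"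
  shows "2 * card {p\<in>units_mod q. gauss1 p q / sqrt (real q) = z} = totient q"
    and "p \<in> units_mod q \<Longrightarrow> gauss1 p q / sqrt (real q) \<in> {1 + \<i>, 1 - \<i>}"
proof -
  have one: "gsign q p = 1" if "p \<in> units_mod q" for p
    by (rule sum_signs_eq_card[OF finite_units_mod _ _ that])
       (use sum_gsign[OF q] sq gsign_sign[OF q] units_modD in \<open>auto simp: card_units_mod\<close>)
  have g: "gauss1 p q / sqrt (real q) = 1 + \<i> * chi4 p" if "p \<in> units_mod q" for p
    using gauss1_conv_gsign[OF q units_modD[OF that]] one[OF that] by simp
  have s: "chi4 p = 1 \<or> chi4 p = - 1" if "p \<in> units_mod q" for p
    using chi4_sign coprime_4_dvd_odd[OF q(1) units_modD[OF that]] by blast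
  obtain b :: complex where b: "b = 1 \<or> b = - 1" "z = 1 + \<i> * b"
    using z by (elim insertE emptyE) (auto intro: that[of 1] that[of "-1"])
  have "{p\<in>units_mod q. gauss1 p q / sqrt (real q) = z} = {p\<in>units_mod q. chi4 p = b}"
    using g by (auto simp: b(2))
  thus "2 * card {p\<in>units_mod q. gauss1 p q / sqrt (real q) = z} = totient q"
    using card_signs[of "units_mod q" chi4 b] s sum_chi4[OF q] b by (simp add: card_units_mod)
  show "p \<in> units_mod q \<Longrightarrow> gauss1 p q / sqrt (real q) \<in> {1 + \<i>, 1 - \<i>}"
    using g[of p] s[of p] by auto
qed

lemma gauss1_law_odd_nonsquare:
  assumes "odd q" "\<not> is_square q" "z \<in> {1, - 1}"
  shows "2 * card {p\<in>units_mod q. gauss1 p q / (eps q * sqrt (real q)) = z} = totient q"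
  using card_signs[of "units_mod q" "\<lambda>p. gauss1 p q / (eps q * sqrt (real q))" z]
    gauss1_odd_sign[OF assms(1)] units_modD sum_gauss1_odd_sign[OF assms(1)] assms
  by (simp add: card_units_mod)

text \<open>The map p -> 2 p sends the units modulo 2 r bijectively to the units modulo r: the
  totients agree, and units modulo 2 r are odd, so congruence modulo r lifts to 2 r.\<close>

lemma gauss1_law_2_mod_4_nonsquare:
  assumes "odd r" "\<not> is_square r" "z \<in> {1, - 1}"
  shows "2 * card {p\<in>units_mod (2 * r). gauss1 (2 * p) r / (eps r * sqrt (real r)) = z} = totient (2 * r)"
proof -
  have r: "r > 0" using assms(1) by (cases r) auto
  define f where "f = (\<lambda>p. gauss1 p r / (eps r * sqrt (real r)))"
  have tot: "totient (2 * r) = totient r" using assms(1) by (simp add: totient_double)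
  have cop: "coprime p (int r)" "odd p" if "p \<in> units_mod (2 * r)" for p
    using units_modD[OF that] by auto
  have "(\<Sum>p\<in>units_mod (2 * r). f (2 * p)) = (\<Sum>p\<in>units_mod r. f p)"
  proof (rule sum_units_mod[OF r])
    fix x y assume "[x = y] (mod int r)"
    thus "f x = f y" unfolding f_def using gauss1_cong by metis
  next
    fix i j assume ij: "i \<in> units_mod (2 * r)" "j \<in> units_mod (2 * r)" "[2 * i = 2 * j] (mod int r)"
    hence "[i = j] (mod int r)" using assms(1) by (simp add: cong_mult_lcancel)
    moreover have "[i = j] (mod 2)" using cop(2)[OF ij(1)] cop(2)[OF ij(2)]
      by (simp add: cong_def odd_iff_mod_2_eq_one)
    ultimately have "[i = j] (mod (2 * int r))"
      using assms(1) by (intro coprime_cong_mult) auto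
    thus "i = j" using ij units_mod_cong_eq[of i "2 * r" j] by simp
  qed (use assms(1) cop in \<open>auto simp: card_units_mod tot\<close>)
  also have "\<dots> = 0" using sum_gauss1_odd_sign[OF assms(1)] assms(2) by (simp add: f_def)
  finally have "2 * card {p\<in>units_mod (2 * r). f (2 * p) = z} = card (units_mod (2 * r))"
    using assms cop gauss1_odd_sign[OF assms(1)]
    by (intro card_signs) (auto simp: f_def)
  thus ?thesis by (simp add: f_def card_units_mod)
qed

section \<open>Equidistribution and convergence in law\<close>

lemma tendsto_approx:
  fixes f :: "'a \<Rightarrow> 'b::metric_space"
  assumes "\<And>e. e > 0 \<Longrightarrow> \<exists>g l. (g \<longlongrightarrow> l) F \<and> (\<forall>\<^sub>F x in F. dist (f x) (g x) \<le> e) \<and> dist l L \<le> e"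
  shows "(f \<longlongrightarrow> L) F"
proof (rule tendstoI)
  fix e :: real assume e: "e > 0"
  then obtain g l where g: "(g \<longlongrightarrow> l) F" "\<forall>\<^sub>F x in F. dist (f x) (g x) \<le> e / 4" "dist l L \<le> e / 4"
    using assms[of "e / 4"] by auto
  have "\<forall>\<^sub>F x in F. dist (g x) l < e / 4" using g(1) e by (intro tendstoD) auto
  with g(2) show "\<forall>\<^sub>F x in F. dist (f x) L < e"
  proof eventually_elim
    case (elim x)
    have "dist (f x) L \<le> dist (f x) (g x) + dist (g x) L" by (rule dist_triangle)
    also have "dist (g x) L \<le> dist (g x) l + dist l L" by (rule dist_triangle)
    finally show ?case using elim g(3) e by linarith
  qed
qed

lemma periodic_continuous_bounded:
  fixes f :: "real \<Rightarrow> complex"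
  assumes "continuous_on UNIV f" "\<And>x. f (x + 1) = f x"
  obtains M where "M > 0" "\<And>x. norm (f x) \<le> M"
proof -
  have "compact (f ` {0..1})"
    using assms(1) continuous_on_subset by (intro compact_continuous_image) blast+
  then obtain M where M: "M > 0" "\<And>x. x \<in> {0..1} \<Longrightarrow> norm (f x) \<le> M"
    using compact_imp_bounded bounded_pos by (metis image_eqI)
  have "norm (f x) \<le> M" for x
  proof -
    have "x = frac x + of_int \<lfloor>x\<rfloor>" by (simp add: frac_def)
    hence "f x = f (frac x)" using periodic_add_int[of f "frac x" "\<lfloor>x\<rfloor>"] assms(2) by simp
    thus ?thesis using M(2)[of "frac x"] frac_ge_0[of x] frac_lt_1[of x] by simp
  qed
  thus ?thesis using M(1) that by blast
qed

lemma trig_poly_continuous: "trig_poly g \<Longrightarrow> continuous_on UNIV g"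
  by (induction rule: trig_poly.induct) (auto intro!: continuous_intros)

lemma trig_poly_periodic: "trig_poly g \<Longrightarrow> g (x + 1) = g x"
  by (induction rule: trig_poly.induct) (simp_all add: distrib_left ee_add)

lemma norm_integral_diff_le:
  fixes f g :: "real \<Rightarrow> complex"
  assumes "continuous_on UNIV f" "continuous_on UNIV g" "\<And>x. norm (f x - g x) \<le> e"
  shows "norm (integral {0..1} f - integral {0..1} g) \<le> e"
proof -
  have "integral {0..1} f - integral {0..1} g = integral {0..1} (\<lambda>x. f x - g x)"
    using assms by (intro integral_diff[symmetric] continuous_imp_integrable_01)
  also have "norm \<dots> \<le> e * (1 - 0)"
    using assms continuous_on_subset[of UNIV] by (intro integral_bound continuous_intros) auto
  finally show ?thesis by simp
qed

section \<open>Weighted averages over the units\<close>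

text \<open>In the application \<open>w q\<close> is the indicator of one value of the normalised
  Gauss sum, \<open>L\<close> its exact frequency, and \<open>c q\<close> the factor in front of the
  inverse of p. The gcd bound 2 is attained when q is 2 modulo 4.\<close>

locale unit_weights =
  fixes S :: "nat set" and w :: "nat \<Rightarrow> int \<Rightarrow> complex" and c :: "nat \<Rightarrow> int" and L :: complex
  assumes pos: "q \<in> S \<Longrightarrow> q > 0"
    and inv: "q \<in> S \<Longrightarrow> square_invariant q (w q)"
    and gcd_c: "q \<in> S \<Longrightarrow> gcd (c q) (int q) \<le> 2"
    and mean: "q \<in> S \<Longrightarrow> (\<Sum>p\<in>units_mod q. w q p) = L * of_nat (totient q)"
begin

definition avg :: "(real \<Rightarrow> complex) \<Rightarrow> (real \<Rightarrow> complex) \<Rightarrow> nat \<Rightarrow> complex" where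
  "avg f H q = (\<Sum>p\<in>units_mod q. w q p * (f (of_int p / real q) * H (of_int (c q * minv q p) / real q)))
     / of_nat (totient q)"

abbreviation "F \<equiv> at_top \<sqinter> principal S"

lemma eventually_F: "eventually P F \<longleftrightarrow> (\<exists>Q. \<forall>q\<ge>Q. q \<in> S \<longrightarrow> P q)"
  by (simp add: eventually_inf_principal eventually_at_top_linorder)

lemma eventually_F_I: "(\<And>q. q \<in> S \<Longrightarrow> P q) \<Longrightarrow> eventually P F"
  unfolding eventually_F by blast

lemma norm_w_le: "q \<in> S \<Longrightarrow> norm (w q p) \<le> 1"
  using inv by (simp add: square_invariant_def)

text \<open>The bound \<open>M\<close> may depend on p/q: for indicators of sets the approximation
  error is small only on average.\<close>

lemma norm_avg_diff_le:
  assumes q: "q \<in> S" and le: "\<And>x y. norm (f x * H y - g x * K y) \<le> M x"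
  shows "norm (avg f H q - avg g K q) \<le> (\<Sum>p\<in>units_mod q. M (of_int p / real q)) / real (totient q)"
proof -
  have "avg f H q - avg g K q = (\<Sum>p\<in>units_mod q. w q p *
      (f (of_int p / real q) * H (of_int (c q * minv q p) / real q) -
       g (of_int p / real q) * K (of_int (c q * minv q p) / real q))) / of_nat (totient q)"
    by (simp add: avg_def diff_divide_distrib[symmetric] sum_subtractf[symmetric] right_diff_distrib)
  also have "norm \<dots> \<le> (\<Sum>p\<in>units_mod q. M (of_int p / real q)) / real (totient q)"
    unfolding norm_divide norm_of_nat
  proof (intro divide_right_mono sum_norm_le)
    fix p
    have "norm (w q p) * norm (f (of_int p / real q) * H (of_int (c q * minv q p) / real q) -
        g (of_int p / real q) * K (of_int (c q * minv q p) / real q)) \<le> 1 * M (of_int p / real q)"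
      by (intro mult_mono norm_w_le q le) auto
    thus "norm (w q p * (f (of_int p / real q) * H (of_int (c q * minv q p) / real q) -
        g (of_int p / real q) * K (of_int (c q * minv q p) / real q))) \<le> M (of_int p / real q)"
      by (simp add: norm_mult)
  qed simp
  finally show ?thesis .
qed

lemma dist_avg_le:
  assumes q: "q \<in> S" and le: "\<And>x y. norm (f x * H y - g x * K y) \<le> M"
  shows "dist (avg f H q) (avg g K q) \<le> M"
proof -
  have "dist (avg f H q) (avg g K q) \<le> (\<Sum>p\<in>units_mod q. M) / real (totient q)"
    unfolding dist_norm by (rule norm_avg_diff_le[OF q le])
  also have "\<dots> = M" using pos[OF q] by (simp add: card_units_mod)
  finally show ?thesis .
qed

lemma avg_monom:
  "avg (\<lambda>x. a * ee (of_int m * x)) (\<lambda>x. b * ee (of_int n * x)) q =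
    a * b * (ksum (w q) q m (n * c q) / of_nat (totient q))"
proof -
  have "em q (m * p + n * c q * minv q p) =
      ee (of_int m * (of_int p / real q)) * ee (of_int n * (of_int (c q * minv q p) / real q))" for p
    unfolding em_add by (simp add: em_def mult_ac)
  thus ?thesis by (simp add: avg_def ksum_def sum_distrib_left mult_ac)
qed

lemma tendsto_ksum:
  assumes "m \<noteq> 0 \<or> n \<noteq> 0"
  shows "((\<lambda>q. ksum (w q) q m (n * c q) / of_nat (totient q)) \<longlongrightarrow> 0) F"
proof (rule tendstoI)
  fix e :: real assume e: "e > 0"
  \<comment> \<open>Bounds \<open>gcd m q\<close> if \<open>m\<close> is nonzero and
    \<open>gcd (n * c q) q\<close>, which is at most \<open>2 * |n|\<close>, if \<open>n\<close> is
    nonzero.\<close>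
  define C where "C = nat (\<bar>m\<bar> + 2 * \<bar>n\<bar>)"
  have "e / 2 > 0" using e by simp
  from ksum_small[OF this, of C] obtain Q where Q: "\<forall>q\<ge>Q. \<forall>w m n. square_invariant q w \<longrightarrow>
      (gcd m (int q) \<le> int C \<or> gcd n (int q) \<le> int C) \<longrightarrow> norm (ksum w q m n) \<le> e / 2 * real (totient q)"
    by blast
  show "\<forall>\<^sub>F q in F. dist (ksum (w q) q m (n * c q) / of_nat (totient q)) 0 < e"
    unfolding eventually_F
  proof (intro exI allI impI)
    fix q assume q: "Q \<le> q" "q \<in> S"
    have "gcd m (int q) \<le> int C \<or> gcd (n * c q) (int q) \<le> int C"
    proof (cases "m = 0")
      case False
      hence "gcd m (int q) \<le> \<bar>m\<bar>" by (intro zdvd_imp_le) auto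
      thus ?thesis by (auto simp: C_def)
    next
      case True
      hence n: "n \<noteq> 0" using assms by simp
      have "gcd (n * c q) (int q) dvd gcd (n * c q) (n * int q)" by (intro gcd_greatest) auto
      also have "\<dots> = \<bar>n\<bar> * gcd (c q) (int q)" by (simp add: gcd_mult_distrib_int)
      finally have "gcd (n * c q) (int q) \<le> \<bar>n\<bar> * gcd (c q) (int q)"
        using n pos[OF q(2)] by (intro zdvd_imp_le) auto
      also have "\<dots> \<le> \<bar>n\<bar> * 2" by (intro mult_left_mono gcd_c q) auto
      finally show ?thesis by (auto simp: C_def)
    qed
    hence "norm (ksum (w q) q m (n * c q)) \<le> e / 2 * real (totient q)"
      using Q q(1) inv[OF q(2)] by blast
    hence "norm (ksum (w q) q m (n * c q)) / real (totient q) \<le> e / 2"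
      using pos[OF q(2)] by (simp add: divide_le_eq)
    also have "e / 2 < e" using e by simp
    finally show "dist (ksum (w q) q m (n * c q) / of_nat (totient q)) 0 < e"
      by (simp add: norm_divide)
  qed
qed

text \<open>The Weyl criterion: the zero frequency yields the mean \<open>L\<close> exactly, and at
  every other frequency both sides tend to 0.\<close>

lemma tendsto_avg_monom:
  "(avg (\<lambda>x. a * ee (of_int m * x)) (\<lambda>x. b * ee (of_int n * x)) \<longlongrightarrow>
    L * (integral {0..1} (\<lambda>x. a * ee (of_int m * x)) * integral {0..1} (\<lambda>x. b * ee (of_int n * x)))) F"
proof (cases "m = 0 \<and> n = 0")
  case True
  have "\<forall>\<^sub>F q in F. a * b * L = avg (\<lambda>x. a * ee (of_int m * x)) (\<lambda>x. b * ee (of_int n * x)) q"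
  proof (rule eventually_F_I)
    fix q assume q: "q \<in> S"
    have "ksum (w q) q 0 0 = L * of_nat (totient q)" using mean[OF q] by (simp add: ksum_def)
    thus "a * b * L = avg (\<lambda>x. a * ee (of_int m * x)) (\<lambda>x. b * ee (of_int n * x)) q"
      unfolding avg_monom using True pos[OF q] by simp
  qed
  hence "(avg (\<lambda>x. a * ee (of_int m * x)) (\<lambda>x. b * ee (of_int n * x)) \<longlongrightarrow> a * b * L) F"
    by (rule Lim_transform_eventually[OF tendsto_const])
  thus ?thesis using True by (simp add: mult_ac)
next
  case False
  have "(avg (\<lambda>x. a * ee (of_int m * x)) (\<lambda>x. b * ee (of_int n * x)) \<longlongrightarrow> a * b * 0) F"
    unfolding avg_monom[abs_def] using False by (intro tendsto_mult tendsto_const tendsto_ksum) auto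
  moreover have "integral {0..1} (\<lambda>x. a * ee (of_int m * x)) * integral {0..1} (\<lambda>x. b * ee (of_int n * x)) = 0"
    using False by (auto simp: integral_ee)
  ultimately show ?thesis by (simp only:) simp
qed

lemma tendsto_avg_trig:
  assumes "trig_poly f" "trig_poly H"
  shows "(avg f H \<longlongrightarrow> L * (integral {0..1} f * integral {0..1} H)) F"
  using assms(1)
proof induction
  case (monom a m)
  show ?case using assms(2)
  proof induction
    case (monom b n)
    show ?case by (rule tendsto_avg_monom)
  next
    case (add H K)
    have "avg (\<lambda>x. a * ee (of_int m * x)) (\<lambda>x. H x + K x) =
        (\<lambda>q. avg (\<lambda>x. a * ee (of_int m * x)) H q + avg (\<lambda>x. a * ee (of_int m * x)) K q)"
      by (simp add: fun_eq_iff avg_def distrib_left sum.distrib add_divide_distrib)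
    moreover have "integral {0..1} (\<lambda>x. H x + K x) = integral {0..1} H + integral {0..1} K"
      using add by (intro integral_add continuous_imp_integrable_01 trig_poly_continuous)
    ultimately show ?case
      using tendsto_add[OF add.IH] by (simp add: distrib_left)
  qed
next
  case (add f g)
  have "avg (\<lambda>x. f x + g x) H = (\<lambda>q. avg f H q + avg g H q)"
    by (simp add: fun_eq_iff avg_def distrib_left distrib_right sum.distrib add_divide_distrib)
  moreover have "integral {0..1} (\<lambda>x. f x + g x) = integral {0..1} f + integral {0..1} g"
    using add by (intro integral_add continuous_imp_integrable_01 trig_poly_continuous)
  ultimately show ?case
    using tendsto_add[OF add.IH] by (simp add: distrib_left distrib_right)
qed

lemma tendsto_avg_continuous:
  assumes f: "continuous_on UNIV f" "\<And>x. f (x + 1) = f x"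
    and H: "continuous_on UNIV H" "\<And>x. H (x + 1) = H x"
  shows "(avg f H \<longlongrightarrow> L * (integral {0..1} f * integral {0..1} H)) F"
proof (rule tendsto_approx)
  fix e :: real assume e: "e > 0"
  obtain M1 where M1: "M1 > 0" "\<And>x. norm (f x) \<le> M1" using periodic_continuous_bounded[OF f] by blast
  obtain M2 where M2: "M2 > 0" "\<And>x. norm (H x) \<le> M2" using periodic_continuous_bounded[OF H] by blast
  \<comment> \<open>From \<open>a * b - a' * b' = (a - a') * b + a' * (b - b')\<close> with
    \<open>norm a' <= M1 + 1\<close>. The factor \<open>1 + norm L\<close> in \<open>e'\<close>
    controls the averages and the limits at once.\<close>
  define M where "M = M1 + 1 + M2"
  define e' where "e' = min 1 (e / (M * (1 + norm L)))"
  have M: "M > 0" using M1 M2 by (simp add: M_def)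
  hence pos: "M * (1 + norm L) > 0" by (simp add: add_pos_nonneg)
  have "e' \<le> e / (M * (1 + norm L))" by (simp add: e'_def)
  hence "M * e' * (1 + norm L) \<le> e" using pos by (simp add: pos_le_divide_eq mult_ac)
  moreover have "e' > 0" "e' \<le> 1" using e pos by (simp_all add: e'_def)
  ultimately have e': "e' > 0" "e' \<le> 1" "M * e' * (1 + norm L) \<le> e" by simp_all
  have "M * e' \<le> M * e' * (1 + norm L)" "norm L * (M * e') \<le> M * e' * (1 + norm L)"
    using M e'(1) by (simp_all add: algebra_simps)
  hence Me: "M * e' \<le> e" "norm L * (M * e') \<le> e" using e'(3) by linarith+
  obtain g where g: "trig_poly g" "\<And>x. norm (f x - g x) < e'"
    using trig_poly_approx[OF f e'(1)] by blast
  obtain K where K: "trig_poly K" "\<And>x. norm (H x - K x) < e'"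
    using trig_poly_approx[OF H e'(1)] by blast
  have prod: "norm (a * b - a' * b') \<le> M * e'"
    if "norm a \<le> M1" "norm b \<le> M2" "norm (a - a') \<le> e'" "norm (b - b') \<le> e'" for a b a' b' :: complex
  proof -
    have "norm a' \<le> M1 + 1"
      using that(1,3) e'(2) norm_triangle_ineq4[of a "a - a'"] by simp
    hence "norm (a - a') * norm b + norm a' * norm (b - b') \<le> e' * M2 + (M1 + 1) * e'"
      using that e'(1) M1(1) by (intro add_mono mult_mono) auto
    moreover have "a * b - a' * b' = (a - a') * b + a' * (b - b')" by (simp add: algebra_simps)
    hence "norm (a * b - a' * b') \<le> norm (a - a') * norm b + norm a' * norm (b - b')"
      unfolding norm_mult[symmetric] by (simp only: norm_triangle_ineq)
    moreover have "e' * M2 + (M1 + 1) * e' = M * e'" by (simp add: M_def algebra_simps)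
    ultimately show ?thesis by linarith
  qed
  show "\<exists>h l. (h \<longlongrightarrow> l) F \<and> (\<forall>\<^sub>F q in F. dist (avg f H q) (h q) \<le> e) \<and>
      dist l (L * (integral {0..1} f * integral {0..1} H)) \<le> e"
  proof (intro exI conjI)
    show "(avg g K \<longlongrightarrow> L * (integral {0..1} g * integral {0..1} K)) F"
      by (rule tendsto_avg_trig[OF g(1) K(1)])
    have "norm (f x * H y - g x * K y) \<le> e" for x y
      using prod[OF M1(2) M2(2) less_imp_le[OF g(2)] less_imp_le[OF K(2)]] Me(1) by (rule order_trans)
    thus "\<forall>\<^sub>F q in F. dist (avg f H q) (avg g K q) \<le> e"
      by (intro eventually_F_I dist_avg_le)
    have "norm (integral {0..1} h) \<le> m" if "continuous_on UNIV h" "\<And>x. norm (h x) \<le> m"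
      for h :: "real \<Rightarrow> complex" and m
      using norm_integral_diff_le[of h "\<lambda>_. 0" m] that by simp
    hence "norm (integral {0..1} f * integral {0..1} H - integral {0..1} g * integral {0..1} K) \<le> M * e'"
      using f H M1 M2 g K trig_poly_continuous
      by (intro prod norm_integral_diff_le) (auto intro: less_imp_le)
    hence "norm L * norm (integral {0..1} f * integral {0..1} H - integral {0..1} g * integral {0..1} K) \<le>
        norm L * (M * e')" by (rule mult_left_mono) simp
    thus "dist (L * (integral {0..1} g * integral {0..1} K)) (L * (integral {0..1} f * integral {0..1} H)) \<le> e"
      using Me(2) by (simp add: dist_norm norm_minus_commute norm_mult flip: right_diff_distrib)
  qed
qed

end

section \<open>Sets with null frontier\<close>

text \<open>A continuous majorant of the indicator of \<open>E\<close> that tends to the indicator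
  of its closure. The empty set is separate because \<open>infdist t {}\<close> is 0, which would
  give the value 1.\<close>

definition near :: "real set \<Rightarrow> nat \<Rightarrow> real \<Rightarrow> real" where
  "near E n t = (if E = {} then 0 else max 0 (1 - real n * infdist t E))"

lemma near_bounds: "0 \<le> near E n t" "near E n t \<le> 1" "t \<in> E \<Longrightarrow> near E n t = 1"
  by (auto simp: near_def infdist_nonneg)

lemma continuous_near: "continuous_on A (near E n)"
  unfolding near_def[abs_def] by (cases "E = {}") (auto intro!: continuous_intros)

lemma near_periodic:
  assumes "\<And>t. t + 1 \<in> E \<longleftrightarrow> t \<in> E"
  shows "near E n (t + 1) = near E n t"
proof -
  have "(\<lambda>a. dist (t + 1) a) ` E = (\<lambda>a. dist t a) ` E"
  proof (intro equalityI image_subsetI)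
    fix a assume "a \<in> E"
    thus "dist (t + 1) a \<in> (\<lambda>a. dist t a) ` E"
      using assms[of "a - 1"] by (intro image_eqI[of _ _ "a - 1"]) (auto simp: dist_real_def algebra_simps)
    show "dist t a \<in> (\<lambda>a. dist (t + 1) a) ` E"
      using assms[of a] \<open>a \<in> E\<close> by (intro image_eqI[of _ _ "a + 1"]) (auto simp: dist_real_def)
  qed
  thus ?thesis by (simp add: near_def infdist_def image_def)
qed

lemma near_tendsto: "(\<lambda>n. near E n t) \<longlonglongrightarrow> indicat_real (closure E) t"
proof (cases "E = {} \<or> t \<in> closure E")
  case True
  hence "near E n t = indicat_real (closure E) t" for n
    using in_closure_iff_infdist_zero[of E t] by (cases "E = {}") (auto simp: near_def)
  thus ?thesis by simp
next
  case False
  hence d: "infdist t E > 0"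
    using in_closure_iff_infdist_zero[of E t] infdist_nonneg[of t E] by (auto simp: less_le)
  obtain N :: nat where N: "real N > 1 / infdist t E" using reals_Archimedean2 by blast
  have "near E n t = indicat_real (closure E) t" if "n \<ge> N" for n
  proof -
    have "1 / infdist t E \<le> real n" using N that by linarith
    hence "1 \<le> real n * infdist t E" using d by (simp add: divide_le_eq)
    thus ?thesis using False by (simp add: near_def)
  qed
  hence "\<forall>\<^sub>F n in sequentially. near E n t = indicat_real (closure E) t"
    by (auto simp: eventually_sequentially)
  thus ?thesis by (rule tendsto_eventually)
qed

text \<open>Take continuous majorants of the periodic extension P of D and of its complement, the
  latter turned into a minorant of P. Their gap converges boundedly to the indicator of the frontier
  of P, which is null.\<close>

lemma jordan_squeeze:
  fixes D :: "real set"
  assumes D: "D \<subseteq> {0..<1}" and null: "negligible (frontier D)" and e: "e > 0"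
  obtains l u :: "real \<Rightarrow> real" where
    "continuous_on UNIV l" "continuous_on UNIV u" "\<And>t. l (t + 1) = l t" "\<And>t. u (t + 1) = u t"
    "\<And>t. l t \<le> of_bool (frac t \<in> D)" "\<And>t. of_bool (frac t \<in> D) \<le> u t"
    "integral {0..1} (\<lambda>t. u t - l t) < e"
proof -
  define P where "P = {t. frac t \<in> D}"
  have per: "t + 1 \<in> P \<longleftrightarrow> t \<in> P" "t + 1 \<in> - P \<longleftrightarrow> t \<in> - P" for t by (simp_all add: P_def frac_1_eq)
  let ?g = "\<lambda>t. indicat_real (closure P) t + indicat_real (closure (- P)) t - 1"
  let ?f = "\<lambda>n t. near P n t + near (- P) n t - 1"
  have lim: "(\<lambda>n. integral {0..1} (?f n)) \<longlonglongrightarrow> integral {0..1} ?g"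
  proof (rule dominated_convergence)
    show "?f n integrable_on {0..1}" for n
      by (intro integrable_continuous_real continuous_intros continuous_near)
    show "(\<lambda>t::real. 1 :: real) integrable_on {0..1}" by (rule integrable_const_ivl)
    fix n and t :: real
    show "norm (?f n t) \<le> 1"
      using near_bounds[where E = P and n = n and t = t] near_bounds[where E = "- P" and n = n and t = t] by (auto simp: abs_le_iff)
    show "(\<lambda>n. ?f n t) \<longlonglongrightarrow> ?g t" by (intro tendsto_intros near_tendsto)
  qed
  have "integral {0..1} ?g = 0"
  proof -
    have "(?g has_integral 0) {0..1}"
    proof (rule has_integral_spike[where f = "\<lambda>_. 0"])
      \<comment> \<open>\<open>P\<close> agrees with \<open>D\<close> only inside the open unit
        interval, so the endpoints are discarded as well.\<close>
      show "negligible (frontier D \<union> {0, 1})" using null by auto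
      show "((\<lambda>_. 0) has_integral (0::real)) {0..1}" by simp
      fix t :: real assume "t \<in> {0..1} - (frontier D \<union> {0, 1})"
      hence t: "t \<in> {0<..<1}" "t \<notin> frontier D" by auto
      have PD: "{0<..<1} \<inter> P \<subseteq> D" "{0<..<1} \<inter> - P \<subseteq> - D"
        by (auto simp: P_def frac_eq[THEN iffD2])
      have "t \<notin> closure P \<or> t \<notin> closure (- P)"
      proof (rule ccontr)
        assume "\<not> (t \<notin> closure P \<or> t \<notin> closure (- P))"
        hence "t \<in> {0<..<1} \<inter> closure P" "t \<in> {0<..<1} \<inter> closure (- P)" using t(1) by blast+
        hence "t \<in> closure ({0<..<1} \<inter> P)" "t \<in> closure ({0<..<1} \<inter> - P)"
          using open_Int_closure_subset[OF open_greaterThanLessThan[of "0::real" 1], of P]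
            open_Int_closure_subset[OF open_greaterThanLessThan[of "0::real" 1], of "- P"] by blast+
        hence "t \<in> closure D" "t \<in> closure (- D)"
          using closure_mono[OF PD(1)] closure_mono[OF PD(2)] by blast+
        thus False using t(2) by (simp add: frontier_closures)
      qed
      moreover have "t \<in> closure P \<or> t \<in> closure (- P)"
        using closure_subset[of P] closure_subset[of "- P"] by blast
      ultimately show "?g t = 0" by auto
    qed
    thus ?thesis by (rule integral_unique)
  qed
  hence "\<forall>\<^sub>F n in sequentially. integral {0..1} (?f n) < e"
    using lim e by (intro order_tendstoD) auto
  then obtain n where n: "integral {0..1} (?f n) < e"
    by (auto simp: eventually_sequentially)
  show ?thesis
  proof (rule that[of "\<lambda>t. 1 - near (- P) n t" "near P n"])
    show "continuous_on UNIV (\<lambda>t. 1 - near (- P) n t)" "continuous_on UNIV (near P n)"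
      by (intro continuous_intros continuous_near)+
    show "1 - near (- P) n (t + 1) = 1 - near (- P) n t" "near P n (t + 1) = near P n t" for t
      using near_periodic[of "- P"] near_periodic[of P] per by simp_all
    show "1 - near (- P) n t \<le> of_bool (frac t \<in> D)" "of_bool (frac t \<in> D) \<le> near P n t" for t
      using near_bounds[where E = P and n = n and t = t] near_bounds[where E = "- P" and n = n and t = t] by (auto simp: P_def)
    have "(\<lambda>t. near P n t - (1 - near (- P) n t)) = ?f n" by (simp add: fun_eq_iff)
    thus "integral {0..1} (\<lambda>t. near P n t - (1 - near (- P) n t)) < e" using n by simp
  qed
qed

lemma has_integral_of_bool_frac:
  assumes D: "D \<subseteq> {0..<1}" "D \<in> lmeasurable"
  shows "((\<lambda>t. of_bool (frac t \<in> D)) has_integral measure lebesgue D) {0..1}"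
proof -
  have "(indicator D has_integral measure lebesgue D) UNIV"
    using D(2) by (simp add: lmeasurable_iff_has_integral)
  moreover have "(\<lambda>t. if t \<in> {0..1} then indicat_real D t else 0) = indicator D"
    using D(1) by (auto simp: fun_eq_iff indicator_def)
  ultimately have ind: "(indicat_real D has_integral measure lebesgue D) {0..1}"
    using has_integral_restrict_UNIV[of "{0..1}" "indicat_real D"] by simp
  have eq: "of_bool (frac t \<in> D) = indicat_real D t" if "t \<in> {0..1} - {1}" for t
  proof -
    have "frac t = t" using that by (simp add: frac_eq)
    thus ?thesis by (simp add: indicator_def)
  qed
  show ?thesis by (rule has_integral_spike_finite[of "{1}", OF _ eq ind]) simp_all
qed


text \<open>The trivial weights give the plain average, which measures the size of
  \<open>Pset\<close> and the error of the squeeze.\<close>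

lemma unit_weights_one:
  assumes "unit_weights S w c L"
  shows "unit_weights S (\<lambda>_ _. 1) c 1"
  using assms by (auto simp: unit_weights_def square_invariant_def card_units_mod)

context unit_weights
begin

text \<open>Replace the indicator by the minorant l. The error is at most M times the plain average
  of u - l, which converges to its small integral.\<close>

lemma tendsto_avg_jordan:
  assumes D: "D \<subseteq> {0..<1}" "D \<in> lmeasurable" "negligible (frontier D)"
    and H: "continuous_on UNIV H" "\<And>x. H (x + 1) = H x"
  shows "(avg (\<lambda>t. of_bool (frac t \<in> D)) H \<longlongrightarrow> L * (of_real (measure lebesgue D) * integral {0..1} H)) F"
proof (rule tendsto_approx)
  fix e :: real assume e: "e > 0"
  interpret one: unit_weights S "\<lambda>_ _. 1" c 1 by (rule unit_weights_one) unfold_locales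
  obtain M where M: "M > 0" "\<And>x. norm (H x) \<le> M"
    using periodic_continuous_bounded[OF H] by blast
  define B where "B = norm (L * integral {0..1} H)"
  \<comment> \<open>One choice for both errors: \<open>M * e'\<close> for the averages and
    \<open>B * e'\<close> for the limits.\<close>
  define e' where "e' = e / (M + B)"
  have B: "B \<ge> 0" by (simp add: B_def)
  have e': "e' > 0" "M * e' \<le> e" "B * e' \<le> e"
    using e M(1) B by (auto simp: e'_def field_simps add_pos_nonneg)
  obtain l u where lu: "continuous_on UNIV l" "continuous_on UNIV u"
      "\<And>t. l (t + 1) = l t" "\<And>t. u (t + 1) = u t"
      "\<And>t. l t \<le> of_bool (frac t \<in> D)" "\<And>t. of_bool (frac t \<in> D) \<le> u t"
      "integral {0..1} (\<lambda>t. u t - l t) < e'"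
    by (rule jordan_squeeze[OF D(1,3) e'(1)]) (assumption | rule that)+
  have cont01: "continuous_on {0..1} l" "continuous_on {0..1} u"
    using lu(1,2) continuous_on_subset by blast+
  have int_of_real: "integral {0..1} (\<lambda>t. complex_of_real (f t)) = of_real (integral {0..1} f)"
    if "continuous_on {0..1} f" for f :: "real \<Rightarrow> real"
    using has_integral_of_real[OF integrable_integral[OF integrable_continuous_real[OF that]]]
    by (rule integral_unique)
  have int_D: "integral {0..1} l \<le> measure lebesgue D" "measure lebesgue D \<le> integral {0..1} u"
    using has_integral_le[OF integrable_integral[OF integrable_continuous_real[OF cont01(1)]]
        has_integral_of_bool_frac[OF D(1,2)]] lu(5)
      has_integral_le[OF has_integral_of_bool_frac[OF D(1,2)]
        integrable_integral[OF integrable_continuous_real[OF cont01(2)]]] lu(6)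
    by auto
  have int_diff: "integral {0..1} (\<lambda>t. u t - l t) = integral {0..1} u - integral {0..1} l"
    by (intro integral_diff integrable_continuous_real cont01)
  let ?d = "\<lambda>t. complex_of_real (u t - l t)"
  have "(one.avg ?d (\<lambda>_. 1) \<longlongrightarrow> 1 * (integral {0..1} ?d * integral {0..1} (\<lambda>_::real. 1))) F"
    using lu(1-4) by (intro one.tendsto_avg_continuous continuous_intros) auto
  moreover have "integral {0..1} ?d = of_real (integral {0..1} (\<lambda>t. u t - l t))"
    by (intro int_of_real continuous_intros cont01)
  ultimately have "((\<lambda>q. norm (one.avg ?d (\<lambda>_. 1) q)) \<longlongrightarrow> norm (complex_of_real (integral {0..1} (\<lambda>t. u t - l t)))) F"
    by (intro tendsto_norm) simp
  moreover have "norm (complex_of_real (integral {0..1} (\<lambda>t. u t - l t))) < e'"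
    unfolding norm_of_real using lu(7) int_diff int_D by linarith
  ultimately have ev: "\<forall>\<^sub>F q in F. norm (one.avg ?d (\<lambda>_. 1) q) < e'"
    by (rule order_tendstoD)
  show "\<exists>g k. (g \<longlongrightarrow> k) F \<and> (\<forall>\<^sub>F q in F. dist (avg (\<lambda>t. of_bool (frac t \<in> D)) H q) (g q) \<le> e) \<and>
      dist k (L * (of_real (measure lebesgue D) * integral {0..1} H)) \<le> e"
  proof (intro exI conjI)
    show "(avg (\<lambda>t. of_real (l t)) H \<longlongrightarrow> L * (integral {0..1} (\<lambda>t. of_real (l t)) * integral {0..1} H)) F"
      using lu(1,3) H by (intro tendsto_avg_continuous continuous_intros) auto
    have pw: "norm (of_bool (frac x \<in> D) * H y - of_real (l x) * H y) \<le> M * (u x - l x)" for x y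
    proof -
      have "norm (of_bool (frac x \<in> D) * H y - of_real (l x) * H y) =
          norm (complex_of_real (of_bool (frac x \<in> D) - l x)) * norm (H y)"
        unfolding norm_mult[symmetric] left_diff_distrib[symmetric] by simp
      also have "\<dots> \<le> (u x - l x) * M"
        unfolding norm_of_real using lu(5,6)[of x] M by (intro mult_mono) auto
      finally show ?thesis by (simp add: mult.commute)
    qed
    have "\<forall>\<^sub>F q in F. q \<in> S" by (rule eventually_F_I)
    with ev show "\<forall>\<^sub>F q in F. dist (avg (\<lambda>t. of_bool (frac t \<in> D)) H q) (avg (\<lambda>t. of_real (l t)) H q) \<le> e"
    proof eventually_elim
      case (elim q)
      have "dist (avg (\<lambda>t. of_bool (frac t \<in> D)) H q) (avg (\<lambda>t. of_real (l t)) H q) \<le>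
          (\<Sum>p\<in>units_mod q. M * (u (of_int p / real q) - l (of_int p / real q))) / real (totient q)"
        unfolding dist_norm by (rule norm_avg_diff_le[OF elim(2) pw])
      also have "\<dots> = M * ((\<Sum>p\<in>units_mod q. u (of_int p / real q) - l (of_int p / real q)) / real (totient q))"
        by (simp add: sum_distrib_left)
      also have "(\<Sum>p\<in>units_mod q. u (of_int p / real q) - l (of_int p / real q)) / real (totient q) \<le>
          norm (one.avg ?d (\<lambda>_. 1) q)"
      proof -
        have "one.avg ?d (\<lambda>_. 1) q =
            of_real ((\<Sum>p\<in>units_mod q. u (of_int p / real q) - l (of_int p / real q)) / real (totient q))"
          by (simp add: one.avg_def)
        thus ?thesis by (simp only: norm_of_real abs_ge_self)
      qed
      also have "\<dots> \<le> e'" using elim(1) by simp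
      finally show ?case using e'(2) M(1) by (simp add: mult_left_mono)
    qed
    have "dist (L * (integral {0..1} (\<lambda>t. of_real (l t)) * integral {0..1} H))
        (L * (of_real (measure lebesgue D) * integral {0..1} H)) =
        B * norm (complex_of_real (integral {0..1} l - measure lebesgue D))"
      unfolding dist_norm B_def norm_mult[symmetric] int_of_real[OF cont01(1)] by (simp add: algebra_simps)
    also have "\<dots> \<le> B * e'"
      unfolding norm_of_real using int_D int_diff lu(7) B by (intro mult_left_mono) linarith+
    finally show "dist (L * (integral {0..1} (\<lambda>t. of_real (l t)) * integral {0..1} H))
        (L * (of_real (measure lebesgue D) * integral {0..1} H)) \<le> e"
      using e'(3) by linarith
  qed
qed

lemma avg_of_bool:
  "avg (\<lambda>t. of_bool (frac t \<in> D)) H q =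
    (\<Sum>p\<in>Pset D q. w q p * H (of_int (c q * minv q p) / real q)) / of_nat (totient q)"
proof -
  have "(\<Sum>p\<in>units_mod q. w q p * (of_bool (frac (of_int p / real q) \<in> D) * H (of_int (c q * minv q p) / real q))) =
      (\<Sum>p\<in>Pset D q. w q p * H (of_int (c q * minv q p) / real q))"
    by (rule sum.mono_neutral_cong_right[OF finite_units_mod]) (auto simp: Pset_def units_mod_def)
  thus ?thesis by (simp add: avg_def)
qed

text \<open>Divide the weighted average over D by the plain one. The positive measure of D is the
  limit of the denominators; it also makes \<open>Pset\<close> eventually nonempty, where
  \<open>pmf_of_set\<close> is meaningful.\<close>

lemma
  assumes D: "D \<subseteq> {0..<1}" "D \<in> lmeasurable" "negligible (frontier D)" "measure lebesgue D > 0"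
  shows eventually_Pset_nonempty: "\<forall>\<^sub>F q in F. Pset D q \<noteq> {}"
    and tendsto_Pset_mean: "continuous_on UNIV H \<Longrightarrow> (\<And>x. H (x + 1) = H x) \<Longrightarrow>
      ((\<lambda>q. (\<Sum>p\<in>Pset D q. w q p * H (of_int (c q * minv q p) / real q)) / of_nat (card (Pset D q))) \<longlongrightarrow>
        L * integral {0..1} H) F"
proof -
  interpret one: unit_weights S "\<lambda>_ _. 1" c 1 by (rule unit_weights_one) unfold_locales
  have "(one.avg (\<lambda>t. of_bool (frac t \<in> D)) (\<lambda>_. 1) \<longlongrightarrow> 1 * (of_real (measure lebesgue D) * integral {0..1} (\<lambda>_::real. 1))) F"
    by (intro one.tendsto_avg_jordan D continuous_intros) auto
  hence card: "((\<lambda>q. of_nat (card (Pset D q)) / complex_of_nat (totient q)) \<longlongrightarrow> of_real (measure lebesgue D)) F"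
    unfolding one.avg_of_bool[abs_def] by simp
  have "\<forall>\<^sub>F q in F. of_nat (card (Pset D q)) / complex_of_nat (totient q) \<noteq> 0"
    by (rule tendsto_imp_eventually_ne[OF card]) (use D(4) in simp)
  thus "\<forall>\<^sub>F q in F. Pset D q \<noteq> {}" by (rule eventually_mono) auto
  assume H: "continuous_on UNIV H" "\<And>x. H (x + 1) = H x"
  have "((\<lambda>q. avg (\<lambda>t. of_bool (frac t \<in> D)) H q / (of_nat (card (Pset D q)) / complex_of_nat (totient q))) \<longlongrightarrow>
      L * (of_real (measure lebesgue D) * integral {0..1} H) / of_real (measure lebesgue D)) F"
    by (intro tendsto_divide tendsto_avg_jordan card D H) (use D(4) in simp)
  moreover have "\<forall>\<^sub>F q in F. avg (\<lambda>t. of_bool (frac t \<in> D)) H q / (of_nat (card (Pset D q)) / complex_of_nat (totient q)) =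
      (\<Sum>p\<in>Pset D q. w q p * H (of_int (c q * minv q p) / real q)) / of_nat (card (Pset D q))"
    by (rule eventually_F_I) (use pos in \<open>simp add: avg_of_bool\<close>)
  ultimately have "((\<lambda>q. (\<Sum>p\<in>Pset D q. w q p * H (of_int (c q * minv q p) / real q)) / of_nat (card (Pset D q))) \<longlongrightarrow>
      L * (of_real (measure lebesgue D) * integral {0..1} H) / of_real (measure lebesgue D)) F"
    by (rule Lim_transform_eventually)
  thus "((\<lambda>q. (\<Sum>p\<in>Pset D q. w q p * H (of_int (c q * minv q p) / real q)) / of_nat (card (Pset D q))) \<longlongrightarrow>
      L * integral {0..1} H) F"
    using D(4) by simp
qed

end

section \<open>Laws and their limits\<close>

lemma finite_Pset: "finite (Pset D q)"
  by (rule finite_subset[of _ "{1..int q}"]) (auto simp: Pset_def)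

lemma Pset_subset_units: "Pset D q \<subseteq> units_mod q"
  by (auto simp: Pset_def units_mod_def)

lemma integral_law_q:
  fixes f :: "'a \<Rightarrow> real"
  assumes "Pset D q \<noteq> {}"
  shows "(\<integral>x. f x \<partial>law_q D E q) = (\<Sum>p\<in>Pset D q. f (E q p)) / card (Pset D q)"
  unfolding law_q_def integral_map_pmf
  by (rule integral_pmf_of_set[OF assms finite_Pset])

lemma prob_space_unifT: "prob_space unifT"
  unfolding unifT_def by (rule prob_space_uniform_measure) auto

lemma sets_unifT [measurable_cong, simp]: "sets unifT = sets borel"
  by (simp add: unifT_def)

lemma integral_unifT:
  fixes g :: "real \<Rightarrow> real"
  assumes "continuous_on UNIV g"
  shows "(\<integral>x. g x \<partial>unifT) = integral {0..1} g"
proof -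
  have meas: "g \<in> borel_measurable borel" using assms by (rule borel_measurable_continuous_onI)
  have d: "unifT = density lborel (\<lambda>x. ennreal (indicator {0..<1} x))"
    unfolding unifT_def uniform_measure_def by (simp add: ennreal_indicator divide_ennreal_def)
  have "(\<integral>x. g x \<partial>unifT) = (\<integral>x. indicator {0..<1} x *\<^sub>R g x \<partial>lborel)"
    unfolding d by (rule integral_density) (use meas in auto)
  also have "\<dots> = (\<integral>x. indicator {0..1} x *\<^sub>R g x \<partial>lborel)"
  proof (rule integral_cong_AE)
    have "AE x in lborel. x \<noteq> (1::real)" by (rule AE_lborel_singleton)
    thus "AE x in lborel. indicator {0..<1} x *\<^sub>R g x = indicator {0..1} x *\<^sub>R g x"
      by eventually_elim (auto simp: indicator_def)
  qed (use meas in measurable)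
  also have "\<dots> = integral {0..1} g"
  proof -
    have "set_integrable lborel {0..1} g"
      using assms continuous_on_subset by (intro borel_integrable_atLeastAtMost') blast
    from set_borel_integral_eq_integral(2)[OF this] show ?thesis by (simp add: set_lebesgue_integral_def)
  qed
  finally show ?thesis .
qed

lemma integral_distr_unifT:
  fixes f :: "complex \<Rightarrow> real"
  assumes "continuous_on UNIV f" "continuous_on UNIV G"
  shows "(\<integral>y. f y \<partial>distr unifT borel G) = integral {0..1} (\<lambda>x. f (G x))"
proof -
  have "f \<in> borel_measurable borel" "G \<in> borel_measurable borel"
    using assms by (auto intro: borel_measurable_continuous_onI)
  hence "(\<integral>y. f y \<partial>distr unifT borel G) = (\<integral>x. f (G x) \<partial>unifT)"
    by (intro integral_distr) (auto cong: measurable_cong_sets)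
  also have "\<dots> = integral {0..1} (\<lambda>x. f (G x))"
    by (intro integral_unifT continuous_on_compose2[OF assms]) simp
  finally show ?thesis .
qed

lemma integral_pair_pmf_distr:
  fixes f :: "complex \<times> complex \<Rightarrow> real"
  assumes f: "continuous_on UNIV f" "bounded (range f)" and G: "continuous_on UNIV G"
    and V: "finite V" "V \<noteq> {}"
  shows "(\<integral>x. f x \<partial>(measure_pmf (pmf_of_set V) \<Otimes>\<^sub>M distr unifT borel G)) =
    (\<Sum>z\<in>V. integral {0..1} (\<lambda>x. f (z, G x))) / card V"
proof -
  have Gm: "G \<in> borel_measurable unifT"
    using borel_measurable_continuous_onI[OF G] by (simp cong: measurable_cong_sets)
  interpret U: prob_space unifT by (rule prob_space_unifT)
  interpret N: prob_space "distr unifT borel G" by (rule U.prob_space_distr[OF Gm])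
  interpret P: pair_prob_space "measure_pmf (pmf_of_set V)" "distr unifT borel G" ..
  let ?M = "measure_pmf (pmf_of_set V) \<Otimes>\<^sub>M distr unifT borel G"
  \<comment> \<open>The sigma-algebra of the first factor is the full power set, so \<open>f\<close>
    is seen to be measurable through the identity into the product of the Borel spaces.\<close>
  have "(\<lambda>z. (fst z, snd z)) \<in> measurable ?M (borel \<Otimes>\<^sub>M borel)"
  proof (rule measurable_Pair)
    show "fst \<in> borel_measurable ?M"
      by (rule measurable_compose[OF measurable_fst, of "\<lambda>x. x"]) simp
    show "snd \<in> borel_measurable ?M"
      by (rule measurable_compose[OF measurable_snd, of "\<lambda>x. x"]) simp
  qed
  moreover have "f \<in> borel_measurable (borel \<Otimes>\<^sub>M borel)"
    unfolding borel_prod using f(1) by (rule borel_measurable_continuous_onI)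
  ultimately have fm: "f \<in> borel_measurable ?M"
    using measurable_compose[of "\<lambda>z. (fst z, snd z)" ?M "borel \<Otimes>\<^sub>M borel" f borel] by simp
  obtain B where B: "\<And>x. norm (f x) \<le> B" using f(2) by (auto simp: bounded_iff)
  have int: "integrable ?M (\<lambda>(x, y). f (x, y))"
    using fm B by (intro P.P.integrable_const_bound[of _ B]) auto
  have "(\<integral>x. f x \<partial>?M) = (\<integral>x. (\<integral>y. f (x, y) \<partial>distr unifT borel G) \<partial>measure_pmf (pmf_of_set V))"
    using P.integral_fst[OF int] by simp
  also have "\<dots> = (\<Sum>z\<in>V. (\<integral>y. f (z, y) \<partial>distr unifT borel G)) / card V"
    by (rule integral_pmf_of_set[OF V(2,1)])
  also have "\<dots> = (\<Sum>z\<in>V. integral {0..1} (\<lambda>x. f (z, G x))) / card V"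
  proof (intro arg_cong2[where f = "(/)"] sum.cong refl integral_distr_unifT G)
    show "continuous_on UNIV (\<lambda>y. f (z, y))" for z
      by (rule continuous_on_compose2[OF f(1)]) (auto intro!: continuous_intros)
  qed
  finally show ?thesis .
qed

text \<open>The data shared by the square and nonsquare cases of a residue class: the series
  \<open>G\<close> and the coefficient \<open>c q\<close> of its argument.\<close>

locale gauss_family =
  fixes D :: "real set" and S :: "nat set" and c :: "nat \<Rightarrow> int" and G :: "real \<Rightarrow> complex"
  assumes D: "D \<subseteq> {0..<1}" "D \<in> lmeasurable" "negligible (frontier D)" "measure lebesgue D > 0"
    and S: "q \<in> S \<Longrightarrow> q > 0" and gcd_c: "q \<in> S \<Longrightarrow> gcd (c q) (int q) \<le> 2"
    and G: "continuous_on UNIV G" "G (x + 1) = G x"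
begin

lemma of_bool_complex: "complex_of_real (of_bool b) = of_bool b"
  by (cases b) auto

text \<open>Asymptotic independence: the event \<open>P\<close> has frequency exactly 1/n among all
  units, and restricting to it multiplies the limiting integral by just this factor.\<close>

lemma tendsto_mean:
  fixes f :: "complex \<Rightarrow> real"
  assumes w: "\<And>q. q \<in> S \<Longrightarrow> square_invariant q (\<lambda>p. of_bool (P q p))"
    and mean: "\<And>q. q \<in> S \<Longrightarrow> n * card {p\<in>units_mod q. P q p} = totient q"
    and f: "continuous_on UNIV f" and n: "n > 0"
  shows "((\<lambda>q. (\<Sum>p\<in>Pset D q. of_bool (P q p) * f (G (of_int (c q * minv q p) / real q))) / card (Pset D q)) \<longlongrightarrow>
    integral {0..1} (\<lambda>x. f (G x)) / n) (at_top \<sqinter> principal S)"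
proof -
  have cont: "continuous_on UNIV (\<lambda>x. f (G x))"
    by (rule continuous_on_compose2[OF f G(1)]) simp
  interpret unit_weights S "\<lambda>q p. of_bool (P q p)" c "1 / of_nat n"
  proof
    fix q assume q: "q \<in> S"
    have "(\<Sum>p\<in>units_mod q. of_bool (P q p)) = complex_of_nat (card {p\<in>units_mod q. P q p})"
      by (simp add: of_bool_def sum.inter_filter[symmetric])
    moreover have "of_nat n * complex_of_nat (card {p\<in>units_mod q. P q p}) = of_nat (totient q)"
      unfolding mean[OF q, symmetric] by simp
    ultimately show "(\<Sum>p\<in>units_mod q. of_bool (P q p)) = 1 / of_nat n * complex_of_nat (totient q)"
      using n by (simp add: field_simps)
  qed (use S w gcd_c in auto)
  have "((\<lambda>q. (\<Sum>p\<in>Pset D q. of_bool (P q p) * complex_of_real (f (G (of_int (c q * minv q p) / real q)))) /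
      of_nat (card (Pset D q))) \<longlongrightarrow> 1 / of_nat n * integral {0..1} (\<lambda>x. complex_of_real (f (G x)))) F"
    by (rule tendsto_Pset_mean[OF D]) (use cont G in \<open>auto intro!: continuous_intros\<close>)
  moreover have "integral {0..1} (\<lambda>x. complex_of_real (f (G x))) = of_real (integral {0..1} (\<lambda>x. f (G x)))"
    using cont continuous_on_subset
    by (intro integral_unique has_integral_of_real integrable_integral integrable_continuous_real) blast
  ultimately have "((\<lambda>q. complex_of_real ((\<Sum>p\<in>Pset D q. of_bool (P q p) * f (G (of_int (c q * minv q p) / real q))) /
      card (Pset D q))) \<longlongrightarrow> of_real (integral {0..1} (\<lambda>x. f (G x)) / n)) F"
    by (simp add: of_bool_complex)
  thus ?thesis unfolding tendsto_of_real_iff .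
qed

lemma eventually_nonempty: "\<forall>\<^sub>F q in at_top \<sqinter> principal S. Pset D q \<noteq> {}"
proof -
  interpret unit_weights S "\<lambda>_ _. 1" c 1
    by unfold_locales (use S gcd_c in \<open>auto simp: square_invariant_def card_units_mod\<close>)
  show ?thesis by (rule eventually_Pset_nonempty[OF D])
qed

lemma conv_distr_single:
  assumes E: "\<And>q p. q \<in> S \<Longrightarrow> p \<in> units_mod q \<Longrightarrow> E q p = G (of_int (c q * minv q p) / real q)"
  shows "conv_distr (law_q D E) (distr unifT borel G) (at_top \<sqinter> principal S)"
  unfolding conv_distr_def
proof (intro allI impI)
  fix f :: "complex \<Rightarrow> real" assume f: "continuous_on UNIV f"
  \<comment> \<open>The trivial event has frequency 1, so this is equidistribution of the argument
    of \<open>G\<close> alone.\<close>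
  have "((\<lambda>q. (\<Sum>p\<in>Pset D q. of_bool True * f (G (of_int (c q * minv q p) / real q))) / card (Pset D q)) \<longlongrightarrow>
      integral {0..1} (\<lambda>x. f (G x)) / (1::nat)) (at_top \<sqinter> principal S)"
    by (rule tendsto_mean) (use f in \<open>auto simp: square_invariant_def card_units_mod\<close>)
  moreover have "\<forall>\<^sub>F q in at_top \<sqinter> principal S. q \<in> S" by (simp add: eventually_inf_principal)
  hence "\<forall>\<^sub>F q in at_top \<sqinter> principal S.
      (\<Sum>p\<in>Pset D q. of_bool True * f (G (of_int (c q * minv q p) / real q))) / card (Pset D q) =
      (\<integral>x. f x \<partial>law_q D E q)"
    using eventually_nonempty
  proof eventually_elim
    case (elim q)
    thus ?case using E[OF elim(1)] Pset_subset_units[of D q]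
      by (auto simp: integral_law_q intro!: sum.cong arg_cong2[where f = "(/)"])
  qed
  ultimately have "((\<lambda>q. \<integral>x. f x \<partial>law_q D E q) \<longlongrightarrow> integral {0..1} (\<lambda>x. f (G x)) / (1::nat)) (at_top \<sqinter> principal S)"
    by (rule Lim_transform_eventually)
  thus "((\<lambda>q. \<integral>x. f x \<partial>law_q D E q) \<longlongrightarrow> (\<integral>x. f x \<partial>distr unifT borel G)) (at_top \<sqinter> principal S)"
    using integral_distr_unifT[OF f G(1)] by simp
qed

text \<open>As \<open>u\<close> takes values in the finite set \<open>V\<close>, a test function
  splits into the slices \<open>f (z, _)\<close> weighted by the event \<open>u q p = z\<close>, and
  each slice is covered by \<open>tendsto_mean\<close>.\<close>

lemma conv_distr_pair:
  fixes u :: "nat \<Rightarrow> int \<Rightarrow> complex"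
  assumes V: "finite V" "V \<noteq> {}"
    and per: "\<And>q p p'. q \<in> S \<Longrightarrow> [p = p'] (mod int q) \<Longrightarrow> u q p = u q p'"
    and sq: "\<And>q p v. q \<in> S \<Longrightarrow> coprime v (int q) \<Longrightarrow> u q (p * v\<^sup>2) = u q p"
    and val: "\<And>q p. q \<in> S \<Longrightarrow> p \<in> units_mod q \<Longrightarrow> u q p \<in> V"
    and unif: "\<And>q z. q \<in> S \<Longrightarrow> z \<in> V \<Longrightarrow> card V * card {p\<in>units_mod q. u q p = z} = totient q"
    and E: "\<And>q p. q \<in> S \<Longrightarrow> p \<in> units_mod q \<Longrightarrow> E q p = (u q p, G (of_int (c q * minv q p) / real q))"
  shows "conv_distr (law_q D E) (measure_pmf (pmf_of_set V) \<Otimes>\<^sub>M distr unifT borel G) (at_top \<sqinter> principal S)"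
  unfolding conv_distr_def
proof (intro allI impI)
  fix f :: "complex \<times> complex \<Rightarrow> real" assume f: "continuous_on UNIV f" "bounded (range f)"
  let ?x = "\<lambda>q p. of_int (c q * minv q p) / real q"
  have "((\<lambda>q. \<Sum>z\<in>V. (\<Sum>p\<in>Pset D q. of_bool (u q p = z) * f (z, G (?x q p))) / card (Pset D q)) \<longlongrightarrow>
      (\<Sum>z\<in>V. integral {0..1} (\<lambda>x. f (z, G x)) / card V)) (at_top \<sqinter> principal S)"
  proof (rule tendsto_sum)
    fix z assume z: "z \<in> V"
    show "((\<lambda>q. (\<Sum>p\<in>Pset D q. of_bool (u q p = z) * f (z, G (?x q p))) / card (Pset D q)) \<longlongrightarrow>
      integral {0..1} (\<lambda>x. f (z, G x)) / card V) (at_top \<sqinter> principal S)"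
    proof (rule tendsto_mean[where f = "\<lambda>y. f (z, y)"])
      show "continuous_on UNIV (\<lambda>y. f (z, y))"
        by (rule continuous_on_compose2[OF f(1)]) (auto intro!: continuous_intros)
      show "square_invariant q (\<lambda>p. of_bool (u q p = z))" if "q \<in> S" for q
        unfolding square_invariant_def using sq[OF that] per[OF that] by (auto simp: of_bool_def)
    qed (use V unif z in \<open>auto simp: card_gt_0_iff\<close>)
  qed
  moreover have "\<forall>\<^sub>F q in at_top \<sqinter> principal S. q \<in> S" by (simp add: eventually_inf_principal)
  hence "\<forall>\<^sub>F q in at_top \<sqinter> principal S.
      (\<Sum>z\<in>V. (\<Sum>p\<in>Pset D q. of_bool (u q p = z) * f (z, G (?x q p))) / card (Pset D q)) =
      (\<integral>x. f x \<partial>law_q D E q)"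
    using eventually_nonempty
  proof eventually_elim
    case (elim q)
    have "(\<Sum>z\<in>V. \<Sum>p\<in>Pset D q. of_bool (u q p = z) * f (z, G (?x q p))) =
        (\<Sum>p\<in>Pset D q. \<Sum>z\<in>V. of_bool (u q p = z) * f (z, G (?x q p)))" by (rule sum.swap)
    also have "\<dots> = (\<Sum>p\<in>Pset D q. f (E q p))"
    proof (rule sum.cong[OF refl])
      fix p assume "p \<in> Pset D q"
      hence p: "p \<in> units_mod q" using Pset_subset_units by blast
      have "(\<Sum>z\<in>V. of_bool (u q p = z) * f (z, G (?x q p))) =
          (\<Sum>z\<in>V. if u q p = z then f (u q p, G (?x q p)) else 0)"
        by (intro sum.cong refl) auto
      also have "\<dots> = f (E q p)" using V(1) val[OF elim(1) p] E[OF elim(1) p] by (simp add: sum.delta')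
      finally show "(\<Sum>z\<in>V. of_bool (u q p = z) * f (z, G (?x q p))) = f (E q p)" .
    qed
    finally show ?case by (simp add: integral_law_q[OF elim(2)] sum_divide_distrib[symmetric])
  qed
  ultimately have "((\<lambda>q. \<integral>x. f x \<partial>law_q D E q) \<longlongrightarrow> (\<Sum>z\<in>V. integral {0..1} (\<lambda>x. f (z, G x)) / card V))
      (at_top \<sqinter> principal S)"
    by (rule Lim_transform_eventually)
  thus "((\<lambda>q. \<integral>x. f x \<partial>law_q D E q) \<longlongrightarrow>
      (\<integral>x. f x \<partial>(measure_pmf (pmf_of_set V) \<Otimes>\<^sub>M distr unifT borel G))) (at_top \<sqinter> principal S)"
    unfolding integral_pair_pmf_distr[OF f G(1) V] sum_divide_distrib .
qed

end


section \<open>Assembling the six cases\<close>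

text \<open>Zero is a multiple of 4 and a square, so it lies in the second class of moduli, but the
  lemmas on Gauss sums assume positive q.\<close>

lemma at_top_principal_remove_0: "at_top \<sqinter> principal S = at_top \<sqinter> principal (S - {0::nat})"
proof (rule filter_eqI)
  fix P
  have "(\<forall>\<^sub>F q in at_top. q \<in> S \<longrightarrow> P q) \<longleftrightarrow> (\<forall>\<^sub>F q in at_top. q \<in> S - {0} \<longrightarrow> P q)"
    by (rule eventually_cong[OF eventually_gt_at_top[of 0]]) auto
  thus "eventually P (at_top \<sqinter> principal S) \<longleftrightarrow> eventually P (at_top \<sqinter> principal (S - {0}))"
    by (simp add: eventually_inf_principal)
qed

lemma gcd_minv_le: "coprime a (int q) \<Longrightarrow> gcd (- minv q a) (int q) \<le> 2"
  using coprime_modular_inverse[of a "int q"] by (simp add: coprime_iff_gcd_eq_1)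

lemma gcd_double_minv_le:
  assumes "coprime a (int r)"
  shows "gcd (- 2 * minv r a) (int (2 * r)) \<le> 2"
proof -
  have "gcd (- 2 * minv r a) (int (2 * r)) = gcd (2 * minv r a) (2 * int r)" by simp
  also have "\<dots> = 2 * gcd (minv r a) (int r)" using gcd_mult_distrib_int[of 2 "minv r a" "int r"] by simp
  finally show ?thesis using coprime_modular_inverse[OF assms] by (simp add: coprime_iff_gcd_eq_1)
qed

lemma gauss1_nonzero_0_mod_4:
  assumes "4 dvd q" "q > 0" "coprime p (int q)"
  shows "gauss1 p q \<noteq> 0"
proof
  assume "gauss1 p q = 0"
  hence "em 4 p = 0" using gauss1_0_mod_4_square[OF assms(1,3,2)] assms(2) by simp
  thus False using norm_em[of 4 p] by simp
qed

lemma gauss1_nonzero_odd: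
  assumes "odd q" "coprime p (int q)"
  shows "gauss1 p q \<noteq> 0"
  using gauss1_odd_sign[OF assms] by auto

lemma gauss1_value_0_mod_4:
  assumes "4 dvd q" "q > 0" "coprime p (int q)"
  shows "gauss1 p q / sqrt (real q) \<in> {1 + \<i>, 1 - \<i>, -1 + \<i>, -1 - \<i>}"
  using gsign_sign[OF assms] chi4_sign[OF coprime_4_dvd_odd[OF assms(1,3)]]
  unfolding gauss1_conv_gsign[OF assms] by auto

lemma coprime_2_4_8:
  assumes "odd q"
  shows "coprime 2 (int q)" "coprime 4 (int q)" "coprime 8 (int q)"
  using coprime_power_left_iff[of "2::int" 2 "int q"] coprime_power_left_iff[of "2::int" 3 "int q"] assms
  by simp_all

theorem theorem1p1:
  fixes D :: "real set" and \<phi> :: "real \<Rightarrow> complex"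
  assumes "D \<subseteq> {0..<1}"
    and "emeasure lebesgue (frontier D) = 0"
    and "emeasure lebesgue D > 0"
    and "\<phi> \<in> BT"
  shows
   "conv_distr
      (law_q D (\<lambda>q p. (gauss1 p q / sqrt (real q), gauss \<phi> p q / gauss1 p q)))
      (measure_pmf lawX \<Otimes>\<^sub>M distr unifT borel (Gplus \<phi>))
      (at_top \<sqinter> principal {q. q mod 4 = 0 \<and> \<not> is_square q})
    \<and> conv_distr
      (law_q D (\<lambda>q p. (gauss1 p q / sqrt (real q), gauss \<phi> p q / gauss1 p q)))
      (measure_pmf lawZ \<Otimes>\<^sub>M distr unifT borel (Gplus \<phi>))
      (at_top \<sqinter> principal {q. q mod 4 = 0 \<and> is_square q})
    \<and> conv_distr
      (law_q D (\<lambda>q p. (gauss1 p q / (eps q * sqrt (real q)), gauss \<phi> p q / gauss1 p q)))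
      (measure_pmf lawY \<Otimes>\<^sub>M distr unifT borel (Gfull \<phi>))
      (at_top \<sqinter> principal {q. odd q \<and> \<not> is_square q})
    \<and> conv_distr
      (law_q D (\<lambda>q p. gauss \<phi> p q / (eps q * sqrt (real q))))
      (distr unifT borel (Gfull \<phi>))
      (at_top \<sqinter> principal {q. odd q \<and> is_square q})
    \<and> conv_distr
      (law_q D (\<lambda>q p. (gauss1 (2 * p) (q div 2) / (eps (q div 2) * sqrt (real (q div 2))),
                      gauss \<phi> p q / (2 * gauss1 (2 * p) (q div 2)))))
      (measure_pmf lawY \<Otimes>\<^sub>M distr unifT borel (Gminus \<phi>))
      (at_top \<sqinter> principal {q. q mod 4 = 2 \<and> \<not> is_square (q div 2)})
    \<and> conv_distr
      (law_q D (\<lambda>q p. gauss \<phi> p q / (eps (q div 2) * sqrt (2 * real q))))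
      (distr unifT borel (Gminus \<phi>))
      (at_top \<sqinter> principal {q. q mod 4 = 2 \<and> is_square (q div 2)})"
proof -
  note \<phi> = assms(4)
  \<comment> \<open>A non-measurable set has \<open>emeasure\<close> 0 by convention, so positivity
    already gives measurability.\<close>
  have D_sets: "D \<in> sets lebesgue" using assms(3) emeasure_notin_sets by fastforce
  have "bounded D"
    by (rule bounded_subset[OF bounded_closed_interval[of 0 1]]) (use assms(1) in auto)
  hence D_meas: "D \<in> lmeasurable" using D_sets by (rule bounded_set_imp_lmeasurable)
  have D_null: "negligible (frontier D)"
    unfolding negligible_iff_null_sets using assms(2) by (intro null_setsI) auto
  have D_pos: "measure lebesgue D > 0"
    using assms(3) emeasure_eq_measure2[OF D_meas] by simp
  note D = assms(1) D_meas D_null D_pos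
  let ?S4 = "{q. q mod 4 = 0} - {0} :: nat set"
  have zero: "is_square 0" by (auto simp: is_square_def)

  \<comment> \<open>Three families serve the six cases. The coefficient is -1 if 4 divides q, minus
    the inverse of 4 modulo q if q is odd, and -2 times the inverse of 8 modulo q/2
    otherwise.\<close>
  have even_family: "gauss_family D S (\<lambda>_. - 1) (Gplus \<phi>)" if "S \<subseteq> ?S4" for S
    using that by unfold_locales (use D \<phi> in \<open>auto simp: continuous_Gplus Gplus_periodic\<close>)
  have even_pair: "(gauss1 p q / sqrt (real q), gauss \<phi> p q / gauss1 p q) =
      (gauss1 p q / sqrt (real q), Gplus \<phi> (of_int (- 1 * minv q p) / real q))"
    if "q \<in> ?S4" "p \<in> units_mod q" for q p
  proof -
    have q: "4 dvd q" "q > 0" "coprime p (int q)" using that units_modD by auto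
    show ?thesis using gauss_0_mod_4[OF \<phi> q] gauss1_nonzero_0_mod_4[OF q] by simp
  qed
  have per: "gauss1 p q / k = gauss1 p' q / k" if "[p = p'] (mod int q)" for p p' q k
    using gauss1_cong[OF that] by simp
  have sq: "gauss1 (p * v\<^sup>2) q / k = gauss1 p q / k" if "q > 0" "coprime v (int q)" for p v q k
    using gauss1_mult_square[OF that(2,1)] by simp

  have odd_family: "gauss_family D S (\<lambda>q. - minv q 4) (Gfull \<phi>)" if "S \<subseteq> {q. odd q}" for S
  proof
    fix q assume "q \<in> S"
    hence q: "odd q" using that by blast
    show "q > 0" using q by (cases q) auto
    show "gcd (- minv q 4) (int q) \<le> 2" by (rule gcd_minv_le[OF coprime_2_4_8(2)[OF q]])
  qed (use D \<phi> in \<open>auto simp: continuous_Gfull Gfull_periodic\<close>)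

  have half: "odd (q div 2)" "q = 2 * (q div 2)" if "q mod 4 = 2" for q :: nat
    using that by presburger+
  have half_family: "gauss_family D S (\<lambda>q. - 2 * minv (q div 2) 8) (Gminus \<phi>)" if "S \<subseteq> {q. q mod 4 = 2}" for S
  proof
    fix q assume "q \<in> S"
    hence q: "q mod 4 = 2" using that by blast
    show "q > 0" using q by (cases q) auto
    show "gcd (- 2 * minv (q div 2) 8) (int q) \<le> 2"
      using gcd_double_minv_le[OF coprime_2_4_8(3)[OF half(1)[OF q]]] half(2)[OF q] by simp
  qed (use D \<phi> in \<open>auto simp: continuous_Gminus Gminus_periodic\<close>)
  have half_units: "coprime p (int (q div 2))" "coprime (2 * p) (int (q div 2))" "coprime p (int q)"
    if "q mod 4 = 2" "coprime p (int q)" for p q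
  proof -
    have "int q = 2 * int (q div 2)" using half(2)[OF that(1)] by simp
    thus "coprime p (int (q div 2))" using that(2) by (metis coprime_mult_right_iff)
    thus "coprime (2 * p) (int (q div 2))" using coprime_2_4_8(1)[OF half(1)[OF that(1)]] by simp
  qed (fact that(2))

  show ?thesis
  proof (intro conjI, goal_cases)
    case 1
    let ?S = "{q. q mod 4 = 0 \<and> \<not> is_square q}"
    have sub: "?S \<subseteq> ?S4" using zero by auto
    interpret gauss_family D ?S "\<lambda>_. - 1" "Gplus \<phi>" by (rule even_family[OF sub])
    have d: "4 dvd q" "q > 0" "\<not> is_square q" if "q \<in> ?S" for q using that S[OF that] by auto
    show ?case unfolding lawX_def
    proof (rule conv_distr_pair[where u = "\<lambda>q p. gauss1 p q / sqrt (real q)"])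
      fix q p assume q: "q \<in> ?S" and p: "p \<in> units_mod q"
      show "gauss1 p q / sqrt (real q) \<in> {1 + \<i>, 1 - \<i>, -1 + \<i>, -1 - \<i>}"
        by (rule gauss1_value_0_mod_4[OF d(1,2)[OF q] units_modD[OF p]])
      show "(gauss1 p q / sqrt (real q), gauss \<phi> p q / gauss1 p q) =
          (gauss1 p q / sqrt (real q), Gplus \<phi> (of_int (- 1 * minv q p) / real q))"
        using even_pair[OF subsetD[OF sub q] p] .
    next
      fix q z assume q: "q \<in> ?S" and z: "z \<in> {1 + \<i>, 1 - \<i>, -1 + \<i>, -1 - \<i>}"
      have "card {1 + \<i>, 1 - \<i>, -1 + \<i>, -1 - \<i>} = 4" by (simp add: complex_eq_iff)
      thus "card {1 + \<i>, 1 - \<i>, -1 + \<i>, -1 - \<i>} * card {p\<in>units_mod q. gauss1 p q / sqrt (real q) = z} = totient q"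
        using gauss1_law_0_mod_4_nonsquare[OF d[OF q] z] by simp
    next
      fix q p p' assume "[p = p'] (mod int q)"
      thus "gauss1 p q / sqrt (real q) = gauss1 p' q / sqrt (real q)" by (rule per)
    next
      fix q p v assume "q \<in> ?S" "coprime v (int q)"
      thus "gauss1 (p * v\<^sup>2) q / sqrt (real q) = gauss1 p q / sqrt (real q)" using d(2) by (intro sq)
    qed simp_all
  next
    case 2
    let ?S = "{q. q mod 4 = 0 \<and> is_square q} - {0}"
    have sub: "?S \<subseteq> ?S4" by auto
    interpret gauss_family D ?S "\<lambda>_. - 1" "Gplus \<phi>" by (rule even_family[OF sub])
    have d: "4 dvd q" "q > 0" "is_square q" if "q \<in> ?S" for q using that by auto
    show ?case unfolding lawZ_def at_top_principal_remove_0[of "{q. q mod 4 = 0 \<and> is_square q}"]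
    proof (rule conv_distr_pair[where u = "\<lambda>q p. gauss1 p q / sqrt (real q)"])
      fix q p assume q: "q \<in> ?S" and p: "p \<in> units_mod q"
      show "gauss1 p q / sqrt (real q) \<in> {1 + \<i>, 1 - \<i>}"
        using gauss1_law_0_mod_4_square(2)[OF d[OF q], of "1 + \<i>" p] p by simp
      show "(gauss1 p q / sqrt (real q), gauss \<phi> p q / gauss1 p q) =
          (gauss1 p q / sqrt (real q), Gplus \<phi> (of_int (- 1 * minv q p) / real q))"
        using even_pair[OF subsetD[OF sub q] p] .
    next
      fix q z assume q: "q \<in> ?S" and z: "z \<in> {1 + \<i>, 1 - \<i>}"
      have "card {1 + \<i>, 1 - \<i>} = 2" by (simp add: complex_eq_iff)
      thus "card {1 + \<i>, 1 - \<i>} * card {p\<in>units_mod q. gauss1 p q / sqrt (real q) = z} = totient q"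
        using gauss1_law_0_mod_4_square(1)[OF d[OF q] z] by simp
    next
      fix q p p' assume "[p = p'] (mod int q)"
      thus "gauss1 p q / sqrt (real q) = gauss1 p' q / sqrt (real q)" by (rule per)
    next
      fix q p v assume "q \<in> ?S" "coprime v (int q)"
      thus "gauss1 (p * v\<^sup>2) q / sqrt (real q) = gauss1 p q / sqrt (real q)" using d(2) by (intro sq)
    qed simp_all
  next
    case 3
    let ?S = "{q. odd q \<and> \<not> is_square q}"
    interpret gauss_family D ?S "\<lambda>q. - minv q 4" "Gfull \<phi>" by (rule odd_family) auto
    show ?case unfolding lawY_def
    proof (rule conv_distr_pair[where u = "\<lambda>q p. gauss1 p q / (eps q * sqrt (real q))"])
      fix q p assume "q \<in> ?S" and p: "p \<in> units_mod q"
      hence q: "odd q" by simp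
      show "gauss1 p q / (eps q * sqrt (real q)) \<in> {1, - 1}"
        using gauss1_odd_sign[OF q units_modD[OF p]] by simp
      show "(gauss1 p q / (eps q * sqrt (real q)), gauss \<phi> p q / gauss1 p q) =
          (gauss1 p q / (eps q * sqrt (real q)), Gfull \<phi> (of_int (- minv q 4 * minv q p) / real q))"
        using gauss_odd[OF \<phi> q units_modD[OF p]] gauss1_nonzero_odd[OF q units_modD[OF p]] by simp
    next
      fix q z assume q: "q \<in> ?S" and z: "z \<in> {1, - 1 :: complex}"
      show "card {1, - 1 :: complex} * card {p\<in>units_mod q. gauss1 p q / (eps q * sqrt (real q)) = z} = totient q"
        using gauss1_law_odd_nonsquare[of q z] q z by simp
    next
      fix q p p' assume "[p = p'] (mod int q)"
      thus "gauss1 p q / (eps q * sqrt (real q)) = gauss1 p' q / (eps q * sqrt (real q))" by (rule per)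
    next
      fix q p v assume "q \<in> ?S" "coprime v (int q)"
      thus "gauss1 (p * v\<^sup>2) q / (eps q * sqrt (real q)) = gauss1 p q / (eps q * sqrt (real q))"
        using S by (intro sq)
    qed simp_all
  next
    case 4
    let ?S = "{q. odd q \<and> is_square q}"
    interpret gauss_family D ?S "\<lambda>q. - minv q 4" "Gfull \<phi>" by (rule odd_family) auto
    show ?case
    proof (rule conv_distr_single)
      fix q p assume "q \<in> ?S" and p: "p \<in> units_mod q"
      hence q: "odd q" "is_square q" by simp_all
      have "gauss \<phi> p q / (eps q * sqrt (real q)) = (gauss1 p q / (eps q * sqrt (real q))) *
          Gfull \<phi> (of_int (- minv q 4 * minv q p) / real q)"
        using gauss_odd[OF \<phi> q(1) units_modD[OF p]] by simp
      thus "gauss \<phi> p q / (eps q * sqrt (real q)) = Gfull \<phi> (of_int (- minv q 4 * minv q p) / real q)"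
        using gauss1_odd_sign_square[OF q units_modD[OF p]] by simp
    qed
  next
    case 5
    let ?S = "{q. q mod 4 = 2 \<and> \<not> is_square (q div 2)}"
    let ?u = "\<lambda>q p. gauss1 (2 * p) (q div 2) / (eps (q div 2) * sqrt (real (q div 2)))"
    interpret gauss_family D ?S "\<lambda>q. - 2 * minv (q div 2) 8" "Gminus \<phi>" by (rule half_family) auto
    show ?case unfolding lawY_def
    proof (rule conv_distr_pair[where u = ?u])
      fix q p assume "q \<in> ?S" and p: "p \<in> units_mod q"
      hence q: "q mod 4 = 2" by simp
      have cop: "coprime (2 * p) (int (q div 2))" by (rule half_units(2)[OF q units_modD[OF p]])
      show "?u q p \<in> {1, - 1}"
        using gauss1_odd_sign[OF half(1)[OF q] cop] by simp
      show "(?u q p,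
            gauss \<phi> p q / (2 * gauss1 (2 * p) (q div 2))) =
          (?u q p,
            Gminus \<phi> (of_int (- 2 * minv (q div 2) 8 * minv q p) / real q))"
        using gauss_2_mod_4[OF \<phi> half(2,1)[OF q] units_modD[OF p]] gauss1_nonzero_odd[OF half(1)[OF q] cop]
        by simp
    next
      fix q z assume q: "q \<in> ?S" and z: "z \<in> {1, - 1 :: complex}"
      hence h: "odd (q div 2)" "q = 2 * (q div 2)" "\<not> is_square (q div 2)" using half by auto
      show "card {1, - 1 :: complex} * card {p\<in>units_mod q.
          ?u q p = z} = totient q"
        using gauss1_law_2_mod_4_nonsquare[OF h(1,3) z] h(2) by simp
    next
      fix q p p' assume q: "q \<in> ?S" and c: "[p = p'] (mod int q)"
      have "int (q div 2) dvd int q" using half(2)[of q] q by (metis (mono_tags) dvd_triv_right int_dvd_int_iff mem_Collect_eq)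
      hence "[2 * p = 2 * p'] (mod int (q div 2))"
        using c by (intro cong_mult cong_refl) (rule cong_dvd_modulus)
      thus "?u q p =
          ?u q p'" by (rule per)
    next
      fix q p v assume q: "q \<in> ?S" and v: "coprime v (int q)"
      have "q div 2 > 0" using half(1)[of q] q by (auto intro: gr0I)
      thus "?u q (p * v\<^sup>2) =
          ?u q p"
        using sq[of "q div 2" v "2 * p"] half_units(1)[OF _ v] q by (simp add: mult.assoc)
    qed simp_all
  next
    case 6
    let ?S = "{q. q mod 4 = 2 \<and> is_square (q div 2)}"
    interpret gauss_family D ?S "\<lambda>q. - 2 * minv (q div 2) 8" "Gminus \<phi>" by (rule half_family) auto
    show ?case
    proof (rule conv_distr_single)
      fix q p assume "q \<in> ?S" and p: "p \<in> units_mod q"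
      hence q: "q mod 4 = 2" "is_square (q div 2)" by simp_all
      have cop: "coprime (2 * p) (int (q div 2))" by (rule half_units(2)[OF q(1) units_modD[OF p]])
      \<comment> \<open>The resulting factor 2 in the root cancels the 2 in
        \<open>gauss_2_mod_4\<close>.\<close>
      have "2 * real q = 2\<^sup>2 * real (q div 2)" by (subst half(2)[OF q(1)]) simp
      hence "sqrt (2 * real q) = 2 * sqrt (real (q div 2))" by (simp only: real_sqrt_mult) simp
      hence "gauss \<phi> p q / (eps (q div 2) * sqrt (2 * real q)) =
          (gauss1 (2 * p) (q div 2) / (eps (q div 2) * sqrt (real (q div 2)))) *
          Gminus \<phi> (of_int (- 2 * minv (q div 2) 8 * minv q p) / real q)"
        using gauss_2_mod_4[OF \<phi> half(2,1)[OF q(1)] units_modD[OF p]] by simp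
      thus "gauss \<phi> p q / (eps (q div 2) * sqrt (2 * real q)) =
          Gminus \<phi> (of_int (- 2 * minv (q div 2) 8 * minv q p) / real q)"
        using gauss1_odd_sign_square[OF half(1)[OF q(1)] q(2) cop] by simp
    qed
  qed
qed

end
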